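(* Let $A$ be a commutative monoid object in $(\mathbf C,\otimes,1)$ and let $\{t_i\}_{i\in I}$ be a collection of elements $t_i\in\mathcal E(A)$ such that the collection $\{Spec(A_{t_i})\longrightarrow Spec(A)\}_{i\in I}$ forms a Zariski open cover of $Spec(A)$. Then there exists a finite subcollection $\{t_i\}_{i\in I'}$, $I'\subseteq I$, that is a partition of unity on $A$.
   Context: Standing assumptions: $(\mathbf C,\otimes,1)$ is an abelian symmetric monoidal category with small limits and small colimits such that for every object $X$ the functor $-\otimes X$ preserves colimits. $Comm(\mathbf C)$ is the category of unital commutative monoid objects in $\mathbf C$ (all monoids are unital and commutative), and $A\text{-}Mod$ is the category of modules over $A\in Comm(\mathbf C)$. For every monoid $A$, filtered colimits commute with finite limits in $A\text{-}Mod$. Moreover: (C1) $Hom_{\mathbf C}(1,-)$ preserves filtered colimits, and for every monoid $A$ and every finite (not necessarily filtered) system of $A$-modules of the form $\{A^{r_i}\}_{i\in I}$, $r_i\ge 0$, the canonical map $colim_{i}\,Hom_{A-Mod}(A,A^{r_i})\to Hom_{A-Mod}(A,colim_i A^{r_i})$ is an isomorphism. (C2) For every monoid $A$, every object of $A\text{-}Mod$ is a directed colimit of finitely presented objects, where $M$ is finitely presented if $Hom_{A-Mod}(M,-)$ preserves directed colimits. $\mathcal E(A):=Hom_{A-Mod}(A,A)$, a commutative ring under composition; a morphism $g:A\to B$ in $Comm(\mathbf C)$ induces by base change a ring homomorphism $\mathcal E(g):\mathcal E(A)\to\mathcal E(B)$. Partition of unity on $A$: a finite collection $\{t_i\}_{i\in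 I}$ of elements of $\mathcal E(A)$ for which there exist $s_i\in\mathcal E(A)$, $i\in I$, with $\sum_{i\in I}s_it_i=1$. Localisation: for $t\in\mathcal E(A)$, $A_t:=colim(A\overset{t}{\to}A\overset{t}{\to}A\overset{t}{\to}\cdots)$, which is a commutative monoid with canonical monoid morphism $I_t:A\to A_t$; it is a flat $A$-module, $\mathcal E(I_t)(t)$ is invertible, and $I_t$ is universal among monoid morphisms $g:A\to B$ with $\mathcal E(g)(t)$ invertible. $Aff_{\mathbf C}:=Comm(\mathbf C)^{op}$, with $Spec(A)$ the object corresponding to $A$. A morphism $Spec(B)\to Spec(A)$ given by $f:A\to B$ is a Zariski open immersion if $f$ is flat ($-\otimes_AB:A\text{-}Mod\to B\text{-}Mod$ preserves finite limits), an epimorphism in $Comm(\mathbf C)$, and of finite presentation (for every filtered system $\{A'_i\}$ in $A/Comm(\mathbf C)$ the natural map $colim_i Hom_{A/Comm(\mathbf C)}(B,A'_i)\to Hom_{A/Comm(\mathbf C)}(B,colim_iA'_i)$ is an isomorphism). A family of Zariski open immersions $\{Spec(B_i)\to Spec(A)\}_{i\in I}$ is a Zariski open cover of $Spec(A)$ if there is a finite subset $I'\subseteq I$ such that $\{-\otimes_AB_i\}_{i\in I'}$ is conservative: for $M$ in $A\text{-}Mod$, $M=0$ if and only if $M\otimes_AB_i=0$ for every $i\in I'$. *)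

theory Defs
  imports "HOL-Algebra.Product_Groups" "HOL-Algebra.Ring" "HOL-Library.Equipollence"
begin

section \<open>Categories and functors\<close>

text \<open>
  Morphisms live in hom-sets that need not be disjoint, and composition, addition and the tensor
  product of morphisms do not depend on the objects.  Every category is isomorphic to one of this
  kind (make the hom-sets disjoint), and so morphisms of monoids or of modules are literally
  morphisms of the underlying category.  Only hom-sets between members of \<open>Obj\<close> matter.
\<close>

record ('o, 'm) precat =
  Obj :: "'o set"
  Hom :: "'o \<Rightarrow> 'o \<Rightarrow> 'm set"
  Idt :: "'o \<Rightarrow> 'm"
  Cmp :: "'m \<Rightarrow> 'm \<Rightarrow> 'm" (infixl "\<cdot>\<index>" 70)

locale category =
  fixes C :: "('o, 'm, 'x) precat_scheme" (structure)
  assumes Idt_in: "X \<in> Obj C \<Longrightarrow> Idt C X \<in> Hom C X X"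
    and Cmp_in: "\<lbrakk>X \<in> Obj C; Y \<in> Obj C; Z \<in> Obj C; f \<in> Hom C X Y; g \<in> Hom C Y Z\<rbrakk>
                  \<Longrightarrow> g \<cdot> f \<in> Hom C X Z"
    and Cmp_Idt: "\<lbrakk>X \<in> Obj C; Y \<in> Obj C; f \<in> Hom C X Y\<rbrakk> \<Longrightarrow> f \<cdot> Idt C X = f"
    and Idt_Cmp: "\<lbrakk>X \<in> Obj C; Y \<in> Obj C; f \<in> Hom C X Y\<rbrakk> \<Longrightarrow> Idt C Y \<cdot> f = f"
    and Cmp_assoc: "\<lbrakk>W \<in> Obj C; X \<in> Obj C; Y \<in> Obj C; Z \<in> Obj C;
                     f \<in> Hom C W X; g \<in> Hom C X Y; h \<in> Hom C Y Z\<rbrakk>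
                  \<Longrightarrow> (h \<cdot> g) \<cdot> f = h \<cdot> (g \<cdot> f)"

definition op_cat :: "('o, 'm, 'x) precat_scheme \<Rightarrow> ('o, 'm) precat" where
  "op_cat K = \<lparr>Obj = Obj K, Hom = (\<lambda>X Y. Hom K Y X), Idt = Idt K, Cmp = (\<lambda>g f. f \<cdot>\<^bsub>K\<^esub> g)\<rparr>"

definition prod_cat ::
  "('j, 'u, 'x) precat_scheme \<Rightarrow> ('k, 'v, 'y) precat_scheme \<Rightarrow> ('j \<times> 'k, 'u \<times> 'v) precat" where
  "prod_cat J K = \<lparr>Obj = Obj J \<times> Obj K,
     Hom = (\<lambda>x y. Hom J (fst x) (fst y) \<times> Hom K (snd x) (snd y)),
     Idt = (\<lambda>x. (Idt J (fst x), Idt K (snd x))),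
     Cmp = (\<lambda>g f. (fst g \<cdot>\<^bsub>J\<^esub> fst f, snd g \<cdot>\<^bsub>K\<^esub> snd f))\<rparr>"

definition is_iso :: "('o, 'm, 'x) precat_scheme \<Rightarrow> 'o \<Rightarrow> 'o \<Rightarrow> 'm \<Rightarrow> bool" where
  "is_iso K X Y f \<longleftrightarrow> f \<in> Hom K X Y \<and>
     (\<exists>g \<in> Hom K Y X. g \<cdot>\<^bsub>K\<^esub> f = Idt K X \<and> f \<cdot>\<^bsub>K\<^esub> g = Idt K Y)"

definition is_mono :: "('o, 'm, 'x) precat_scheme \<Rightarrow> 'o \<Rightarrow> 'o \<Rightarrow> 'm \<Rightarrow> bool" where
  "is_mono K X Y f \<longleftrightarrow> f \<in> Hom K X Y \<and>
     (\<forall>W \<in> Obj K. \<forall>g \<in> Hom K W X. \<forall>h \<in> Hom K W X. f \<cdot>\<^bsub>K\<^esub> g = f \<cdot>\<^bsub>K\<^esub> h \<longrightarrow> g = h)"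

definition is_epi :: "('o, 'm, 'x) precat_scheme \<Rightarrow> 'o \<Rightarrow> 'o \<Rightarrow> 'm \<Rightarrow> bool" where
  "is_epi K X Y f \<longleftrightarrow> f \<in> Hom K X Y \<and>
     (\<forall>Z \<in> Obj K. \<forall>g \<in> Hom K Y Z. \<forall>h \<in> Hom K Y Z. g \<cdot>\<^bsub>K\<^esub> f = h \<cdot>\<^bsub>K\<^esub> f \<longrightarrow> g = h)"

definition is_zero_object :: "('o, 'm, 'x) precat_scheme \<Rightarrow> 'o \<Rightarrow> bool" where
  "is_zero_object K X \<longleftrightarrow> X \<in> Obj K \<and>
     (\<forall>Y \<in> Obj K. (\<exists>!f. f \<in> Hom K X Y) \<and> (\<exists>!f. f \<in> Hom K Y X))"

text \<open>
  The action on morphisms takes source and target as arguments because hom-sets may overlap.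
\<close>

record ('o, 'm, 'p, 'n) func =
  FObj :: "'o \<Rightarrow> 'p"
  FHom :: "'o \<Rightarrow> 'o \<Rightarrow> 'm \<Rightarrow> 'n"

definition is_functor ::
  "('o, 'm, 'x) precat_scheme \<Rightarrow> ('p, 'n, 'y) precat_scheme \<Rightarrow> ('o, 'm, 'p, 'n) func \<Rightarrow> bool" where
  "is_functor J K F \<longleftrightarrow>
     (\<forall>x \<in> Obj J. FObj F x \<in> Obj K \<and> FHom F x x (Idt J x) = Idt K (FObj F x)) \<and>
     (\<forall>x \<in> Obj J. \<forall>y \<in> Obj J. \<forall>f \<in> Hom J x y. FHom F x y f \<in> Hom K (FObj F x) (FObj F y)) \<and>
     (\<forall>x \<in> Obj J. \<forall>y \<in> Obj J. \<forall>z \<in> Obj J. \<forall>f \<in> Hom J x y. \<forall>g \<in> Hom J y z.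
        FHom F x z (g \<cdot>\<^bsub>J\<^esub> f) = FHom F y z g \<cdot>\<^bsub>K\<^esub> FHom F x y f)"

definition comp_func ::
  "('p, 'n, 'q, 'l) func \<Rightarrow> ('o, 'm, 'p, 'n) func \<Rightarrow> ('o, 'm, 'q, 'l) func" where
  "comp_func G F = \<lparr>FObj = (\<lambda>x. FObj G (FObj F x)),
     FHom = (\<lambda>x y f. FHom G (FObj F x) (FObj F y) (FHom F x y f))\<rparr>"


section \<open>Limits and colimits\<close>

definition is_cocone ::
  "('j, 'u, 'x) precat_scheme \<Rightarrow> ('o, 'm, 'y) precat_scheme \<Rightarrow> ('j, 'u, 'o, 'm) func
    \<Rightarrow> 'o \<Rightarrow> ('j \<Rightarrow> 'm) \<Rightarrow> bool" where
  "is_cocone J K D L \<iota> \<longleftrightarrow> L \<in> Obj K \<and> (\<forall>j \<in> Obj J. \<iota> j \<in> Hom K (FObj D j) L) \<and>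
     (\<forall>j \<in> Obj J. \<forall>k \<in> Obj J. \<forall>u \<in> Hom J j k. \<iota> k \<cdot>\<^bsub>K\<^esub> FHom D j k u = \<iota> j)"

definition is_colimit ::
  "('j, 'u, 'x) precat_scheme \<Rightarrow> ('o, 'm, 'y) precat_scheme \<Rightarrow> ('j, 'u, 'o, 'm) func
    \<Rightarrow> 'o \<Rightarrow> ('j \<Rightarrow> 'm) \<Rightarrow> bool" where
  "is_colimit J K D L \<iota> \<longleftrightarrow> is_cocone J K D L \<iota> \<and>
     (\<forall>Y \<kappa>. is_cocone J K D Y \<kappa> \<longrightarrow>
        (\<exists>!h. h \<in> Hom K L Y \<and> (\<forall>j \<in> Obj J. h \<cdot>\<^bsub>K\<^esub> \<iota> j = \<kappa> j)))"

definition is_cone ::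
  "('j, 'u, 'x) precat_scheme \<Rightarrow> ('o, 'm, 'y) precat_scheme \<Rightarrow> ('j, 'u, 'o, 'm) func
    \<Rightarrow> 'o \<Rightarrow> ('j \<Rightarrow> 'm) \<Rightarrow> bool" where
  "is_cone J K D L \<pi> \<longleftrightarrow> L \<in> Obj K \<and> (\<forall>j \<in> Obj J. \<pi> j \<in> Hom K L (FObj D j)) \<and>
     (\<forall>j \<in> Obj J. \<forall>k \<in> Obj J. \<forall>u \<in> Hom J j k. FHom D j k u \<cdot>\<^bsub>K\<^esub> \<pi> j = \<pi> k)"

definition is_limit ::
  "('j, 'u, 'x) precat_scheme \<Rightarrow> ('o, 'm, 'y) precat_scheme \<Rightarrow> ('j, 'u, 'o, 'm) func
    \<Rightarrow> 'o \<Rightarrow> ('j \<Rightarrow> 'm) \<Rightarrow> bool" where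
  "is_limit J K D L \<pi> \<longleftrightarrow> is_cone J K D L \<pi> \<and>
     (\<forall>Y \<kappa>. is_cone J K D Y \<kappa> \<longrightarrow>
        (\<exists>!h. h \<in> Hom K Y L \<and> (\<forall>j \<in> Obj J. \<pi> j \<cdot>\<^bsub>K\<^esub> h = \<kappa> j)))"

definition is_coequalizer ::
  "('o, 'm, 'x) precat_scheme \<Rightarrow> 'o \<Rightarrow> 'o \<Rightarrow> 'm \<Rightarrow> 'm \<Rightarrow> 'o \<Rightarrow> 'm \<Rightarrow> bool" where
  "is_coequalizer K X Y u v Q q \<longleftrightarrow> Q \<in> Obj K \<and> q \<in> Hom K Y Q \<and> q \<cdot>\<^bsub>K\<^esub> u = q \<cdot>\<^bsub>K\<^esub> v \<and>
     (\<forall>Z \<in> Obj K. \<forall>g \<in> Hom K Y Z. g \<cdot>\<^bsub>K\<^esub> u = g \<cdot>\<^bsub>K\<^esub> v \<longrightarrow>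
        (\<exists>!h. h \<in> Hom K Q Z \<and> h \<cdot>\<^bsub>K\<^esub> q = g))"

text \<open>\<open>L\<close> is the coproduct of copies of \<open>X\<close> indexed by \<open>S\<close>, with injections \<open>e\<close>.\<close>

definition is_copower ::
  "('o, 'm, 'x) precat_scheme \<Rightarrow> 's set \<Rightarrow> 'o \<Rightarrow> 'o \<Rightarrow> ('s \<Rightarrow> 'm) \<Rightarrow> bool" where
  "is_copower K S X L e \<longleftrightarrow> L \<in> Obj K \<and> (\<forall>s \<in> S. e s \<in> Hom K X L) \<and>
     (\<forall>Y \<in> Obj K. \<forall>g. (\<forall>s \<in> S. g s \<in> Hom K X Y) \<longrightarrow>
        (\<exists>!h. h \<in> Hom K L Y \<and> (\<forall>s \<in> S. h \<cdot>\<^bsub>K\<^esub> e s = g s)))"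

definition arrows :: "('o, 'm, 'x) precat_scheme \<Rightarrow> 'm set" where
  "arrows K = (\<Union>X \<in> Obj K. \<Union>Y \<in> Obj K. Hom K X Y)"

text \<open>
  Smallness is relative to a type \<open>'u\<close>: a set is small if its cardinality is less than that of
  \<open>'u\<close>.  For \<open>'u\<close> of strongly inaccessible cardinality these are the small sets of a
  Grothendieck universe; what follows asks only that \<open>'u\<close> be uncountable, so that countable
  diagrams are small.  Up to isomorphism every small category has its objects and morphisms
  in \<open>'u\<close>, and every finite category has them in \<open>nat\<close>.
\<close>

definition universe :: "'u itself \<Rightarrow> bool" where
  "universe U \<longleftrightarrow> (UNIV :: nat set) \<prec> (UNIV :: 'u set)"

definition small_cat :: "('u, 'u) precat \<Rightarrow> bool" where
  "small_cat J \<longleftrightarrow> category J \<and> Obj J \<prec> (UNIV :: 'u set) \<and> arrows J \<prec> (UNIV :: 'u set)"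

definition finite_cat :: "(nat, nat) precat \<Rightarrow> bool" where
  "finite_cat J \<longleftrightarrow> category J \<and> finite (Obj J) \<and> finite (arrows J)"

definition filtered :: "('j, 'u, 'x) precat_scheme \<Rightarrow> bool" where
  "filtered J \<longleftrightarrow> Obj J \<noteq> {} \<and>
     (\<forall>x \<in> Obj J. \<forall>y \<in> Obj J. \<exists>z \<in> Obj J. Hom J x z \<noteq> {} \<and> Hom J y z \<noteq> {}) \<and>
     (\<forall>x \<in> Obj J. \<forall>y \<in> Obj J. \<forall>u \<in> Hom J x y. \<forall>v \<in> Hom J x y.
        \<exists>z \<in> Obj J. \<exists>w \<in> Hom J y z. w \<cdot>\<^bsub>J\<^esub> u = w \<cdot>\<^bsub>J\<^esub> v)"

text \<open>A directed index category is a directed preordered set.\<close>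

definition directed :: "('j, 'u, 'x) precat_scheme \<Rightarrow> bool" where
  "directed J \<longleftrightarrow> filtered J \<and>
     (\<forall>x \<in> Obj J. \<forall>y \<in> Obj J. \<forall>u \<in> Hom J x y. \<forall>v \<in> Hom J x y. u = v)"

definition has_small_limits :: "'u itself \<Rightarrow> ('o, 'm, 'x) precat_scheme \<Rightarrow> bool" where
  "has_small_limits U K \<longleftrightarrow> (\<forall>(J :: ('u, 'u) precat) D.
     small_cat J \<longrightarrow> is_functor J K D \<longrightarrow> (\<exists>L \<pi>. is_limit J K D L \<pi>))"

definition has_small_colimits :: "'u itself \<Rightarrow> ('o, 'm, 'x) precat_scheme \<Rightarrow> bool" where
  "has_small_colimits U K \<longleftrightarrow> (\<forall>(J :: ('u, 'u) precat) D.
     small_cat J \<longrightarrow> is_functor J K D \<longrightarrow> (\<exists>L \<iota>. is_colimit J K D L \<iota>))"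

definition preserves_small_colimits ::
  "'u itself \<Rightarrow> ('o, 'm, 'x) precat_scheme \<Rightarrow> ('p, 'n, 'y) precat_scheme
    \<Rightarrow> ('o, 'm, 'p, 'n) func \<Rightarrow> bool" where
  "preserves_small_colimits U K K' F \<longleftrightarrow> (\<forall>(J :: ('u, 'u) precat) D L \<iota>.
     small_cat J \<longrightarrow> is_functor J K D \<longrightarrow> is_colimit J K D L \<iota> \<longrightarrow>
     is_colimit J K' (comp_func F D) (FObj F L) (\<lambda>j. FHom F (FObj D j) L (\<iota> j)))"

definition preserves_finite_limits ::
  "('o, 'm, 'x) precat_scheme \<Rightarrow> ('p, 'n, 'y) precat_scheme \<Rightarrow> ('o, 'm, 'p, 'n) func \<Rightarrow> bool" where
  "preserves_finite_limits K K' F \<longleftrightarrow> (\<forall>(J :: (nat, nat) precat) D L \<pi>.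
     finite_cat J \<longrightarrow> is_functor J K D \<longrightarrow> is_limit J K D L \<pi> \<longrightarrow>
     is_limit J K' (comp_func F D) (FObj F L) (\<lambda>j. FHom F L (FObj D j) (\<pi> j)))"

text \<open>
  For \<open>D : J \<times> I \<rightarrow> K\<close> let \<open>L j = lim\<^sub>i D (j, i)\<close> and \<open>E i = colim\<^sub>j D (j, i)\<close>, functorially in
  \<open>j\<close> and \<open>i\<close>, and let \<open>P = colim\<^sub>j L j\<close>.  The canonical map \<open>colim\<^sub>j lim\<^sub>i D \<rightarrow> lim\<^sub>i colim\<^sub>j D\<close> is
  an isomorphism iff the induced maps \<open>q i : P \<rightarrow> E i\<close> form a limit cone.
\<close>

definition filtered_colimits_commute_with_finite_limits ::
  "'u itself \<Rightarrow> ('o, 'm, 'x) precat_scheme \<Rightarrow> bool" where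
  "filtered_colimits_commute_with_finite_limits U K \<longleftrightarrow>
     (\<forall>(J :: ('u, 'u) precat) (I :: (nat, nat) precat) D L \<pi> E \<iota> P p q.
        small_cat J \<longrightarrow> filtered J \<longrightarrow> finite_cat I \<longrightarrow>
        is_functor (prod_cat J I) K D \<longrightarrow> is_functor J K L \<longrightarrow> is_functor I K E \<longrightarrow>
        (\<forall>j \<in> Obj J. is_limit I K \<lparr>FObj = (\<lambda>i. FObj D (j, i)),
             FHom = (\<lambda>i i' v. FHom D (j, i) (j, i') (Idt J j, v))\<rparr> (FObj L j) (\<pi> j)) \<longrightarrow>
        (\<forall>j \<in> Obj J. \<forall>j' \<in> Obj J. \<forall>u \<in> Hom J j j'. \<forall>i \<in> Obj I.
             \<pi> j' i \<cdot>\<^bsub>K\<^esub> FHom L j j' u = FHom D (j, i) (j', i) (u, Idt I i) \<cdot>\<^bsub>K\<^esub> \<pi> j i) \<longrightarrow>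
        (\<forall>i \<in> Obj I. is_colimit J K \<lparr>FObj = (\<lambda>j. FObj D (j, i)),
             FHom = (\<lambda>j j' u. FHom D (j, i) (j', i) (u, Idt I i))\<rparr> (FObj E i) (\<iota> i)) \<longrightarrow>
        (\<forall>i \<in> Obj I. \<forall>i' \<in> Obj I. \<forall>v \<in> Hom I i i'. \<forall>j \<in> Obj J.
             FHom E i i' v \<cdot>\<^bsub>K\<^esub> \<iota> i j = \<iota> i' j \<cdot>\<^bsub>K\<^esub> FHom D (j, i) (j, i') (Idt J j, v)) \<longrightarrow>
        is_colimit J K L P p \<longrightarrow>
        (\<forall>i \<in> Obj I. q i \<in> Hom K P (FObj E i) \<and>
             (\<forall>j \<in> Obj J. q i \<cdot>\<^bsub>K\<^esub> p j = \<iota> i j \<cdot>\<^bsub>K\<^esub> \<pi> j i)) \<longrightarrow>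
        is_limit I K E P q)"

text \<open>
  The colimit in sets of \<open>Hom(X, D j)\<close> is the quotient of the disjoint union of these sets by the
  equivalence relation generated by \<open>(j, g) \<sim> (k, D u \<circ> g)\<close> for \<open>u : j \<rightarrow> k\<close>.
\<close>

definition colim_Hom_rel ::
  "('j, 'u, 'x) precat_scheme \<Rightarrow> ('o, 'm, 'y) precat_scheme \<Rightarrow> ('j, 'u, 'o, 'm) func \<Rightarrow> 'o
    \<Rightarrow> (('j \<times> 'm) \<times> ('j \<times> 'm)) set" where
  "colim_Hom_rel J K D X = {((j, g), (k, FHom D j k u \<cdot>\<^bsub>K\<^esub> g)) | j k u g.
     j \<in> Obj J \<and> k \<in> Obj J \<and> u \<in> Hom J j k \<and> g \<in> Hom K X (FObj D j)}"

definition colim_Hom ::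
  "('j, 'u, 'x) precat_scheme \<Rightarrow> ('o, 'm, 'y) precat_scheme \<Rightarrow> ('j, 'u, 'o, 'm) func \<Rightarrow> 'o
    \<Rightarrow> ('j \<times> 'm) set set" where
  "colim_Hom J K D X = (SIGMA j:Obj J. Hom K X (FObj D j)) //
     (colim_Hom_rel J K D X \<union> (colim_Hom_rel J K D X)\<inverse>)\<^sup>*"

text \<open>
  \<open>Hom(X, -)\<close> preserves the colimit \<open>(L, \<iota>)\<close> of \<open>D\<close>.  On each class the function
  \<open>(j, g) \<mapsto> \<iota> j \<circ> g\<close> is constant, and \<open>the_elem\<close> picks its value.
\<close>

definition Hom_preserves_colimit ::
  "('j, 'u, 'x) precat_scheme \<Rightarrow> ('o, 'm, 'y) precat_scheme \<Rightarrow> 'o \<Rightarrow> ('j, 'u, 'o, 'm) func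
    \<Rightarrow> 'o \<Rightarrow> ('j \<Rightarrow> 'm) \<Rightarrow> bool" where
  "Hom_preserves_colimit J K X D L \<iota> \<longleftrightarrow>
     bij_betw (\<lambda>c. the_elem ((\<lambda>(j, g). \<iota> j \<cdot>\<^bsub>K\<^esub> g) ` c)) (colim_Hom J K D X) (Hom K X L)"

definition Hom_preserves_filtered_colimits ::
  "'u itself \<Rightarrow> ('o, 'm, 'x) precat_scheme \<Rightarrow> 'o \<Rightarrow> bool" where
  "Hom_preserves_filtered_colimits U K X \<longleftrightarrow> (\<forall>(J :: ('u, 'u) precat) D L \<iota>.
     small_cat J \<longrightarrow> filtered J \<longrightarrow> is_functor J K D \<longrightarrow> is_colimit J K D L \<iota> \<longrightarrow>
     Hom_preserves_colimit J K X D L \<iota>)"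

definition Hom_preserves_directed_colimits ::
  "'u itself \<Rightarrow> ('o, 'm, 'x) precat_scheme \<Rightarrow> 'o \<Rightarrow> bool" where
  "Hom_preserves_directed_colimits U K X \<longleftrightarrow> (\<forall>(J :: ('u, 'u) precat) D L \<iota>.
     small_cat J \<longrightarrow> directed J \<longrightarrow> is_functor J K D \<longrightarrow> is_colimit J K D L \<iota> \<longrightarrow>
     Hom_preserves_colimit J K X D L \<iota>)"

definition finitely_presented_object ::
  "'u itself \<Rightarrow> ('o, 'm, 'x) precat_scheme \<Rightarrow> 'o \<Rightarrow> bool" where
  "finitely_presented_object U K M \<longleftrightarrow> M \<in> Obj K \<and> Hom_preserves_directed_colimits U K M"


section \<open>Abelian categories\<close>

record ('o, 'm) preadd_cat = "('o, 'm) precat" +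
  Zer :: "'o \<Rightarrow> 'o \<Rightarrow> 'm"
  Add :: "'m \<Rightarrow> 'm \<Rightarrow> 'm"

text \<open>The abelian group \<open>Hom(X, Y)\<close>, written multiplicatively as in the group library.\<close>

definition Hom_group :: "('o, 'm, 'x) preadd_cat_scheme \<Rightarrow> 'o \<Rightarrow> 'o \<Rightarrow> 'm monoid" where
  "Hom_group K X Y = \<lparr>carrier = Hom K X Y, monoid.mult = Add K, one = Zer K X Y\<rparr>"

locale preadditive_category = category C
  for C :: "('o, 'm, 'x) preadd_cat_scheme" (structure) +
  assumes Hom_comm_group: "\<lbrakk>X \<in> Obj C; Y \<in> Obj C\<rbrakk> \<Longrightarrow> comm_group (Hom_group C X Y)"
    and Cmp_Add_left: "\<lbrakk>X \<in> Obj C; Y \<in> Obj C; Z \<in> Obj C;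
          f \<in> Hom C X Y; g \<in> Hom C Y Z; h \<in> Hom C Y Z\<rbrakk>
        \<Longrightarrow> Add C g h \<cdot> f = Add C (g \<cdot> f) (h \<cdot> f)"
    and Cmp_Add_right: "\<lbrakk>X \<in> Obj C; Y \<in> Obj C; Z \<in> Obj C;
          f \<in> Hom C X Y; g \<in> Hom C X Y; h \<in> Hom C Y Z\<rbrakk>
        \<Longrightarrow> h \<cdot> Add C f g = Add C (h \<cdot> f) (h \<cdot> g)"

definition is_kernel ::
  "('o, 'm, 'x) preadd_cat_scheme \<Rightarrow> 'o \<Rightarrow> 'o \<Rightarrow> 'm \<Rightarrow> 'o \<Rightarrow> 'm \<Rightarrow> bool" where
  "is_kernel C X Y f K k \<longleftrightarrow> K \<in> Obj C \<and> k \<in> Hom C K X \<and> f \<cdot>\<^bsub>C\<^esub> k = Zer C K Y \<and>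
     (\<forall>W \<in> Obj C. \<forall>g \<in> Hom C W X. f \<cdot>\<^bsub>C\<^esub> g = Zer C W Y \<longrightarrow>
        (\<exists>!h. h \<in> Hom C W K \<and> k \<cdot>\<^bsub>C\<^esub> h = g))"

definition is_cokernel ::
  "('o, 'm, 'x) preadd_cat_scheme \<Rightarrow> 'o \<Rightarrow> 'o \<Rightarrow> 'm \<Rightarrow> 'o \<Rightarrow> 'm \<Rightarrow> bool" where
  "is_cokernel C X Y f Q q \<longleftrightarrow> Q \<in> Obj C \<and> q \<in> Hom C Y Q \<and> q \<cdot>\<^bsub>C\<^esub> f = Zer C X Q \<and>
     (\<forall>Z \<in> Obj C. \<forall>g \<in> Hom C Y Z. g \<cdot>\<^bsub>C\<^esub> f = Zer C X Z \<longrightarrow>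
        (\<exists>!h. h \<in> Hom C Q Z \<and> h \<cdot>\<^bsub>C\<^esub> q = g))"

definition is_biproduct ::
  "('o, 'm, 'x) preadd_cat_scheme \<Rightarrow> 'o \<Rightarrow> 'o \<Rightarrow> 'o \<Rightarrow> 'm \<Rightarrow> 'm \<Rightarrow> 'm \<Rightarrow> 'm \<Rightarrow> bool" where
  "is_biproduct C X Y P i\<^sub>1 i\<^sub>2 p\<^sub>1 p\<^sub>2 \<longleftrightarrow> P \<in> Obj C \<and>
     i\<^sub>1 \<in> Hom C X P \<and> i\<^sub>2 \<in> Hom C Y P \<and> p\<^sub>1 \<in> Hom C P X \<and> p\<^sub>2 \<in> Hom C P Y \<and>
     p\<^sub>1 \<cdot>\<^bsub>C\<^esub> i\<^sub>1 = Idt C X \<and> p\<^sub>2 \<cdot>\<^bsub>C\<^esub> i\<^sub>2 = Idt C Y \<and>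
     p\<^sub>2 \<cdot>\<^bsub>C\<^esub> i\<^sub>1 = Zer C X Y \<and> p\<^sub>1 \<cdot>\<^bsub>C\<^esub> i\<^sub>2 = Zer C Y X \<and>
     Add C (i\<^sub>1 \<cdot>\<^bsub>C\<^esub> p\<^sub>1) (i\<^sub>2 \<cdot>\<^bsub>C\<^esub> p\<^sub>2) = Idt C P"

locale abelian_category = preadditive_category C
  for C :: "('o, 'm, 'x) preadd_cat_scheme" (structure) +
  assumes has_zero_object: "\<exists>Z. is_zero_object C Z"
    and has_biproducts: "\<lbrakk>X \<in> Obj C; Y \<in> Obj C\<rbrakk>
          \<Longrightarrow> \<exists>P i\<^sub>1 i\<^sub>2 p\<^sub>1 p\<^sub>2. is_biproduct C X Y P i\<^sub>1 i\<^sub>2 p\<^sub>1 p\<^sub>2"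
    and has_kernels: "\<lbrakk>X \<in> Obj C; Y \<in> Obj C; f \<in> Hom C X Y\<rbrakk> \<Longrightarrow> \<exists>K k. is_kernel C X Y f K k"
    and has_cokernels: "\<lbrakk>X \<in> Obj C; Y \<in> Obj C; f \<in> Hom C X Y\<rbrakk> \<Longrightarrow> \<exists>Q q. is_cokernel C X Y f Q q"
    and mono_is_kernel: "\<lbrakk>X \<in> Obj C; Y \<in> Obj C; is_mono C X Y f\<rbrakk>
          \<Longrightarrow> \<exists>Z \<in> Obj C. \<exists>g \<in> Hom C Y Z. is_kernel C Y Z g X f"
    and epi_is_cokernel: "\<lbrakk>X \<in> Obj C; Y \<in> Obj C; is_epi C X Y f\<rbrakk>
          \<Longrightarrow> \<exists>W \<in> Obj C. \<exists>g \<in> Hom C W X. is_cokernel C W X g Y f"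

text \<open>
  The colimit in abelian groups of \<open>Hom(X, D j)\<close>: the direct sum of these groups modulo the subgroup
  generated by the elements \<open>in\<^sub>j g - in\<^sub>k (D u \<circ> g)\<close> for \<open>u : j \<rightarrow> k\<close>.
\<close>

definition Hom_sum ::
  "('j, 'u, 'x) precat_scheme \<Rightarrow> ('o, 'm, 'y) preadd_cat_scheme \<Rightarrow> ('j, 'u, 'o, 'm) func \<Rightarrow> 'o
    \<Rightarrow> ('j \<Rightarrow> 'm) monoid" where
  "Hom_sum J K D X = sum_group (Obj J) (\<lambda>j. Hom_group K X (FObj D j))"

definition Hom_sum_inj ::
  "('j, 'u, 'x) precat_scheme \<Rightarrow> ('o, 'm, 'y) preadd_cat_scheme \<Rightarrow> ('j, 'u, 'o, 'm) func \<Rightarrow> 'o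
    \<Rightarrow> 'j \<Rightarrow> 'm \<Rightarrow> 'j \<Rightarrow> 'm" where
  "Hom_sum_inj J K D X j g = (\<lambda>i \<in> Obj J. if i = j then g else Zer K X (FObj D i))"

definition Hom_sum_rel ::
  "('j, 'u, 'x) precat_scheme \<Rightarrow> ('o, 'm, 'y) preadd_cat_scheme \<Rightarrow> ('j, 'u, 'o, 'm) func \<Rightarrow> 'o
    \<Rightarrow> ('j \<Rightarrow> 'm) set" where
  "Hom_sum_rel J K D X = generate (Hom_sum J K D X)
     {Hom_sum_inj J K D X j g \<otimes>\<^bsub>Hom_sum J K D X\<^esub>
        inv\<^bsub>Hom_sum J K D X\<^esub> Hom_sum_inj J K D X k (FHom D j k u \<cdot>\<^bsub>K\<^esub> g) | j k u g.
      j \<in> Obj J \<and> k \<in> Obj J \<and> u \<in> Hom J j k \<and> g \<in> Hom K X (FObj D j)}"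

text \<open>
  \<open>Hom(X, -)\<close>, with values in abelian groups, preserves the colimit \<open>(L, \<iota>)\<close> of the finite diagram \<open>D\<close>:
  the map that sends the class of \<open>(g\<^sub>j)\<^sub>j\<close> to the sum of the \<open>\<iota> j \<circ> g\<^sub>j\<close> is an isomorphism.
\<close>

definition Hom_ab_preserves_finite_colimit ::
  "('j, 'u, 'x) precat_scheme \<Rightarrow> ('o, 'm, 'y) preadd_cat_scheme \<Rightarrow> 'o \<Rightarrow> ('j, 'u, 'o, 'm) func
    \<Rightarrow> 'o \<Rightarrow> ('j \<Rightarrow> 'm) \<Rightarrow> bool" where
  "Hom_ab_preserves_finite_colimit J K X D L \<iota> \<longleftrightarrow>
     (\<lambda>c. the_elem ((\<lambda>x. finprod (Hom_group K X L) (\<lambda>j. \<iota> j \<cdot>\<^bsub>K\<^esub> x j) (Obj J)) ` c))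
       \<in> iso (Hom_sum J K D X Mod Hom_sum_rel J K D X) (Hom_group K X L)"


section \<open>Symmetric monoidal categories\<close>

record ('o, 'm) tensor_cat = "('o, 'm) preadd_cat" +
  TObj :: "'o \<Rightarrow> 'o \<Rightarrow> 'o" (infixl "\<boxtimes>\<index>" 75)
  THom :: "'m \<Rightarrow> 'm \<Rightarrow> 'm" (infixl "\<boxdot>\<index>" 75)
  Unt :: "'o"
  Asc :: "'o \<Rightarrow> 'o \<Rightarrow> 'o \<Rightarrow> 'm"
  LUn :: "'o \<Rightarrow> 'm"
  RUn :: "'o \<Rightarrow> 'm"
  Brd :: "'o \<Rightarrow> 'o \<Rightarrow> 'm"

locale symmetric_monoidal_category = category C
  for C :: "('o, 'm, 'x) tensor_cat_scheme" (structure) +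
  assumes Unt_in: "Unt C \<in> Obj C"
    and TObj_in: "\<lbrakk>X \<in> Obj C; Y \<in> Obj C\<rbrakk> \<Longrightarrow> X \<boxtimes> Y \<in> Obj C"
    and THom_in: "\<lbrakk>X \<in> Obj C; X' \<in> Obj C; Y \<in> Obj C; Y' \<in> Obj C;
          f \<in> Hom C X X'; g \<in> Hom C Y Y'\<rbrakk> \<Longrightarrow> f \<boxdot> g \<in> Hom C (X \<boxtimes> Y) (X' \<boxtimes> Y')"
    and THom_Idt: "\<lbrakk>X \<in> Obj C; Y \<in> Obj C\<rbrakk> \<Longrightarrow> Idt C X \<boxdot> Idt C Y = Idt C (X \<boxtimes> Y)"
    and THom_Cmp: "\<lbrakk>X \<in> Obj C; X' \<in> Obj C; X'' \<in> Obj C; Y \<in> Obj C; Y' \<in> Obj C; Y'' \<in> Obj C;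
          f \<in> Hom C X X'; f' \<in> Hom C X' X''; g \<in> Hom C Y Y'; g' \<in> Hom C Y' Y''\<rbrakk>
        \<Longrightarrow> (f' \<cdot> f) \<boxdot> (g' \<cdot> g) = (f' \<boxdot> g') \<cdot> (f \<boxdot> g)"
    and Asc_iso: "\<lbrakk>X \<in> Obj C; Y \<in> Obj C; Z \<in> Obj C\<rbrakk>
        \<Longrightarrow> is_iso C ((X \<boxtimes> Y) \<boxtimes> Z) (X \<boxtimes> (Y \<boxtimes> Z)) (Asc C X Y Z)"
    and LUn_iso: "X \<in> Obj C \<Longrightarrow> is_iso C (Unt C \<boxtimes> X) X (LUn C X)"
    and RUn_iso: "X \<in> Obj C \<Longrightarrow> is_iso C (X \<boxtimes> Unt C) X (RUn C X)"
    and Brd_in: "\<lbrakk>X \<in> Obj C; Y \<in> Obj C\<rbrakk> \<Longrightarrow> Brd C X Y \<in> Hom C (X \<boxtimes> Y) (Y \<boxtimes> X)"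
    and Asc_natural: "\<lbrakk>X \<in> Obj C; X' \<in> Obj C; Y \<in> Obj C; Y' \<in> Obj C; Z \<in> Obj C; Z' \<in> Obj C;
          f \<in> Hom C X X'; g \<in> Hom C Y Y'; h \<in> Hom C Z Z'\<rbrakk>
        \<Longrightarrow> Asc C X' Y' Z' \<cdot> ((f \<boxdot> g) \<boxdot> h) = (f \<boxdot> (g \<boxdot> h)) \<cdot> Asc C X Y Z"
    and LUn_natural: "\<lbrakk>X \<in> Obj C; Y \<in> Obj C; f \<in> Hom C X Y\<rbrakk>
        \<Longrightarrow> LUn C Y \<cdot> (Idt C (Unt C) \<boxdot> f) = f \<cdot> LUn C X"
    and RUn_natural: "\<lbrakk>X \<in> Obj C; Y \<in> Obj C; f \<in> Hom C X Y\<rbrakk>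
        \<Longrightarrow> RUn C Y \<cdot> (f \<boxdot> Idt C (Unt C)) = f \<cdot> RUn C X"
    and Brd_natural: "\<lbrakk>X \<in> Obj C; X' \<in> Obj C; Y \<in> Obj C; Y' \<in> Obj C;
          f \<in> Hom C X X'; g \<in> Hom C Y Y'\<rbrakk>
        \<Longrightarrow> Brd C X' Y' \<cdot> (f \<boxdot> g) = (g \<boxdot> f) \<cdot> Brd C X Y"
    and pentagon: "\<lbrakk>W \<in> Obj C; X \<in> Obj C; Y \<in> Obj C; Z \<in> Obj C\<rbrakk>
        \<Longrightarrow> Asc C W X (Y \<boxtimes> Z) \<cdot> Asc C (W \<boxtimes> X) Y Z
          = (Idt C W \<boxdot> Asc C X Y Z) \<cdot> Asc C W (X \<boxtimes> Y) Z \<cdot> (Asc C W X Y \<boxdot> Idt C Z)"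
    and triangle: "\<lbrakk>X \<in> Obj C; Y \<in> Obj C\<rbrakk>
        \<Longrightarrow> (Idt C X \<boxdot> LUn C Y) \<cdot> Asc C X (Unt C) Y = RUn C X \<boxdot> Idt C Y"
    and hexagon: "\<lbrakk>X \<in> Obj C; Y \<in> Obj C; Z \<in> Obj C\<rbrakk>
        \<Longrightarrow> Asc C Y Z X \<cdot> Brd C X (Y \<boxtimes> Z) \<cdot> Asc C X Y Z
          = (Idt C Y \<boxdot> Brd C X Z) \<cdot> Asc C Y X Z \<cdot> (Brd C X Y \<boxdot> Idt C Z)"
    and Brd_Brd: "\<lbrakk>X \<in> Obj C; Y \<in> Obj C\<rbrakk> \<Longrightarrow> Brd C Y X \<cdot> Brd C X Y = Idt C (X \<boxtimes> Y)"

definition tensor_right :: "('o, 'm, 'x) tensor_cat_scheme \<Rightarrow> 'o \<Rightarrow> ('o, 'm, 'o, 'm) func" where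
  "tensor_right C X = \<lparr>FObj = (\<lambda>Y. Y \<boxtimes>\<^bsub>C\<^esub> X), FHom = (\<lambda>Y Z f. f \<boxdot>\<^bsub>C\<^esub> Idt C X)\<rparr>"


section \<open>Commutative monoids and modules\<close>

record ('o, 'm) mon =
  mon_obj :: "'o"
  mon_mul :: "'m"
  mon_unt :: "'m"

definition is_comm_monoid :: "('o, 'm, 'x) tensor_cat_scheme \<Rightarrow> ('o, 'm) mon \<Rightarrow> bool" where
  "is_comm_monoid C A \<longleftrightarrow>
    (let X = mon_obj A; \<mu> = mon_mul A; \<eta> = mon_unt A; i = Idt C X in
      X \<in> Obj C \<and> \<mu> \<in> Hom C (X \<boxtimes>\<^bsub>C\<^esub> X) X \<and> \<eta> \<in> Hom C (Unt C) X \<and>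
      \<mu> \<cdot>\<^bsub>C\<^esub> (\<mu> \<boxdot>\<^bsub>C\<^esub> i) = \<mu> \<cdot>\<^bsub>C\<^esub> (i \<boxdot>\<^bsub>C\<^esub> \<mu>) \<cdot>\<^bsub>C\<^esub> Asc C X X X \<and>
      \<mu> \<cdot>\<^bsub>C\<^esub> (\<eta> \<boxdot>\<^bsub>C\<^esub> i) = LUn C X \<and>
      \<mu> \<cdot>\<^bsub>C\<^esub> (i \<boxdot>\<^bsub>C\<^esub> \<eta>) = RUn C X \<and>
      \<mu> \<cdot>\<^bsub>C\<^esub> Brd C X X = \<mu>)"

definition mon_hom ::
  "('o, 'm, 'x) tensor_cat_scheme \<Rightarrow> ('o, 'm) mon \<Rightarrow> ('o, 'm) mon \<Rightarrow> 'm set" where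
  "mon_hom C A B = {f \<in> Hom C (mon_obj A) (mon_obj B).
     f \<cdot>\<^bsub>C\<^esub> mon_mul A = mon_mul B \<cdot>\<^bsub>C\<^esub> (f \<boxdot>\<^bsub>C\<^esub> f) \<and> f \<cdot>\<^bsub>C\<^esub> mon_unt A = mon_unt B}"

definition Comm :: "('o, 'm, 'x) tensor_cat_scheme \<Rightarrow> (('o, 'm) mon, 'm) precat" where
  "Comm C = \<lparr>Obj = {A. is_comm_monoid C A}, Hom = mon_hom C,
     Idt = (\<lambda>A. Idt C (mon_obj A)), Cmp = Cmp C\<rparr>"

text \<open>The coslice category \<open>A/Comm(C)\<close>: an object is a monoid with a morphism from \<open>A\<close>.\<close>

definition Comm_under ::
  "('o, 'm, 'x) tensor_cat_scheme \<Rightarrow> ('o, 'm) mon \<Rightarrow> (('o, 'm) mon \<times> 'm, 'm) precat" where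
  "Comm_under C A = \<lparr>Obj = {(B, f). B \<in> Obj (Comm C) \<and> f \<in> Hom (Comm C) A B},
     Hom = (\<lambda>(B, f) (B', f'). {h \<in> Hom (Comm C) B B'. h \<cdot>\<^bsub>C\<^esub> f = f'}),
     Idt = (\<lambda>(B, f). Idt C (mon_obj B)), Cmp = Cmp C\<rparr>"

text \<open>Modules are written on the right; this makes no difference as all monoids are commutative.\<close>

record ('o, 'm) modl =
  mod_obj :: "'o"
  mod_act :: "'m"

definition is_module ::
  "('o, 'm, 'x) tensor_cat_scheme \<Rightarrow> ('o, 'm) mon \<Rightarrow> ('o, 'm) modl \<Rightarrow> bool" where
  "is_module C A M \<longleftrightarrow>
    (let X = mon_obj A; Y = mod_obj M; \<rho> = mod_act M in
      Y \<in> Obj C \<and> \<rho> \<in> Hom C (Y \<boxtimes>\<^bsub>C\<^esub> X) Y \<and>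
      \<rho> \<cdot>\<^bsub>C\<^esub> (\<rho> \<boxdot>\<^bsub>C\<^esub> Idt C X) = \<rho> \<cdot>\<^bsub>C\<^esub> (Idt C Y \<boxdot>\<^bsub>C\<^esub> mon_mul A) \<cdot>\<^bsub>C\<^esub> Asc C Y X X \<and>
      \<rho> \<cdot>\<^bsub>C\<^esub> (Idt C Y \<boxdot>\<^bsub>C\<^esub> mon_unt A) = RUn C Y)"

definition mod_hom ::
  "('o, 'm, 'x) tensor_cat_scheme \<Rightarrow> ('o, 'm) mon \<Rightarrow> ('o, 'm) modl \<Rightarrow> ('o, 'm) modl \<Rightarrow> 'm set" where
  "mod_hom C A M N = {f \<in> Hom C (mod_obj M) (mod_obj N).
     f \<cdot>\<^bsub>C\<^esub> mod_act M = mod_act N \<cdot>\<^bsub>C\<^esub> (f \<boxdot>\<^bsub>C\<^esub> Idt C (mon_obj A))}"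

definition ModCat ::
  "('o, 'm, 'x) tensor_cat_scheme \<Rightarrow> ('o, 'm) mon \<Rightarrow> (('o, 'm) modl, 'm) preadd_cat" where
  "ModCat C A = \<lparr>Obj = {M. is_module C A M}, Hom = mod_hom C A,
     Idt = (\<lambda>M. Idt C (mod_obj M)), Cmp = Cmp C,
     Zer = (\<lambda>M N. Zer C (mod_obj M) (mod_obj N)), Add = Add C\<rparr>"

definition regular :: "('o, 'm) mon \<Rightarrow> ('o, 'm) modl" where
  "regular A = \<lparr>mod_obj = mon_obj A, mod_act = mon_mul A\<rparr>"

definition is_free_module ::
  "('o, 'm, 'x) tensor_cat_scheme \<Rightarrow> ('o, 'm) mon \<Rightarrow> nat \<Rightarrow> ('o, 'm) modl \<Rightarrow> bool" where
  "is_free_module C A r M \<longleftrightarrow> (\<exists>e. is_copower (ModCat C A) {..<r} (regular A) M e)"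

definition restrict_scalars ::
  "('o, 'm, 'x) tensor_cat_scheme \<Rightarrow> 'm \<Rightarrow> ('o, 'm) modl \<Rightarrow> ('o, 'm) modl" where
  "restrict_scalars C f N = \<lparr>mod_obj = mod_obj N,
     mod_act = mod_act N \<cdot>\<^bsub>C\<^esub> (Idt C (mod_obj N) \<boxdot>\<^bsub>C\<^esub> f)\<rparr>"

text \<open>
  \<open>M \<otimes>\<^sub>A B\<close> for \<open>f : A \<rightarrow> B\<close>: its underlying object is the coequalizer \<open>q\<close> of the two maps
  \<open>(M \<otimes> A) \<otimes> B \<rightarrow> M \<otimes> B\<close> given by the actions of \<open>A\<close> on \<open>M\<close> and on \<open>B\<close>,
  and \<open>B\<close> acts by multiplication on the second factor.
\<close>

definition is_base_change_object ::
  "('o, 'm, 'x) tensor_cat_scheme \<Rightarrow> ('o, 'm) mon \<Rightarrow> ('o, 'm) mon \<Rightarrow> 'm \<Rightarrow> ('o, 'm) modl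
    \<Rightarrow> ('o, 'm) modl \<Rightarrow> 'm \<Rightarrow> bool" where
  "is_base_change_object C A B f M N q \<longleftrightarrow>
    (let X = mon_obj A; Y = mon_obj B; Z = mod_obj M in
      N \<in> Obj (ModCat C B) \<and>
      is_coequalizer C ((Z \<boxtimes>\<^bsub>C\<^esub> X) \<boxtimes>\<^bsub>C\<^esub> Y) (Z \<boxtimes>\<^bsub>C\<^esub> Y)
        (mod_act M \<boxdot>\<^bsub>C\<^esub> Idt C Y)
        ((Idt C Z \<boxdot>\<^bsub>C\<^esub> (mon_mul B \<cdot>\<^bsub>C\<^esub> (f \<boxdot>\<^bsub>C\<^esub> Idt C Y))) \<cdot>\<^bsub>C\<^esub> Asc C Z X Y)
        (mod_obj N) q \<and>
      mod_act N \<cdot>\<^bsub>C\<^esub> (q \<boxdot>\<^bsub>C\<^esub> Idt C Y) = q \<cdot>\<^bsub>C\<^esub> (Idt C Z \<boxdot>\<^bsub>C\<^esub> mon_mul B) \<cdot>\<^bsub>C\<^esub> Asc C Z Y Y)"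

definition base_change_pair ::
  "('o, 'm, 'x) tensor_cat_scheme \<Rightarrow> ('o, 'm) mon \<Rightarrow> ('o, 'm) mon \<Rightarrow> 'm \<Rightarrow> ('o, 'm) modl
    \<Rightarrow> ('o, 'm) modl \<times> 'm" where
  "base_change_pair C A B f M = (SOME (N, q). is_base_change_object C A B f M N q)"

definition base_change ::
  "('o, 'm, 'x) tensor_cat_scheme \<Rightarrow> ('o, 'm) mon \<Rightarrow> ('o, 'm) mon \<Rightarrow> 'm
    \<Rightarrow> (('o, 'm) modl, 'm, ('o, 'm) modl, 'm) func" where
  "base_change C A B f = \<lparr>FObj = (\<lambda>M. fst (base_change_pair C A B f M)),
     FHom = (\<lambda>M M' h. THE k.
       k \<in> Hom (ModCat C B) (fst (base_change_pair C A B f M)) (fst (base_change_pair C A B f M')) \<and>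
       k \<cdot>\<^bsub>C\<^esub> snd (base_change_pair C A B f M)
         = snd (base_change_pair C A B f M') \<cdot>\<^bsub>C\<^esub> (h \<boxdot>\<^bsub>C\<^esub> Idt C (mon_obj B)))\<rparr>"


section \<open>The standing assumptions\<close>

text \<open>
  In the second part of (C1) the colimit of the \<open>Hom(A, A\<^sup>r)\<close> is one of abelian groups
  (equivalently, of modules over the endomorphism ring of \<open>A\<close>); for colimits of sets the condition
  would already fail for \<open>A \<oplus> A\<close>.
\<close>

locale relative_geometry = abelian_category C + symmetric_monoidal_category C
  for C :: "('o, 'm, 'x) tensor_cat_scheme" (structure) and U :: "'u itself" +
  assumes universe: "universe U"
    and complete: "has_small_limits U C"
    and cocomplete: "has_small_colimits U C"
    and tensor_cocontinuous: "X \<in> Obj C \<Longrightarrow> preserves_small_colimits U C C (tensor_right C X)"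
    and filtered_exact: "A \<in> Obj (Comm C)
          \<Longrightarrow> filtered_colimits_commute_with_finite_limits U (ModCat C A)"
    and C1_unit: "Hom_preserves_filtered_colimits U C (Unt C)"
    and C1_free: "\<And>A (J :: (nat, nat) precat) D L \<iota>.
          \<lbrakk>A \<in> Obj (Comm C); finite_cat J; is_functor J (ModCat C A) D;
           \<And>j. j \<in> Obj J \<Longrightarrow> \<exists>r. is_free_module C A r (FObj D j);
           is_colimit J (ModCat C A) D L \<iota>\<rbrakk>
          \<Longrightarrow> Hom_ab_preserves_finite_colimit J (ModCat C A) (regular A) D L \<iota>"
    and C2: "\<lbrakk>A \<in> Obj (Comm C); M \<in> Obj (ModCat C A)\<rbrakk>
          \<Longrightarrow> \<exists>(J :: ('u, 'u) precat) D \<iota>. small_cat J \<and> directed J \<and> is_functor J (ModCat C A) D \<and>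
                (\<forall>j \<in> Obj J. finitely_presented_object U (ModCat C A) (FObj D j)) \<and>
                is_colimit J (ModCat C A) D M \<iota>"


section \<open>Endomorphism rings, partitions of unity and localisation\<close>

definition EndRing :: "('o, 'm, 'x) tensor_cat_scheme \<Rightarrow> ('o, 'm) mon \<Rightarrow> 'm ring" where
  "EndRing C A = \<lparr>carrier = Hom (ModCat C A) (regular A) (regular A), monoid.mult = Cmp C,
     one = Idt C (mon_obj A), zero = Zer C (mon_obj A) (mon_obj A), add = Add C\<rparr>"

definition partition_of_unity ::
  "('o, 'm, 'x) tensor_cat_scheme \<Rightarrow> ('o, 'm) mon \<Rightarrow> 'i set \<Rightarrow> ('i \<Rightarrow> 'm) \<Rightarrow> bool" where
  "partition_of_unity C A I t \<longleftrightarrow> finite I \<and> (\<forall>i \<in> I. t i \<in> carrier (EndRing C A)) \<and>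
     (\<exists>s. (\<forall>i \<in> I. s i \<in> carrier (EndRing C A)) \<and>
        (\<Oplus>\<^bsub>EndRing C A\<^esub>i \<in> I. s i \<otimes>\<^bsub>EndRing C A\<^esub> t i) = \<one>\<^bsub>EndRing C A\<^esub>)"

definition omega :: "(nat, unit) precat" where
  "omega = \<lparr>Obj = UNIV, Hom = (\<lambda>m n. if m \<le> n then {()} else {}), Idt = (\<lambda>_. ()),
     Cmp = (\<lambda>_ _. ())\<rparr>"

definition power_diagram ::
  "('o, 'm, 'x) tensor_cat_scheme \<Rightarrow> ('o, 'm) mon \<Rightarrow> 'm \<Rightarrow> (nat, unit, ('o, 'm) modl, 'm) func" where
  "power_diagram C A t = \<lparr>FObj = (\<lambda>_. regular A),
     FHom = (\<lambda>m n _. t [^]\<^bsub>EndRing C A\<^esub> (n - m))\<rparr>"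

text \<open>
  \<open>A\<^sub>t\<close> as a monoid under \<open>A\<close>: as an \<open>A\<close>-module it is the colimit of \<open>A \<rightarrow> A \<rightarrow> \<dots>\<close> with all maps \<open>t\<close>.
  The leg \<open>\<iota> n\<close> plays the role of \<open>a \<mapsto> a / t\<^sup>n\<close>; thus \<open>\<iota> 0\<close> is the canonical morphism \<open>A \<rightarrow> A\<^sub>t\<close>, and
  the multiplication is \<open>(a / t\<^sup>m) (b / t\<^sup>n) = a b / t\<^bsup>m + n\<^esup>\<close>.
\<close>

definition is_localisation ::
  "('o, 'm, 'x) tensor_cat_scheme \<Rightarrow> ('o, 'm) mon \<Rightarrow> 'm \<Rightarrow> ('o, 'm) mon \<Rightarrow> 'm \<Rightarrow> bool" where
  "is_localisation C A t B f \<longleftrightarrow> B \<in> Obj (Comm C) \<and> f \<in> Hom (Comm C) A B \<and>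
     (\<exists>\<iota>. is_colimit omega (ModCat C A) (power_diagram C A t)
             (restrict_scalars C f (regular B)) \<iota> \<and>
          \<iota> 0 = f \<and>
          (\<forall>m n. mon_mul B \<cdot>\<^bsub>C\<^esub> (\<iota> m \<boxdot>\<^bsub>C\<^esub> \<iota> n) = \<iota> (m + n) \<cdot>\<^bsub>C\<^esub> mon_mul A))"


section \<open>Zariski open covers\<close>

text \<open>An object of \<open>Aff C\<close> is a monoid \<open>A\<close>, regarded as \<open>Spec(A)\<close>.\<close>

definition Aff :: "('o, 'm, 'x) tensor_cat_scheme \<Rightarrow> (('o, 'm) mon, 'm) precat" where
  "Aff C = op_cat (Comm C)"

definition flat_morphism ::
  "('o, 'm, 'x) tensor_cat_scheme \<Rightarrow> ('o, 'm) mon \<Rightarrow> ('o, 'm) mon \<Rightarrow> 'm \<Rightarrow> bool" where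
  "flat_morphism C A B f \<longleftrightarrow> preserves_finite_limits (ModCat C A) (ModCat C B) (base_change C A B f)"

definition finite_presentation ::
  "'u itself \<Rightarrow> ('o, 'm, 'x) tensor_cat_scheme \<Rightarrow> ('o, 'm) mon \<Rightarrow> ('o, 'm) mon \<Rightarrow> 'm \<Rightarrow> bool" where
  "finite_presentation U C A B f \<longleftrightarrow> Hom_preserves_filtered_colimits U (Comm_under C A) (B, f)"

text \<open>The morphism \<open>Spec(B) \<rightarrow> Spec(A)\<close> given by \<open>f : A \<rightarrow> B\<close>.\<close>

definition zariski_open_immersion ::
  "'u itself \<Rightarrow> ('o, 'm, 'x) tensor_cat_scheme \<Rightarrow> ('o, 'm) mon \<Rightarrow> ('o, 'm) mon \<Rightarrow> 'm \<Rightarrow> bool" where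
  "zariski_open_immersion U C B A f \<longleftrightarrow>
     A \<in> Obj (Aff C) \<and> B \<in> Obj (Aff C) \<and> f \<in> Hom (Aff C) B A \<and>
     flat_morphism C A B f \<and> is_epi (Comm C) A B f \<and> finite_presentation U C A B f"

definition zariski_open_cover ::
  "'u itself \<Rightarrow> ('o, 'm, 'x) tensor_cat_scheme \<Rightarrow> ('o, 'm) mon
    \<Rightarrow> 'i set \<Rightarrow> ('i \<Rightarrow> ('o, 'm) mon) \<Rightarrow> ('i \<Rightarrow> 'm) \<Rightarrow> bool" where
  "zariski_open_cover U C A I B f \<longleftrightarrow>
     (\<forall>i \<in> I. zariski_open_immersion U C (B i) A (f i)) \<and>
     (\<exists>I' \<subseteq> I. finite I' \<and>
        (\<forall>M \<in> Obj (ModCat C A). is_zero_object (ModCat C A) M \<longleftrightarrow>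
           (\<forall>i \<in> I'. is_zero_object (ModCat C (B i)) (FObj (base_change C A (B i) (f i)) M))))"

end

theory Submission
  imports Defs
begin

text \<open>
  Let \<open>I'\<close> be a finite subfamily on which base change is conservative, and let \<open>Q\<close> be the quotient of
  the \<open>A\<close>-module \<open>A\<close> by the images of the \<open>t\<^sub>i\<close>, \<open>i \<in> I'\<close>.  Each \<open>t\<^sub>i\<close> acts on \<open>Q \<otimes>\<^sub>A A\<^sub>t\<close> both as zero, through
  \<open>Q\<close>, and invertibly, through the localisation at \<open>t = t\<^sub>i\<close>, and so these base changes vanish and
  \<open>Q = 0\<close>.  Now \<open>Q\<close> is the colimit of the finite diagram with the parallel arrows \<open>t\<^sub>i\<close> and \<open>0\<close> from \<open>A\<close> to
  \<open>A\<close>, and by (C1) the group \<open>Hom(A, Q) = 0\<close> is the quotient of \<open>\<E>(A)\<close> by the ideal generated by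
  the \<open>t\<^sub>i\<close>.  This ideal therefore contains the unit.
\<close>

section \<open>Typed morphisms\<close>

text \<open>The assumptions provide colimits in \<open>C\<close>, whereas \<open>Q\<close> has to be
  a colimit of modules. It is therefore formed in \<open>C\<close>; the action of \<open>A\<close>
  and the universal property among modules descend to it because tensoring with a fixed object
  preserves this colimit. Additivity of that tensor functor is not an assumption either: it follows
  from preservation of coproducts, and it makes the module maps between two modules a subgroup of
  all maps. The zero arrow turns a joint coequalizer into a joint cokernel, and gives
  \<open>Q = A\<close> when the subfamily is empty. The two actions of \<open>t\<close> are compared
  on maps out of the plain tensor product of \<open>Q\<close> and the localisation, before any
  coequalizer is taken. A map that identifies \<open>(q a, b)\<close> with \<open>(q, a b)\<close>
  kills every \<open>(q, t b)\<close>, and each \<open>b\<close> has the form \<open>t b'\<close>.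
  This suits the definition of base change, which picks some coequalizer: a zero module has to be
  shown to be a coequalizer before anything is known about the chosen one.\<close>

definition arr :: "('o, 'm, 'x) precat_scheme \<Rightarrow> 'o \<Rightarrow> 'o \<Rightarrow> 'm \<Rightarrow> bool" where
  "arr K X Y f \<longleftrightarrow> X \<in> Obj K \<and> Y \<in> Obj K \<and> f \<in> Hom K X Y"

text \<open>Hom-sets may overlap, so a morphism does not determine its objects, and every law of a
  category asks for their membership. With source and target carried along, a composite is typed by
  backchaining on its shape through this collection, and the laws become rewrite rules once
  instantiated with typing facts.\<close>

named_theorems arr

context category
begin

lemma arr_Cmp [arr]: "arr C X Y f \<Longrightarrow> arr C Y Z g \<Longrightarrow> arr C X Z (g \<cdot> f)"
  unfolding arr_def using Cmp_in by blast

lemma arr_Idt [arr]: "X \<in> Obj C \<Longrightarrow> arr C X X (Idt C X)"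
  unfolding arr_def using Idt_in by blast

lemma assoc: "arr C W X f \<Longrightarrow> arr C X Y g \<Longrightarrow> arr C Y Z h \<Longrightarrow> (h \<cdot> g) \<cdot> f = h \<cdot> (g \<cdot> f)"
  unfolding arr_def using Cmp_assoc by blast

lemma id_right: "arr C X Y f \<Longrightarrow> f \<cdot> Idt C X = f"
  unfolding arr_def using Cmp_Idt by blast

lemma id_left: "arr C X Y f \<Longrightarrow> Idt C Y \<cdot> f = f"
  unfolding arr_def using Idt_Cmp by blast

lemma iso_cancel_right:
  assumes "is_iso C X Y i" "X \<in> Obj C" and u: "arr C Y Z u" and v: "arr C Y Z v" and "u \<cdot> i = v \<cdot> i"
  shows "u = v"
proof -
  from assms(1) obtain j where j: "j \<in> Hom C Y X" "i \<cdot> j = Idt C Y" and i: "i \<in> Hom C X Y"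
    unfolding is_iso_def by blast
  have ai: "arr C X Y i" and aj: "arr C Y X j"
    using i j(1) assms(2) u unfolding arr_def by auto
  have "u = (u \<cdot> i) \<cdot> j" by (simp only: assoc[OF aj ai u] j(2) id_right[OF u])
  also have "\<dots> = (v \<cdot> i) \<cdot> j" by (simp only: assms(5))
  also have "\<dots> = v" by (simp only: assoc[OF aj ai v] j(2) id_right[OF v])
  finally show ?thesis .
qed

end


section \<open>Colimits of parallel arrows\<close>

text \<open>
  The identities of \<open>a\<close> and of \<open>b\<close> are both \<open>z\<close>, and \<open>S\<close> is the set of arrows from \<open>a\<close> to \<open>b\<close>.
\<close>

definition par_cat :: "'j \<Rightarrow> 'j \<Rightarrow> 'u \<Rightarrow> 'u set \<Rightarrow> ('j, 'u) precat" where
  "par_cat a b z S = \<lparr>Obj = {a, b},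
     Hom = (\<lambda>x y. if x = y then {z} else if x = a \<and> y = b then S else {}),
     Idt = (\<lambda>_. z), Cmp = (\<lambda>g f. if f = z then g else f)\<rparr>"

text \<open>An arrow is recognised as an identity by its label alone, which is why \<open>z\<close>
  is kept outside \<open>S\<close> below. The labelling \<open>\<phi>\<close> need not be injective:
  colimits will depend only on its image.\<close>

definition par_func ::
  "('o, 'm, 'x) precat_scheme \<Rightarrow> 'j \<Rightarrow> 'u \<Rightarrow> 'o \<Rightarrow> 'o \<Rightarrow> ('u \<Rightarrow> 'm) \<Rightarrow> ('j, 'u, 'o, 'm) func" where
  "par_func K a z X Y \<phi> = \<lparr>FObj = (\<lambda>j. if j = a then X else Y),
     FHom = (\<lambda>j _ s. if s = z then Idt K (if j = a then X else Y) else \<phi> s)\<rparr>"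

text \<open>For \<open>F = {}\<close> this is a coproduct, and otherwise \<open>q\<close> is a joint coequalizer of \<open>F\<close>.\<close>

definition is_par_colimit ::
  "('o, 'm, 'x) precat_scheme \<Rightarrow> 'o \<Rightarrow> 'o \<Rightarrow> 'm set \<Rightarrow> 'o \<Rightarrow> 'm \<Rightarrow> 'm \<Rightarrow> bool" where
  "is_par_colimit K X Y F L p q \<longleftrightarrow> arr K X L p \<and> arr K Y L q \<and> (\<forall>f \<in> F. q \<cdot>\<^bsub>K\<^esub> f = p) \<and>
     (\<forall>Z u v. arr K X Z u \<longrightarrow> arr K Y Z v \<longrightarrow> (\<forall>f \<in> F. v \<cdot>\<^bsub>K\<^esub> f = u) \<longrightarrow>
        (\<exists>!h. arr K L Z h \<and> h \<cdot>\<^bsub>K\<^esub> p = u \<and> h \<cdot>\<^bsub>K\<^esub> q = v))"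

lemma par_colimit_factor:
  assumes "is_par_colimit K X Y F L p q" "arr K X Z u" "arr K Y Z v" "\<And>f. f \<in> F \<Longrightarrow> v \<cdot>\<^bsub>K\<^esub> f = u"
  obtains h where "arr K L Z h" "h \<cdot>\<^bsub>K\<^esub> p = u" "h \<cdot>\<^bsub>K\<^esub> q = v"
  using assms unfolding is_par_colimit_def by metis

lemma category_par_cat: "a \<noteq> b \<Longrightarrow> z \<notin> S \<Longrightarrow> category (par_cat a b z S)"
  unfolding par_cat_def by unfold_locales (auto split: if_splits)

lemma arrows_par_cat: "arrows (par_cat a b z S) \<subseteq> insert z S"
  unfolding arrows_def par_cat_def by auto

lemma is_functor_par_func:
  assumes "category K" "X \<in> Obj K" "Y \<in> Obj K" "a \<noteq> b" "z \<notin> S" "\<phi> ` S \<subseteq> Hom K X Y"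
  shows "is_functor (par_cat a b z S) K (par_func K a z X Y \<phi>)" (is "is_functor _ _ ?D")
proof -
  interpret category K by fact
  have obj: "FObj ?D x \<in> Obj K" for x using assms(2,3) by (simp add: par_func_def)
  have hom: "FHom ?D x y f \<in> Hom K (FObj ?D x) (FObj ?D y)"
    if "x \<in> Obj (par_cat a b z S)" "y \<in> Obj (par_cat a b z S)" "f \<in> Hom (par_cat a b z S) x y" for x y f
    using that assms(4-6) Idt_in[OF assms(2)] Idt_in[OF assms(3)]
    by (auto simp: par_func_def par_cat_def image_subset_iff split: if_splits)
  show ?thesis
    unfolding is_functor_def
  proof (intro conjI ballI)
    fix x y w f g
    assume *: "x \<in> Obj (par_cat a b z S)" "y \<in> Obj (par_cat a b z S)" "w \<in> Obj (par_cat a b z S)"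
      "f \<in> Hom (par_cat a b z S) x y" "g \<in> Hom (par_cat a b z S) y w"
    \<comment> \<open>The only arrows out of \<open>b\<close> and the only arrows into
      \<open>a\<close> are identities, so one of two composable arrows is an identity.\<close>
    consider "f = z" "x = y" | "g = z" "f \<noteq> z" "y = w"
      using * assms(4,5) by (auto simp: par_cat_def split: if_splits)
    then show "FHom ?D x w (g \<cdot>\<^bsub>par_cat a b z S\<^esub> f) = FHom ?D y w g \<cdot>\<^bsub>K\<^esub> FHom ?D x y f"
    proof cases
      case 1
      have "FHom ?D y w g \<in> Hom K (FObj ?D y) (FObj ?D w)" by (rule hom[OF *(2,3,5)])
      then show ?thesis using 1 obj[of y] obj[of w] Cmp_Idt
        by (simp add: par_func_def par_cat_def)
    next
      case 2
      have "FHom ?D x y f \<in> Hom K (FObj ?D x) (FObj ?D y)" by (rule hom[OF *(1,2,4)])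
      then show ?thesis using 2 obj[of x] obj[of y] Idt_Cmp
        by (simp add: par_func_def par_cat_def)
    qed
  qed (use obj hom in \<open>simp_all add: par_func_def par_cat_def\<close>)
qed

lemma is_cocone_par:
  assumes "category K" "X \<in> Obj K" "Y \<in> Obj K" "a \<noteq> b" "z \<notin> S" "\<phi> ` S \<subseteq> Hom K X Y"
  shows "is_cocone (par_cat a b z S) K (par_func K a z X Y \<phi>) L \<iota> \<longleftrightarrow>
    arr K X L (\<iota> a) \<and> arr K Y L (\<iota> b) \<and> (\<forall>f \<in> \<phi> ` S. \<iota> b \<cdot>\<^bsub>K\<^esub> f = \<iota> a)"
proof -
  interpret category K by fact
  show ?thesis
    using assms Cmp_Idt[of X L "\<iota> a"] Cmp_Idt[of Y L "\<iota> b"]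
    unfolding is_cocone_def par_func_def par_cat_def arr_def
    by (auto split: if_splits)
qed

text \<open>The right-hand side mentions no index category. A colimit found over one shape can thus
  be used over another: cocompleteness of \<open>C\<close> speaks of shapes in \<open>'u\<close>,
  and (C1) of shapes in \<open>nat\<close>.\<close>

lemma is_colimit_par:
  assumes "category K" "X \<in> Obj K" "Y \<in> Obj K" "a \<noteq> b" "z \<notin> S" "\<phi> ` S \<subseteq> Hom K X Y"
  shows "is_colimit (par_cat a b z S) K (par_func K a z X Y \<phi>) L \<iota> \<longleftrightarrow>
    is_par_colimit K X Y (\<phi> ` S) L (\<iota> a) (\<iota> b)" (is "?l \<longleftrightarrow> ?r")
proof
  have O: "Obj (par_cat a b z S) = {a, b}" by (simp add: par_cat_def)
  note cc = is_cocone_par[OF assms]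
  { assume l: ?l
    show ?r unfolding is_par_colimit_def
    proof (intro conjI allI impI)
      fix Z u v assume h: "arr K X Z u" "arr K Y Z v" "\<forall>f \<in> \<phi> ` S. v \<cdot>\<^bsub>K\<^esub> f = u"
      have "is_cocone (par_cat a b z S) K (par_func K a z X Y \<phi>) Z (\<lambda>j. if j = a then u else v)"
        unfolding cc using h \<open>a \<noteq> b\<close> by simp
      then have "\<exists>!h. h \<in> Hom K L Z \<and> (\<forall>j \<in> {a, b}. h \<cdot>\<^bsub>K\<^esub> \<iota> j = (if j = a then u else v))"
        using l unfolding is_colimit_def O by blast
      moreover have "L \<in> Obj K" "Z \<in> Obj K" using l h unfolding is_colimit_def is_cocone_def arr_def by auto
      ultimately show "\<exists>!h. arr K L Z h \<and> h \<cdot>\<^bsub>K\<^esub> \<iota> a = u \<and> h \<cdot>\<^bsub>K\<^esub> \<iota> b = v"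
        using \<open>a \<noteq> b\<close> unfolding arr_def by simp
    next
      have "is_cocone (par_cat a b z S) K (par_func K a z X Y \<phi>) L \<iota>"
        using l unfolding is_colimit_def by (rule conjunct1)
      then show "arr K X L (\<iota> a)" "arr K Y L (\<iota> b)" "\<forall>f \<in> \<phi> ` S. \<iota> b \<cdot>\<^bsub>K\<^esub> f = \<iota> a"
        unfolding cc by auto
    qed }
  { assume r: ?r
    show ?l unfolding is_colimit_def
    proof (intro conjI allI impI)
      show "is_cocone (par_cat a b z S) K (par_func K a z X Y \<phi>) L \<iota>"
        using r unfolding cc is_par_colimit_def by blast
      fix Z \<kappa> assume "is_cocone (par_cat a b z S) K (par_func K a z X Y \<phi>) Z \<kappa>"
      then have c: "arr K X Z (\<kappa> a)" "arr K Y Z (\<kappa> b)" "\<forall>f \<in> \<phi> ` S. \<kappa> b \<cdot>\<^bsub>K\<^esub> f = \<kappa> a"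
        unfolding cc by auto
      then have "\<exists>!h. arr K L Z h \<and> h \<cdot>\<^bsub>K\<^esub> \<iota> a = \<kappa> a \<and> h \<cdot>\<^bsub>K\<^esub> \<iota> b = \<kappa> b"
        using r unfolding is_par_colimit_def by blast
      moreover have "L \<in> Obj K" "Z \<in> Obj K" using r c unfolding is_par_colimit_def arr_def by auto
      ultimately show "\<exists>!h. h \<in> Hom K L Z \<and> (\<forall>j \<in> Obj (par_cat a b z S). h \<cdot>\<^bsub>K\<^esub> \<iota> j = \<kappa> j)"
        unfolding O arr_def by simp
    qed }
qed

lemma par_colimit_eqI:
  assumes "is_par_colimit K X Y F L p q" "category K" "F \<subseteq> Hom K X Y"
    and "arr K L Z u" "arr K L Z v" "u \<cdot>\<^bsub>K\<^esub> p = v \<cdot>\<^bsub>K\<^esub> p" "u \<cdot>\<^bsub>K\<^esub> q = v \<cdot>\<^bsub>K\<^esub> q"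
  shows "u = v"
proof -
  interpret category K by fact
  have p: "arr K X L p" and q: "arr K Y L q" and e: "\<forall>f \<in> F. q \<cdot>\<^bsub>K\<^esub> f = p"
    using assms(1) unfolding is_par_colimit_def by auto
  have f: "arr K X Y f" if "f \<in> F" for f using that assms(3) p q unfolding arr_def by blast
  have up: "arr K X Z (u \<cdot>\<^bsub>K\<^esub> p)" "arr K Y Z (u \<cdot>\<^bsub>K\<^esub> q)"
    by (rule arr_Cmp[OF p assms(4)] arr_Cmp[OF q assms(4)])+
  have "\<forall>f \<in> F. (u \<cdot>\<^bsub>K\<^esub> q) \<cdot>\<^bsub>K\<^esub> f = u \<cdot>\<^bsub>K\<^esub> p"
    using assoc[OF f q assms(4)] e by simp
  with up have "\<exists>!h. arr K L Z h \<and> h \<cdot>\<^bsub>K\<^esub> p = u \<cdot>\<^bsub>K\<^esub> p \<and> h \<cdot>\<^bsub>K\<^esub> q = u \<cdot>\<^bsub>K\<^esub> q"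
    using assms(1) unfolding is_par_colimit_def by blast
  then show ?thesis using assms(4-7) by metis
qed

text \<open>A diagram shape must have its arrows in \<open>'u\<close> or in \<open>nat\<close>,
  while \<open>F\<close> consists of morphisms of type \<open>'m\<close>. Hence \<open>F\<close> is
  relabelled, with one label more than its cardinality, the extra one being reserved for the
  identities.\<close>

lemma finite_reindex:
  assumes "finite F" "infinite (UNIV :: 'u set)"
  obtains z :: 'u and S \<phi> where "finite S" "z \<notin> S" "\<phi> ` S = F"
proof -
  obtain T :: "'u set" where T: "finite T" "card T = Suc (card F)"
    using infinite_arbitrarily_large[OF assms(2)] by blast
  then obtain z where z: "z \<in> T" by fastforce
  with T have "card (T - {z}) = card F" by simp
  with T(1) assms(1) obtain \<phi> where "bij_betw \<phi> (T - {z}) F"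
    using finite_same_card_bij[of "T - {z}" F] by auto
  then show thesis using that[of "T - {z}" z \<phi>] T(1) by (auto simp: bij_betw_def)
qed


section \<open>Preadditive categories\<close>

context preadditive_category
begin

lemma arr_Add [arr]: "arr C X Y f \<Longrightarrow> arr C X Y g \<Longrightarrow> arr C X Y (Add C f g)"
  using Hom_comm_group[of X Y] monoid.m_closed[of "Hom_group C X Y" f g]
  unfolding comm_group_def group_def arr_def by (simp add: Hom_group_def)

lemma arr_Zer [arr]: "X \<in> Obj C \<Longrightarrow> Y \<in> Obj C \<Longrightarrow> arr C X Y (Zer C X Y)"
  using Hom_comm_group[of X Y] monoid.one_closed[of "Hom_group C X Y"]
  unfolding comm_group_def group_def arr_def by (simp add: Hom_group_def)

lemma Add_Zer:
  assumes "arr C X Y f"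
  shows "Add C f (Zer C X Y) = f" "Add C (Zer C X Y) f = f"
proof -
  interpret G: comm_group "Hom_group C X Y" using assms Hom_comm_group unfolding arr_def by blast
  have "f \<in> carrier (Hom_group C X Y)" using assms by (simp add: Hom_group_def arr_def)
  from G.r_one[OF this] G.l_one[OF this]
  show "Add C f (Zer C X Y) = f" "Add C (Zer C X Y) f = f" by (simp_all only: Hom_group_def monoid.simps)
qed

lemma Add_idem_eq_Zer:
  assumes "arr C X Y f" "Add C f f = f"
  shows "f = Zer C X Y"
proof -
  interpret G: comm_group "Hom_group C X Y" using assms Hom_comm_group unfolding arr_def by blast
  have "f \<in> carrier (Hom_group C X Y)" using assms by (simp add: Hom_group_def arr_def)
  moreover have "f \<otimes>\<^bsub>Hom_group C X Y\<^esub> f = f" using assms by (simp add: Hom_group_def)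
  ultimately have "f = \<one>\<^bsub>Hom_group C X Y\<^esub>" by simp
  then show ?thesis by (simp add: Hom_group_def)
qed

text \<open>Distributivity gives \<open>0 f = (0 + 0) f = 0 f + 0 f\<close>, and the only idempotent
  of a group is its neutral element. The same argument on the other side gives
  \<open>Cmp_Zer\<close>.\<close>

lemma Zer_Cmp:
  assumes "arr C X Y f" "Z \<in> Obj C"
  shows "Zer C Y Z \<cdot> f = Zer C X Z"
proof (rule Add_idem_eq_Zer)
  have Y: "Y \<in> Obj C" "X \<in> Obj C" "f \<in> Hom C X Y" using assms unfolding arr_def by auto
  show "arr C X Z (Zer C Y Z \<cdot> f)" by (rule arr assms Y)+
  have z: "arr C Y Z (Zer C Y Z)" by (rule arr assms Y)+
  then show "Add C (Zer C Y Z \<cdot> f) (Zer C Y Z \<cdot> f) = Zer C Y Z \<cdot> f"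
    using Cmp_Add_left[of X Y Z f "Zer C Y Z" "Zer C Y Z"] Add_Zer[OF z] Y assms(2)
    unfolding arr_def by simp
qed

lemma Cmp_Zer:
  assumes "arr C X Y f" "W \<in> Obj C"
  shows "f \<cdot> Zer C W X = Zer C W Y"
proof (rule Add_idem_eq_Zer)
  have Y: "Y \<in> Obj C" "X \<in> Obj C" "f \<in> Hom C X Y" using assms unfolding arr_def by auto
  show "arr C W Y (f \<cdot> Zer C W X)" by (rule arr assms Y)+
  have z: "arr C W X (Zer C W X)" by (rule arr assms Y)+
  then show "Add C (f \<cdot> Zer C W X) (f \<cdot> Zer C W X) = f \<cdot> Zer C W X"
    using Cmp_Add_right[of W X Y "Zer C W X" "Zer C W X" f] Add_Zer[OF z] Y assms(2)
    unfolding arr_def by simp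
qed

lemma Add_Cmp:
  "arr C X Y f \<Longrightarrow> arr C Y Z g \<Longrightarrow> arr C Y Z h \<Longrightarrow> Add C g h \<cdot> f = Add C (g \<cdot> f) (h \<cdot> f)"
  unfolding arr_def using Cmp_Add_left by blast

lemma Cmp_Add:
  "arr C X Y f \<Longrightarrow> arr C X Y g \<Longrightarrow> arr C Y Z h \<Longrightarrow> h \<cdot> Add C f g = Add C (h \<cdot> f) (h \<cdot> g)"
  unfolding arr_def using Cmp_Add_right by blast

lemma zero_object_arr_eq:
  assumes "is_zero_object C Z"
  shows "arr C Z Y f \<Longrightarrow> arr C Z Y g \<Longrightarrow> f = g" and "arr C Y Z f \<Longrightarrow> arr C Y Z g \<Longrightarrow> f = g"
  using assms unfolding is_zero_object_def arr_def by blast+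

end

section \<open>Tensor products of typed morphisms\<close>

context symmetric_monoidal_category
begin

lemma Obj_tensor [arr]: "X \<in> Obj C \<Longrightarrow> Y \<in> Obj C \<Longrightarrow> X \<boxtimes> Y \<in> Obj C"
  by (rule TObj_in)

lemma arr_THom [arr]: "arr C X X' f \<Longrightarrow> arr C Y Y' g \<Longrightarrow> arr C (X \<boxtimes> Y) (X' \<boxtimes> Y') (f \<boxdot> g)"
  unfolding arr_def using THom_in TObj_in by blast

lemma arr_Asc [arr]:
  "X \<in> Obj C \<Longrightarrow> Y \<in> Obj C \<Longrightarrow> Z \<in> Obj C \<Longrightarrow> arr C ((X \<boxtimes> Y) \<boxtimes> Z) (X \<boxtimes> (Y \<boxtimes> Z)) (Asc C X Y Z)"
  using Asc_iso[of X Y Z] by (simp add: TObj_in arr_def is_iso_def)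

lemma arr_LUn [arr]: "X \<in> Obj C \<Longrightarrow> arr C (Unt C \<boxtimes> X) X (LUn C X)"
  using LUn_iso[of X] by (simp add: TObj_in Unt_in arr_def is_iso_def)

lemma arr_RUn [arr]: "X \<in> Obj C \<Longrightarrow> arr C (X \<boxtimes> Unt C) X (RUn C X)"
  using RUn_iso[of X] by (simp add: TObj_in Unt_in arr_def is_iso_def)

lemma arr_Brd [arr]: "X \<in> Obj C \<Longrightarrow> Y \<in> Obj C \<Longrightarrow> arr C (X \<boxtimes> Y) (Y \<boxtimes> X) (Brd C X Y)"
  using Brd_in[of X Y] by (simp add: TObj_in arr_def)

lemmas [arr] = Unt_in

lemma interchange:
  "arr C X X' f \<Longrightarrow> arr C X' X'' f' \<Longrightarrow> arr C Y Y' g \<Longrightarrow> arr C Y' Y'' g' \<Longrightarrow>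
    (f' \<boxdot> g') \<cdot> (f \<boxdot> g) = (f' \<cdot> f) \<boxdot> (g' \<cdot> g)"
  unfolding arr_def using THom_Cmp[of X X' X'' Y Y' Y'' f f' g g'] by simp

text \<open>Together with \<open>THom_left_right\<close> this lets the two factors act in either
  order. The commutativity of the endomorphism ring and the descent of the module axioms to a
  quotient rest on this exchange.\<close>

lemma THom_right_left:
  assumes "arr C X X' f" "arr C Y Y' g"
  shows "(f \<boxdot> Idt C Y') \<cdot> (Idt C X \<boxdot> g) = f \<boxdot> g"
proof -
  have "X \<in> Obj C" "Y' \<in> Obj C" using assms unfolding arr_def by auto
  then show ?thesis
    using interchange[OF arr_Idt assms(1) assms(2) arr_Idt] id_right[OF assms(1)] id_left[OF assms(2)]
    by simp
qed

lemma THom_left_right: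
  assumes "arr C X X' f" "arr C Y Y' g"
  shows "(Idt C X' \<boxdot> g) \<cdot> (f \<boxdot> Idt C Y) = f \<boxdot> g"
proof -
  have "X' \<in> Obj C" "Y \<in> Obj C" using assms unfolding arr_def by auto
  then show ?thesis
    using interchange[OF assms(1) arr_Idt arr_Idt assms(2)] id_left[OF assms(1)] id_right[OF assms(2)]
    by simp
qed

lemma THom_Cmp_left:
  "arr C X Y f \<Longrightarrow> arr C Y Z g \<Longrightarrow> W \<in> Obj C \<Longrightarrow> (g \<boxdot> Idt C W) \<cdot> (f \<boxdot> Idt C W) = (g \<cdot> f) \<boxdot> Idt C W"
  using interchange[OF _ _ arr_Idt arr_Idt, of X Y f Z g W] id_left[OF arr_Idt, of W] by simp

lemma THom_Cmp_right:
  "arr C X Y f \<Longrightarrow> arr C Y Z g \<Longrightarrow> W \<in> Obj C \<Longrightarrow> (Idt C W \<boxdot> g) \<cdot> (Idt C W \<boxdot> f) = Idt C W \<boxdot> (g \<cdot> f)"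
  using interchange[OF arr_Idt arr_Idt, of W X Y f Z g] id_left[OF arr_Idt, of W] by simp

end

section \<open>The tensor product as an additive functor\<close>

context relative_geometry
begin

lemma infinite_universe: "infinite (UNIV :: 'u set)"
  using universe unfolding universe_def
  by (simp add: infinite_le_lepoll lesspoll_def)

lemma parallel_shape:
  assumes "finite F"
  obtains a b z :: 'u and S \<phi> where "a \<noteq> b" "z \<notin> S" "\<phi> ` S = F" "small_cat (par_cat a b z S)"
proof -
  obtain z :: 'u and S \<phi> where S: "finite S" "z \<notin> S" "\<phi> ` S = F"
    using finite_reindex[OF assms infinite_universe] .
  obtain b :: 'u where "b \<noteq> z"
    using ex_new_if_finite[OF infinite_universe, of "{z}"] by auto
  \<comment> \<open>Objects and arrows are separate sets, so \<open>z\<close> may serve both as the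
    first object and as the label of the identities.\<close>
  then have ab: "z \<noteq> b" by simp
  have "finite (arrows (par_cat z b z S))"
    by (rule finite_subset[OF arrows_par_cat]) (simp add: S(1))
  moreover have "finite (Obj (par_cat z b z S))" by (simp add: par_cat_def)
  ultimately have "small_cat (par_cat z b z S)"
    unfolding small_cat_def
    using category_par_cat[OF ab S(2)] finite_lesspoll_infinite[OF infinite_universe] by blast
  with ab S(2,3) show thesis using that by blast
qed

lemma par_colimit_exists:
  assumes "X \<in> Obj C" "Y \<in> Obj C" "finite F" "F \<subseteq> Hom C X Y"
  obtains L p q where "is_par_colimit C X Y F L p q"
proof -
  obtain a b z :: 'u and S \<phi> where S: "a \<noteq> b" "z \<notin> S" "\<phi> ` S = F" "small_cat (par_cat a b z S)"
    using parallel_shape[OF assms(3)] .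
  have \<phi>: "\<phi> ` S \<subseteq> Hom C X Y" using S(3) assms(4) by simp
  note par = category_axioms assms(1,2) S(1,2) \<phi>
  obtain L \<iota> where "is_colimit (par_cat a b z S) C (par_func C a z X Y \<phi>) L \<iota>"
    using cocomplete S(4) is_functor_par_func[OF par] unfolding has_small_colimits_def by blast
  then show thesis using that S(3) is_colimit_par[OF par] by metis
qed

lemma tensor_par_colimit:
  assumes "is_par_colimit C X Y F L p q" "X \<in> Obj C" "Y \<in> Obj C" "finite F" "F \<subseteq> Hom C X Y" "W \<in> Obj C"
  shows "is_par_colimit C (X \<boxtimes> W) (Y \<boxtimes> W) ((\<lambda>f. f \<boxdot> Idt C W) ` F)
    (L \<boxtimes> W) (p \<boxdot> Idt C W) (q \<boxdot> Idt C W)"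
proof -
  obtain a b z :: 'u and S \<phi> where S: "a \<noteq> b" "z \<notin> S" "\<phi> ` S = F" "small_cat (par_cat a b z S)"
    using parallel_shape[OF assms(4)] .
  have \<phi>: "\<phi> ` S \<subseteq> Hom C X Y" using S(3) assms(5) by simp
  note par = category_axioms assms(2,3) S(1,2) \<phi>
  define \<psi> where "\<psi> = (\<lambda>s. \<phi> s \<boxdot> Idt C W)"
  have im: "\<psi> ` S = (\<lambda>f. f \<boxdot> Idt C W) ` F" unfolding \<psi>_def S(3)[symmetric] by auto
  have "\<psi> ` S \<subseteq> Hom C (X \<boxtimes> W) (Y \<boxtimes> W)"
    unfolding im using assms THom_in[OF assms(2,3,6,6) _ Idt_in[OF assms(6)]] by blast
  note par' = category_axioms TObj_in[OF assms(2,6)] TObj_in[OF assms(3,6)] S(1,2) this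
  have "is_colimit (par_cat a b z S) C (par_func C a z X Y \<phi>) L (\<lambda>j. if j = a then p else q)"
    unfolding is_colimit_par[OF par] using assms(1) S(1,3) by simp
  then have "is_colimit (par_cat a b z S) C
      (comp_func (tensor_right C W) (par_func C a z X Y \<phi>)) (FObj (tensor_right C W) L)
      (\<lambda>j. FHom (tensor_right C W) (FObj (par_func C a z X Y \<phi>) j) L (if j = a then p else q))"
    using tensor_cocontinuous[OF assms(6)] S(4) is_functor_par_func[OF par]
    unfolding preserves_small_colimits_def by blast
  \<comment> \<open>The image of the diagram is literally a diagram of the same kind with labelling
    \<open>\<psi>\<close>, since \<open>THom_Idt\<close> sends identities to identities.\<close>
  moreover have "comp_func (tensor_right C W) (par_func C a z X Y \<phi>)
      = par_func C a z (X \<boxtimes> W) (Y \<boxtimes> W) \<psi>"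
    using THom_Idt assms(2,3,6)
    by (simp add: comp_func_def tensor_right_def par_func_def \<psi>_def fun_eq_iff)
  ultimately show ?thesis
    using is_colimit_par[OF par', unfolded im] S(1) by (simp add: tensor_right_def)
qed

text \<open>A zero object is a coproduct of two copies of itself with equal injections. Tensoring
  preserves this, so \<open>u\<close> and \<open>v\<close> are composites of one map
  \<open>h\<close> with the same injection.\<close>

lemma tensor_zero_object_arr_eq:
  assumes Z: "is_zero_object C Z" and W: "W \<in> Obj C"
    and u: "arr C (Z \<boxtimes> W) Y u" and v: "arr C (Z \<boxtimes> W) Y v"
  shows "u = v"
proof -
  have Zo: "Z \<in> Obj C" using Z unfolding is_zero_object_def by blast
  have "is_par_colimit C Z Z {} Z (Idt C Z) (Idt C Z)"
    unfolding is_par_colimit_def using zero_object_arr_eq(1)[OF Z] id_right arr_Idt[OF Zo] by blast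
  from tensor_par_colimit[OF this Zo Zo _ _ W]
  have "is_par_colimit C (Z \<boxtimes> W) (Z \<boxtimes> W) {} (Z \<boxtimes> W) (Idt C Z \<boxdot> Idt C W) (Idt C Z \<boxdot> Idt C W)" by simp
  then obtain h where "h \<cdot> (Idt C Z \<boxdot> Idt C W) = u" "h \<cdot> (Idt C Z \<boxdot> Idt C W) = v"
    by (rule par_colimit_factor[OF _ u v]) simp_all
  then show ?thesis by simp
qed

text \<open>A zero map factors through a zero object \<open>Z\<close>, and after tensoring all maps
  out of \<open>Z \<boxtimes> W\<close> with a given target still coincide.\<close>

lemma Zer_THom:
  assumes X: "X \<in> Obj C" and Y: "Y \<in> Obj C" and W: "W \<in> Obj C"
  shows "Zer C X Y \<boxdot> Idt C W = Zer C (X \<boxtimes> W) (Y \<boxtimes> W)"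
proof -
  obtain Z where Z: "is_zero_object C Z" using has_zero_object by blast
  then have Zo: "Z \<in> Obj C" unfolding is_zero_object_def by blast
  note ob = X Y W Zo
  have "Zer C X Y = Zer C Z Y \<cdot> Zer C X Z"
    by (rule Zer_Cmp[symmetric]) (rule arr ob)+
  then have "Zer C X Y \<boxdot> Idt C W = (Zer C Z Y \<boxdot> Idt C W) \<cdot> (Zer C X Z \<boxdot> Idt C W)"
    by (simp only:) (rule THom_Cmp_left[symmetric], (rule arr ob)+)
  also have "Zer C Z Y \<boxdot> Idt C W = Zer C (Z \<boxtimes> W) (Y \<boxtimes> W)"
    by (rule tensor_zero_object_arr_eq[OF Z W]) (rule arr ob)+
  also have "\<dots> \<cdot> (Zer C X Z \<boxdot> Idt C W) = Zer C (X \<boxtimes> W) (Y \<boxtimes> W)"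
    by (rule Zer_Cmp) (rule arr ob)+
  finally show ?thesis .
qed

lemma biproduct_par_colimit:
  assumes "X \<in> Obj C" "Y \<in> Obj C" "is_biproduct C X Y P i\<^sub>1 i\<^sub>2 p\<^sub>1 p\<^sub>2"
  shows "is_par_colimit C X Y {} P i\<^sub>1 i\<^sub>2"
proof -
  have i: "arr C X P i\<^sub>1" "arr C Y P i\<^sub>2" and p: "arr C P X p\<^sub>1" "arr C P Y p\<^sub>2"
    and e: "p\<^sub>1 \<cdot> i\<^sub>1 = Idt C X" "p\<^sub>2 \<cdot> i\<^sub>2 = Idt C Y" "p\<^sub>2 \<cdot> i\<^sub>1 = Zer C X Y" "p\<^sub>1 \<cdot> i\<^sub>2 = Zer C Y X"
    and s: "Add C (i\<^sub>1 \<cdot> p\<^sub>1) (i\<^sub>2 \<cdot> p\<^sub>2) = Idt C P"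
    using assms unfolding is_biproduct_def arr_def by auto
  show ?thesis unfolding is_par_colimit_def
  proof (intro conjI allI impI i)
    fix Z u v assume u: "arr C X Z u" and v: "arr C Y Z v"
    have Zo: "Z \<in> Obj C" using u unfolding arr_def by blast
    note up = arr_Cmp[OF p(1) u] and vp = arr_Cmp[OF p(2) v]
    show "\<exists>!h. arr C P Z h \<and> h \<cdot> i\<^sub>1 = u \<and> h \<cdot> i\<^sub>2 = v"
    proof (rule ex1I[of _ "Add C (u \<cdot> p\<^sub>1) (v \<cdot> p\<^sub>2)"], intro conjI)
      show "arr C P Z (Add C (u \<cdot> p\<^sub>1) (v \<cdot> p\<^sub>2))" by (rule arr u v p)+
      show "Add C (u \<cdot> p\<^sub>1) (v \<cdot> p\<^sub>2) \<cdot> i\<^sub>1 = u"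
        by (simp only: Add_Cmp[OF i(1) up vp] assoc[OF i(1) p(1) u] assoc[OF i(1) p(2) v] e
            id_right[OF u] Cmp_Zer[OF v assms(1)] Add_Zer[OF u])
      show "Add C (u \<cdot> p\<^sub>1) (v \<cdot> p\<^sub>2) \<cdot> i\<^sub>2 = v"
        by (simp only: Add_Cmp[OF i(2) up vp] assoc[OF i(2) p(1) u] assoc[OF i(2) p(2) v] e
            id_right[OF v] Cmp_Zer[OF u assms(2)] Add_Zer[OF v])
      fix h assume "arr C P Z h \<and> h \<cdot> i\<^sub>1 = u \<and> h \<cdot> i\<^sub>2 = v"
      then have h: "arr C P Z h" "h \<cdot> i\<^sub>1 = u" "h \<cdot> i\<^sub>2 = v" by auto
      have "h = h \<cdot> Add C (i\<^sub>1 \<cdot> p\<^sub>1) (i\<^sub>2 \<cdot> p\<^sub>2)" by (simp only: s id_right[OF h(1)])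
      also have "\<dots> = Add C ((h \<cdot> i\<^sub>1) \<cdot> p\<^sub>1) ((h \<cdot> i\<^sub>2) \<cdot> p\<^sub>2)"
        by (simp only: assoc[OF p(1) i(1) h(1)] assoc[OF p(2) i(2) h(1)]
            Cmp_Add[OF arr_Cmp[OF p(1) i(1)] arr_Cmp[OF p(2) i(2)] h(1)])
      finally show "h = Add C (u \<cdot> p\<^sub>1) (v \<cdot> p\<^sub>2)" by (simp only: h(2,3))
    qed
  qed auto
qed

text \<open>
  A functor that preserves binary coproducts is additive: \<open>f + g\<close> factors as \<open>p\<^sub>1 + p\<^sub>2\<close> after the
  map into \<open>Y \<oplus> Y\<close> with components \<open>f\<close> and \<open>g\<close>.
\<close>

lemma Add_THom:
  assumes f: "arr C X Y f" and g: "arr C X Y g" and W: "W \<in> Obj C"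
  shows "Add C f g \<boxdot> Idt C W = Add C (f \<boxdot> Idt C W) (g \<boxdot> Idt C W)"
proof -
  let ?T = "\<lambda>f. f \<boxdot> Idt C W"
  have X: "X \<in> Obj C" and Y: "Y \<in> Obj C" using f unfolding arr_def by auto
  obtain P i\<^sub>1 i\<^sub>2 p\<^sub>1 p\<^sub>2 where bi: "is_biproduct C Y Y P i\<^sub>1 i\<^sub>2 p\<^sub>1 p\<^sub>2"
    using has_biproducts[OF Y Y] by blast
  then have i: "arr C Y P i\<^sub>1" "arr C Y P i\<^sub>2" and p: "arr C P Y p\<^sub>1" "arr C P Y p\<^sub>2"
    and e: "p\<^sub>1 \<cdot> i\<^sub>1 = Idt C Y" "p\<^sub>2 \<cdot> i\<^sub>2 = Idt C Y" "p\<^sub>2 \<cdot> i\<^sub>1 = Zer C Y Y" "p\<^sub>1 \<cdot> i\<^sub>2 = Zer C Y Y"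
    using Y unfolding is_biproduct_def arr_def by auto
  note ty = X Y W f g i p
  have T: "arr C (U \<boxtimes> W) (V \<boxtimes> W) (?T h)" if "arr C U V h" for U V h by (rule arr that W)+
  have YW: "Y \<boxtimes> W \<in> Obj C" and iY: "arr C Y Y (Idt C Y)" by (rule arr W Y)+
  note iT = T[OF iY]
  note TC = THom_Cmp_left[OF _ _ W]
  have pp: "arr C P Y (Add C p\<^sub>1 p\<^sub>2)" by (rule arr ty)+
  have "?T (Add C p\<^sub>1 p\<^sub>2) = Add C (?T p\<^sub>1) (?T p\<^sub>2)"
  \<comment> \<open>The tensored injections are jointly epic, as \<open>P \<boxtimes> W\<close> is
    again a coproduct. Composed with either of them, both sides become
    \<open>Idt C Y \<boxdot> Idt C W\<close>.\<close>
  proof (rule par_colimit_eqI[OF tensor_par_colimit[OF biproduct_par_colimit[OF Y Y bi] Y Y _ _ W]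
        category_axioms])
    show "?T (Add C p\<^sub>1 p\<^sub>2) \<cdot> ?T i\<^sub>1 = Add C (?T p\<^sub>1) (?T p\<^sub>2) \<cdot> ?T i\<^sub>1"
      by (simp only: TC[OF i(1) pp] Add_Cmp[OF i(1) p] Add_Cmp[OF T[OF i(1)] T[OF p(1)] T[OF p(2)]]
          TC[OF i(1) p(1)] TC[OF i(1) p(2)] e Add_Zer[OF iY] Zer_THom[OF Y Y W] Add_Zer[OF iT])
    show "?T (Add C p\<^sub>1 p\<^sub>2) \<cdot> ?T i\<^sub>2 = Add C (?T p\<^sub>1) (?T p\<^sub>2) \<cdot> ?T i\<^sub>2"
      by (simp only: TC[OF i(2) pp] Add_Cmp[OF i(2) p] Add_Cmp[OF T[OF i(2)] T[OF p(1)] T[OF p(2)]]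
          TC[OF i(2) p(1)] TC[OF i(2) p(2)] e Add_Zer[OF iY] Zer_THom[OF Y Y W] Add_Zer[OF iT])
    show "arr C (P \<boxtimes> W) (Y \<boxtimes> W) (?T (Add C p\<^sub>1 p\<^sub>2))"
      "arr C (P \<boxtimes> W) (Y \<boxtimes> W) (Add C (?T p\<^sub>1) (?T p\<^sub>2))" by (rule arr ty)+
  qed simp_all
  moreover define m where "m = Add C (i\<^sub>1 \<cdot> f) (i\<^sub>2 \<cdot> g)"
  have m: "arr C X P m" unfolding m_def by (rule arr ty)+
  note if1 = arr_Cmp[OF f i(1)] and ig2 = arr_Cmp[OF g i(2)]
  have m1: "p\<^sub>1 \<cdot> m = f" unfolding m_def
    by (simp only: Cmp_Add[OF if1 ig2 p(1)] assoc[OF f i(1) p(1), symmetric]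
        assoc[OF g i(2) p(1), symmetric] e id_left[OF f] Zer_Cmp[OF g Y] Add_Zer[OF f])
  have m2: "p\<^sub>2 \<cdot> m = g" unfolding m_def
    by (simp only: Cmp_Add[OF if1 ig2 p(2)] assoc[OF f i(1) p(2), symmetric]
        assoc[OF g i(2) p(2), symmetric] e id_left[OF g] Zer_Cmp[OF f Y] Add_Zer[OF g])
  have "Add C f g = Add C p\<^sub>1 p\<^sub>2 \<cdot> m" by (simp only: Add_Cmp[OF m p] m1 m2)
  then have "?T (Add C f g) = ?T (Add C p\<^sub>1 p\<^sub>2) \<cdot> ?T m" by (simp only: TC[OF m pp])
  ultimately show ?thesis
    by (simp only: Add_Cmp[OF T[OF m] T[OF p(1)] T[OF p(2)]] TC[OF m p(1)] TC[OF m p(2)] m1 m2)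
qed

text \<open>The leg at \<open>X\<close> is zero and so puts no condition on a map out of
  \<open>L\<close>; the leg \<open>q\<close> alone determines it. Identities between maps out of
  quotients are checked below after composition with \<open>q\<close>.\<close>

lemma quotient_epi:
  assumes "is_par_colimit C X Y F L (Zer C X L) q" "F \<subseteq> Hom C X Y"
    and u: "arr C L Z u" and v: "arr C L Z v" and "u \<cdot> q = v \<cdot> q"
  shows "u = v"
proof (rule par_colimit_eqI[OF assms(1) category_axioms assms(2) u v _ assms(5)])
  have "X \<in> Obj C" using assms(1) unfolding is_par_colimit_def arr_def by blast
  then show "u \<cdot> Zer C X L = v \<cdot> Zer C X L" by (simp only: Cmp_Zer[OF u] Cmp_Zer[OF v])
qed

text \<open>Because \<open>Zer_THom\<close> keeps the first leg zero, the conclusion has the form of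
  the first hypothesis and the lemma can be iterated, as associativity of an action
  requires.\<close>

lemma tensor_quotient:
  assumes "is_par_colimit C X Y F L (Zer C X L) q" "finite F" "F \<subseteq> Hom C X Y" "W \<in> Obj C"
  shows "is_par_colimit C (X \<boxtimes> W) (Y \<boxtimes> W) ((\<lambda>f. f \<boxdot> Idt C W) ` F)
    (L \<boxtimes> W) (Zer C (X \<boxtimes> W) (L \<boxtimes> W)) (q \<boxdot> Idt C W)"
proof -
  have "X \<in> Obj C" "Y \<in> Obj C" "L \<in> Obj C"
    using assms(1) unfolding is_par_colimit_def arr_def by auto
  then show ?thesis using tensor_par_colimit[OF assms(1) _ _ assms(2-4)] Zer_THom assms(4) by simp
qed

lemma tensor_subset_Hom:
  assumes "X \<in> Obj C" "Y \<in> Obj C" "W \<in> Obj C" "F \<subseteq> Hom C X Y"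
  shows "(\<lambda>f. f \<boxdot> Idt C W) ` F \<subseteq> Hom C (X \<boxtimes> W) (Y \<boxtimes> W)"
  using THom_in[OF assms(1,2,3,3) _ Idt_in[OF assms(3)]] assms(4) by blast

end

section \<open>Modules\<close>

context relative_geometry
begin

lemma comm_monoidD:
  assumes "A \<in> Obj (Comm C)"
  shows "mon_obj A \<in> Obj C" "arr C (mon_obj A \<boxtimes> mon_obj A) (mon_obj A) (mon_mul A)"
    "arr C (Unt C) (mon_obj A) (mon_unt A)"
    "mon_mul A \<cdot> (mon_mul A \<boxdot> Idt C (mon_obj A)) =
      mon_mul A \<cdot> (Idt C (mon_obj A) \<boxdot> mon_mul A) \<cdot> Asc C (mon_obj A) (mon_obj A) (mon_obj A)"
    "mon_mul A \<cdot> (mon_unt A \<boxdot> Idt C (mon_obj A)) = LUn C (mon_obj A)"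
    "mon_mul A \<cdot> (Idt C (mon_obj A) \<boxdot> mon_unt A) = RUn C (mon_obj A)"
    "mon_mul A \<cdot> Brd C (mon_obj A) (mon_obj A) = mon_mul A"
  using assms Unt_in TObj_in unfolding Comm_def is_comm_monoid_def Let_def arr_def by simp_all

lemma moduleD:
  assumes "M \<in> Obj (ModCat C A)" "A \<in> Obj (Comm C)"
  shows "mod_obj M \<in> Obj C" "arr C (mod_obj M \<boxtimes> mon_obj A) (mod_obj M) (mod_act M)"
  using assms TObj_in comm_monoidD(1)[of A] unfolding ModCat_def is_module_def Let_def arr_def by simp_all

lemma arr_ModCat:
  assumes "A \<in> Obj (Comm C)"
  shows "arr (ModCat C A) M N f \<longleftrightarrow> M \<in> Obj (ModCat C A) \<and> N \<in> Obj (ModCat C A) \<and>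
    arr C (mod_obj M) (mod_obj N) f \<and> f \<cdot> mod_act M = mod_act N \<cdot> (f \<boxdot> Idt C (mon_obj A))"
  using moduleD[OF _ assms] unfolding arr_def by (auto simp: ModCat_def mod_hom_def)

lemma Hom_ModCat:
  assumes "A \<in> Obj (Comm C)" "M \<in> Obj (ModCat C A)" "N \<in> Obj (ModCat C A)"
  shows "f \<in> Hom (ModCat C A) M N \<longleftrightarrow>
    arr C (mod_obj M) (mod_obj N) f \<and> f \<cdot> mod_act M = mod_act N \<cdot> (f \<boxdot> Idt C (mon_obj A))"
  using arr_ModCat[OF assms(1), of M N f] assms(2,3) unfolding arr_def by blast

lemma category_ModCat:
  assumes A: "A \<in> Obj (Comm C)"
  shows "category (ModCat C A)"
proof
  note X = comm_monoidD(1)[OF A]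
  fix L M N P f g h
  { assume L: "L \<in> Obj (ModCat C A)"
    note l = moduleD[OF L A]
    have "Idt C (mod_obj L) \<cdot> mod_act L = mod_act L \<cdot> (Idt C (mod_obj L) \<boxdot> Idt C (mon_obj A))"
      by (simp only: THom_Idt[OF l(1) X] id_left[OF l(2)] id_right[OF l(2)])
    then show "Idt (ModCat C A) L \<in> Hom (ModCat C A) L L"
      unfolding Hom_ModCat[OF A L L] using arr_Idt[OF l(1)] by (simp add: ModCat_def) }
  { assume L: "L \<in> Obj (ModCat C A)" and M: "M \<in> Obj (ModCat C A)" and N: "N \<in> Obj (ModCat C A)"
      and f: "f \<in> Hom (ModCat C A) L M" and g: "g \<in> Hom (ModCat C A) M N"
    note l = moduleD[OF L A] and m = moduleD[OF M A] and n = moduleD[OF N A]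
    note f = f[unfolded Hom_ModCat[OF A L M]] and g = g[unfolded Hom_ModCat[OF A M N]]
    note F = f[THEN conjunct1] and G = g[THEN conjunct1]
    let ?T = "\<lambda>h. h \<boxdot> Idt C (mon_obj A)"
    have TF: "arr C (mod_obj L \<boxtimes> mon_obj A) (mod_obj M \<boxtimes> mon_obj A) (?T f)"
      and TG: "arr C (mod_obj M \<boxtimes> mon_obj A) (mod_obj N \<boxtimes> mon_obj A) (?T g)"
      by (rule arr F G X)+
    have "(g \<cdot> f) \<cdot> mod_act L = g \<cdot> (mod_act M \<cdot> ?T f)"
      by (simp only: assoc[OF l(2) F G] f)
    also have "\<dots> = (mod_act N \<cdot> ?T g) \<cdot> ?T f"
      by (simp only: assoc[OF TF m(2) G, symmetric] g)
    also have "\<dots> = mod_act N \<cdot> ?T (g \<cdot> f)"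
      by (simp only: assoc[OF TF TG n(2)] THom_Cmp_left[OF F G X])
    finally show "g \<cdot>\<^bsub>ModCat C A\<^esub> f \<in> Hom (ModCat C A) L N"
      unfolding Hom_ModCat[OF A L N] using arr_Cmp[OF F G] by (simp add: ModCat_def) }
  { assume M: "M \<in> Obj (ModCat C A)" and N: "N \<in> Obj (ModCat C A)" and f: "f \<in> Hom (ModCat C A) M N"
    then show "f \<cdot>\<^bsub>ModCat C A\<^esub> Idt (ModCat C A) M = f" "Idt (ModCat C A) N \<cdot>\<^bsub>ModCat C A\<^esub> f = f"
      using Hom_ModCat[OF A M N, of f] id_left[of _ _ f] id_right[of _ _ f] by (auto simp: ModCat_def) }
  { assume L: "L \<in> Obj (ModCat C A)" and M: "M \<in> Obj (ModCat C A)" and N: "N \<in> Obj (ModCat C A)"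
      and P: "P \<in> Obj (ModCat C A)" and f: "f \<in> Hom (ModCat C A) L M" and g: "g \<in> Hom (ModCat C A) M N"
      and h: "h \<in> Hom (ModCat C A) N P"
    have "(h \<cdot> g) \<cdot> f = h \<cdot> (g \<cdot> f)"
      by (rule assoc[of "mod_obj L" "mod_obj M" _ "mod_obj N" _ "mod_obj P"])
        (use f g h in \<open>simp_all add: Hom_ModCat[OF A] L M N P\<close>)
    then show "h \<cdot>\<^bsub>ModCat C A\<^esub> g \<cdot>\<^bsub>ModCat C A\<^esub> f = h \<cdot>\<^bsub>ModCat C A\<^esub> (g \<cdot>\<^bsub>ModCat C A\<^esub> f)"
      by (simp add: ModCat_def) }
qed

text \<open>Both sides of the equation that defines a module map are additive in the map:
  composition is biadditive, and tensoring with \<open>A\<close> is additive by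
  \<open>Add_THom\<close> and \<open>Zer_THom\<close>.\<close>

lemma subgroup_mod_hom:
  assumes A: "A \<in> Obj (Comm C)" and M: "M \<in> Obj (ModCat C A)" and N: "N \<in> Obj (ModCat C A)"
  shows "subgroup (Hom (ModCat C A) M N) (Hom_group C (mod_obj M) (mod_obj N))"
proof -
  note X = comm_monoidD(1)[OF A] and m = moduleD[OF M A] and n = moduleD[OF N A]
  let ?T = "\<lambda>h. h \<boxdot> Idt C (mon_obj A)"
  have MX: "mod_obj M \<boxtimes> mon_obj A \<in> Obj C" and NX: "mod_obj N \<boxtimes> mon_obj A \<in> Obj C" by (rule arr X m n)+
  note HI = Hom_ModCat[OF A M N]
  let ?G = "Hom_group C (mod_obj M) (mod_obj N)" and ?H = "Hom_group C (mod_obj M \<boxtimes> mon_obj A) (mod_obj N)"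
  interpret G: comm_group ?G by (rule Hom_comm_group[OF m(1) n(1)])
  interpret H: comm_group ?H by (rule Hom_comm_group[OF MX n(1)])
  have H: "h \<in> carrier ?H" if "arr C (mod_obj M \<boxtimes> mon_obj A) (mod_obj N) h" for h
    using that by (simp add: arr_def Hom_group_def)
  have T: "arr C (mod_obj M \<boxtimes> mon_obj A) (mod_obj N \<boxtimes> mon_obj A) (?T h)"
    if "arr C (mod_obj M) (mod_obj N) h" for h by (rule arr that X)+
  have R: "arr C (mod_obj M \<boxtimes> mon_obj A) (mod_obj N) (mod_act N \<cdot> ?T h)"
    if "arr C (mod_obj M) (mod_obj N) h" for h by (rule arr that X n)+
  have add: "Add C f g \<cdot> mod_act M = Add C (f \<cdot> mod_act M) (g \<cdot> mod_act M)"
      "mod_act N \<cdot> ?T (Add C f g) = Add C (mod_act N \<cdot> ?T f) (mod_act N \<cdot> ?T g)"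
    if "arr C (mod_obj M) (mod_obj N) f" "arr C (mod_obj M) (mod_obj N) g" for f g
    by (simp_all only: Add_Cmp[OF m(2) that] Add_THom[OF that X] Cmp_Add[OF T[OF that(1)] T[OF that(2)] n(2)])
  have zero: "Zer C (mod_obj M) (mod_obj N) \<cdot> mod_act M = Zer C (mod_obj M \<boxtimes> mon_obj A) (mod_obj N)"
      "mod_act N \<cdot> ?T (Zer C (mod_obj M) (mod_obj N)) = Zer C (mod_obj M \<boxtimes> mon_obj A) (mod_obj N)"
    by (simp_all only: Zer_Cmp[OF m(2) n(1)] Zer_THom[OF m(1) n(1) X] Cmp_Zer[OF n(2) MX])
  show ?thesis
  proof (rule G.subgroupI)
    show "Hom (ModCat C A) M N \<subseteq> carrier ?G" using HI by (auto simp: Hom_group_def arr_def)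
    have "Zer C (mod_obj M) (mod_obj N) \<in> Hom (ModCat C A) M N"
      unfolding HI using arr_Zer[OF m(1) n(1)] zero by simp
    then show "Hom (ModCat C A) M N \<noteq> {}" by blast
  next
    fix f g assume "f \<in> Hom (ModCat C A) M N" "g \<in> Hom (ModCat C A) M N"
    then have f: "arr C (mod_obj M) (mod_obj N) f" "f \<cdot> mod_act M = mod_act N \<cdot> ?T f"
      and g: "arr C (mod_obj M) (mod_obj N) g" "g \<cdot> mod_act M = mod_act N \<cdot> ?T g" unfolding HI by auto
    have "Add C f g \<in> Hom (ModCat C A) M N"
      unfolding HI by (simp add: arr_Add[OF f(1) g(1)] add[OF f(1) g(1)] f(2) g(2))
    then show "f \<otimes>\<^bsub>?G\<^esub> g \<in> Hom (ModCat C A) M N" by (simp add: Hom_group_def)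
  next
    fix f assume "f \<in> Hom (ModCat C A) M N"
    then have f: "arr C (mod_obj M) (mod_obj N) f" "f \<cdot> mod_act M = mod_act N \<cdot> ?T f" unfolding HI by auto
    define g where "g = inv\<^bsub>?G\<^esub> f"
    have fG: "f \<in> carrier ?G" using f(1) by (simp add: arr_def Hom_group_def)
    then have "g \<in> carrier ?G" "g \<otimes>\<^bsub>?G\<^esub> f = \<one>\<^bsub>?G\<^esub>" unfolding g_def by simp_all
    then have g: "arr C (mod_obj M) (mod_obj N) g" and gf: "Add C g f = Zer C (mod_obj M) (mod_obj N)"
      using f(1) by (simp_all add: arr_def Hom_group_def)
    \<comment> \<open>No law relates the tensor product to inverses. Instead, both sides of the
      equation for \<open>g\<close> become zero when the common value for \<open>f\<close> is added,
      and that value cancels in the group \<open>?H\<close>.\<close>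
    have "(g \<cdot> mod_act M) \<otimes>\<^bsub>?H\<^esub> (f \<cdot> mod_act M) = (mod_act N \<cdot> ?T g) \<otimes>\<^bsub>?H\<^esub> (f \<cdot> mod_act M)"
      using add[OF g f(1)] zero gf f(2) by (simp add: Hom_group_def)
    then have "g \<cdot> mod_act M = mod_act N \<cdot> ?T g"
      using H[OF arr_Cmp[OF m(2) g]] H[OF arr_Cmp[OF m(2) f(1)]] H[OF R[OF g]] by simp
    then show "inv\<^bsub>?G\<^esub> f \<in> Hom (ModCat C A) M N" unfolding HI using g by (simp add: g_def)
  qed
qed

lemma preadditive_ModCat:
  assumes A: "A \<in> Obj (Comm C)"
  shows "preadditive_category (ModCat C A)"
proof -
  show ?thesis
  proof (rule preadditive_category.intro[OF category_ModCat[OF A] preadditive_category_axioms.intro])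
    fix M N assume M: "M \<in> Obj (ModCat C A)" and N: "N \<in> Obj (ModCat C A)"
    let ?G = "Hom_group C (mod_obj M) (mod_obj N)"
    interpret G: comm_group ?G by (rule Hom_comm_group[OF moduleD(1)[OF M A] moduleD(1)[OF N A]])
    interpret S: subgroup "Hom (ModCat C A) M N" ?G by (rule subgroup_mod_hom[OF A M N])
    have e: "Hom_group (ModCat C A) M N = ?G\<lparr>carrier := Hom (ModCat C A) M N\<rparr>"
      by (simp add: Hom_group_def ModCat_def)
    show "comm_group (Hom_group (ModCat C A) M N)"
      unfolding e
      by (rule group.group_comm_groupI[OF S.subgroup_is_group[OF G.is_group]]) (simp add: G.m_comm S.mem_carrier)
  next
    fix L M N f g h
    assume L: "L \<in> Obj (ModCat C A)" and M: "M \<in> Obj (ModCat C A)" and N: "N \<in> Obj (ModCat C A)"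
    { assume "f \<in> Hom (ModCat C A) L M" "g \<in> Hom (ModCat C A) M N" "h \<in> Hom (ModCat C A) M N"
      then show "Add (ModCat C A) g h \<cdot>\<^bsub>ModCat C A\<^esub> f =
          Add (ModCat C A) (g \<cdot>\<^bsub>ModCat C A\<^esub> f) (h \<cdot>\<^bsub>ModCat C A\<^esub> f)"
        using Add_Cmp[of "mod_obj L" "mod_obj M" f "mod_obj N" g h]
        unfolding Hom_ModCat[OF A L M] Hom_ModCat[OF A M N] by (simp add: ModCat_def) }
    { assume "f \<in> Hom (ModCat C A) L M" "g \<in> Hom (ModCat C A) L M" "h \<in> Hom (ModCat C A) M N"
      then show "h \<cdot>\<^bsub>ModCat C A\<^esub> Add (ModCat C A) f g =
          Add (ModCat C A) (h \<cdot>\<^bsub>ModCat C A\<^esub> f) (h \<cdot>\<^bsub>ModCat C A\<^esub> g)"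
        using Cmp_Add[of "mod_obj L" "mod_obj M" f g "mod_obj N" h]
        unfolding Hom_ModCat[OF A L M] Hom_ModCat[OF A M N] by (simp add: ModCat_def) }
  qed
qed

lemma regular_in_ModCat:
  assumes A: "A \<in> Obj (Comm C)"
  shows "regular A \<in> Obj (ModCat C A)"
  using comm_monoidD[OF A] unfolding ModCat_def regular_def is_module_def Let_def arr_def by simp

end


section \<open>The endomorphism ring\<close>

locale affine_scheme = relative_geometry C U for C :: "('o, 'm, 'x) tensor_cat_scheme" (structure)
    and U :: "'u itself" +
  fixes A :: "('o, 'm) mon"
  assumes A_in: "A \<in> Obj (Comm C)"
begin

abbreviation X :: 'o where "X \<equiv> mon_obj A"
abbreviation \<mu> :: 'm where "\<mu> \<equiv> mon_mul A"
abbreviation \<eta> :: 'm where "\<eta> \<equiv> mon_unt A"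
abbreviation E :: "'m ring" where "E \<equiv> EndRing C A"

lemmas A_obj = comm_monoidD(1)[OF A_in]
  and A_mul = comm_monoidD(2)[OF A_in]
  and A_unt = comm_monoidD(3)[OF A_in]
  and A_assoc = comm_monoidD(4)[OF A_in]
  and A_right_unit = comm_monoidD(6)[OF A_in]
  and A_comm = comm_monoidD(7)[OF A_in]
  and A_regular = regular_in_ModCat[OF A_in]

lemma A_id: "arr C X X (Idt C X)"
  by (rule arr_Idt[OF A_obj])

sublocale Modules: preadditive_category "ModCat C A"
  by (rule preadditive_ModCat[OF A_in])

lemma EndRing_carrier: "t \<in> carrier E \<longleftrightarrow> arr C X X t \<and> t \<cdot> \<mu> = \<mu> \<cdot> (t \<boxdot> Idt C X)"
  using Hom_ModCat[OF A_in A_regular A_regular, of t] by (simp add: EndRing_def regular_def)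

lemma EndRing_simps:
  "monoid.mult E = Cmp C" "\<one>\<^bsub>E\<^esub> = Idt C X" "\<zero>\<^bsub>E\<^esub> = Zer C X X" "ring.add E = Add C"
  by (simp_all add: EndRing_def)

lemma mul_endo_right:
  assumes "t \<in> carrier E"
  shows "\<mu> \<cdot> (Idt C X \<boxdot> t) = t \<cdot> \<mu>"
proof -
  have t: "arr C X X t" "t \<cdot> \<mu> = \<mu> \<cdot> (t \<boxdot> Idt C X)" using assms EndRing_carrier by auto
  have B: "arr C (X \<boxtimes> X) (X \<boxtimes> X) (Brd C X X)" and t1: "arr C (X \<boxtimes> X) (X \<boxtimes> X) (t \<boxdot> Idt C X)"
    and t2: "arr C (X \<boxtimes> X) (X \<boxtimes> X) (Idt C X \<boxdot> t)" by (rule arr A_obj t)+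
  have "\<mu> \<cdot> (Idt C X \<boxdot> t) = \<mu> \<cdot> (Brd C X X \<cdot> (Idt C X \<boxdot> t))"
    by (simp only: assoc[OF t2 B A_mul, symmetric] A_comm)
  also have "Brd C X X \<cdot> (Idt C X \<boxdot> t) = (t \<boxdot> Idt C X) \<cdot> Brd C X X"
    using Brd_natural[OF A_obj A_obj A_obj A_obj] t(1) A_id unfolding arr_def by blast
  also have "\<mu> \<cdot> \<dots> = (t \<cdot> \<mu>) \<cdot> Brd C X X"
    by (simp only: assoc[OF B t1 A_mul, symmetric] t(2))
  also have "\<dots> = t \<cdot> \<mu>" by (simp only: assoc[OF B A_mul t(1)] A_comm)
  finally show ?thesis .
qed

text \<open>The unit law exhibits an isomorphism, \<open>RUn C X\<close>, that factors through
  \<open>\<mu>\<close> as its last map.\<close>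

lemma mul_epi:
  assumes u: "arr C X Z u" and v: "arr C X Z v" and e: "u \<cdot> \<mu> = v \<cdot> \<mu>"
  shows "u = v"
proof (rule iso_cancel_right[OF RUn_iso[OF A_obj] _ u v])
  have i: "arr C (X \<boxtimes> Unt C) (X \<boxtimes> X) (Idt C X \<boxdot> \<eta>)" by (rule arr A_obj A_unt)+
  show "X \<boxtimes> Unt C \<in> Obj C" by (rule arr A_obj)+
  show "u \<cdot> RUn C X = v \<cdot> RUn C X"
    by (simp only: A_right_unit[symmetric] assoc[OF i A_mul u, symmetric] assoc[OF i A_mul v, symmetric] e)
qed

text \<open>This is the Eckmann-Hilton argument: let \<open>s\<close> act on the left factor and
  \<open>t\<close> on the right one. After \<open>\<mu>\<close> both composites equal
  \<open>\<mu> \<cdot> (s \<boxdot> t)\<close>, and \<open>\<mu>\<close> is epic.\<close>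

lemma endo_commute:
  assumes "s \<in> carrier E" "t \<in> carrier E"
  shows "s \<cdot> t = t \<cdot> s"
proof (rule mul_epi)
  have s: "arr C X X s" "s \<cdot> \<mu> = \<mu> \<cdot> (s \<boxdot> Idt C X)" and t: "arr C X X t"
    using assms EndRing_carrier by auto
  show "arr C X X (s \<cdot> t)" "arr C X X (t \<cdot> s)" by (rule arr s t)+
  have s1: "arr C (X \<boxtimes> X) (X \<boxtimes> X) (s \<boxdot> Idt C X)"
    and t1: "arr C (X \<boxtimes> X) (X \<boxtimes> X) (Idt C X \<boxdot> t)" by (rule arr A_obj s t)+
  have "(s \<cdot> t) \<cdot> \<mu> = \<mu> \<cdot> (s \<boxdot> t)"
    by (simp only: assoc[OF A_mul t s(1)] mul_endo_right[OF assms(2), symmetric]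
        assoc[OF t1 A_mul s(1), symmetric] s(2) assoc[OF t1 s1 A_mul] THom_right_left[OF s(1) t])
  also have "\<dots> = (t \<cdot> s) \<cdot> \<mu>"
    by (simp only: assoc[OF A_mul s(1) t] s(2) mul_endo_right[OF assms(2), symmetric]
        assoc[OF s1 A_mul t, symmetric] assoc[OF s1 t1 A_mul] THom_left_right[OF s(1) t])
  finally show "(s \<cdot> t) \<cdot> \<mu> = (t \<cdot> s) \<cdot> \<mu>" .
qed

lemma add_monoid_EndRing: "add_monoid E = Hom_group (ModCat C A) (regular A) (regular A)"
  by (simp add: EndRing_def Hom_group_def ModCat_def regular_def)

lemma EndRing_arr: "t \<in> carrier E \<longleftrightarrow> arr (ModCat C A) (regular A) (regular A) t"
  using A_regular by (simp add: arr_def EndRing_def)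

lemma ModCat_regular_simps:
  "Cmp (ModCat C A) = Cmp C" "Idt (ModCat C A) (regular A) = Idt C X" "Add (ModCat C A) = Add C"
  by (simp_all add: ModCat_def regular_def)

sublocale E: cring E
proof (rule cringI)
  have "comm_group (add_monoid E)"
    unfolding add_monoid_EndRing by (rule Modules.Hom_comm_group[OF A_regular A_regular])
  then show "abelian_group E"
    by (simp add: abelian_group_def abelian_group_axioms_def abelian_monoid_def comm_group_def)
  show "Group.comm_monoid E"
  proof (rule comm_monoidI)
    show "\<one>\<^bsub>E\<^esub> \<in> carrier E"
      using Modules.arr_Idt[OF A_regular] by (simp add: EndRing_arr EndRing_simps ModCat_regular_simps)
    fix r s t assume *: "r \<in> carrier E" "s \<in> carrier E" "t \<in> carrier E"
    note ** = *[unfolded EndRing_arr]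
    show "r \<otimes>\<^bsub>E\<^esub> s \<in> carrier E"
      using Modules.arr_Cmp[OF **(2,1)] by (simp add: EndRing_arr EndRing_simps ModCat_regular_simps)
    show "(r \<otimes>\<^bsub>E\<^esub> s) \<otimes>\<^bsub>E\<^esub> t = r \<otimes>\<^bsub>E\<^esub> (s \<otimes>\<^bsub>E\<^esub> t)"
      using Modules.assoc[OF **(3,2,1)] by (simp add: EndRing_simps ModCat_regular_simps)
    show "r \<otimes>\<^bsub>E\<^esub> s = s \<otimes>\<^bsub>E\<^esub> r" using endo_commute[OF *(1,2)] by (simp add: EndRing_simps)
    show "\<one>\<^bsub>E\<^esub> \<otimes>\<^bsub>E\<^esub> r = r"
      using Modules.id_left[OF **(1)] by (simp add: EndRing_simps ModCat_regular_simps)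
  qed
  fix r s t assume "r \<in> carrier E" "s \<in> carrier E" "t \<in> carrier E"
  then show "(r \<oplus>\<^bsub>E\<^esub> s) \<otimes>\<^bsub>E\<^esub> t = r \<otimes>\<^bsub>E\<^esub> t \<oplus>\<^bsub>E\<^esub> s \<otimes>\<^bsub>E\<^esub> t"
    using Modules.Add_Cmp[of _ _ t _ r s] by (simp add: EndRing_arr EndRing_simps ModCat_regular_simps)
qed

end

section \<open>Quotients of the regular module\<close>

lemma (in preadditive_category) zero_objectI:
  assumes X: "X \<in> Obj C" and e: "Idt C X = Zer C X X"
  shows "is_zero_object C X"
proof -
  have "f = Zer C X Y" if "arr C X Y f" for f Y
    using id_right[OF that] Cmp_Zer[OF that X] by (simp add: e)
  moreover have "f = Zer C Y X" if "arr C Y X f" for f Y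
    using id_left[OF that] Zer_Cmp[OF that X] by (simp add: e)
  ultimately have "f \<in> Hom C X Y \<longleftrightarrow> f = Zer C X Y" "f \<in> Hom C Y X \<longleftrightarrow> f = Zer C Y X"
    if "Y \<in> Obj C" for Y f
    using arr_Zer[OF X that] arr_Zer[OF that X] X that unfolding arr_def by metis+
  then show ?thesis using X by (simp add: is_zero_object_def)
qed

context affine_scheme
begin

lemma EndRing_subset: "F \<subseteq> carrier E \<Longrightarrow> F \<subseteq> Hom C X X"
  using EndRing_carrier unfolding arr_def by blast

text \<open>Both universal properties of the same \<open>q\<close> are kept. The one in
  \<open>C\<close> survives tensoring and serves to test identities; the one among modules is the
  colimit to which (C1) applies.\<close>

lemma quotient_module_exists:
  assumes F: "finite F" "F \<subseteq> carrier E" "Zer C X X \<in> F"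
  obtains M q where "is_par_colimit C X X F (mod_obj M) (Zer C X (mod_obj M)) q"
    and "is_par_colimit (ModCat C A) (regular A) (regular A) F M (Zer C X (mod_obj M)) q"
proof -
  note FH = EndRing_subset[OF F(2)]
  obtain Q p q where "is_par_colimit C X X F Q p q"
    using par_colimit_exists[OF A_obj A_obj F(1) FH] .
  \<comment> \<open>Since \<open>0 \<in> F\<close>, the leg \<open>p\<close> equals
    \<open>q 0 = 0\<close>, and the joint coequalizer is a joint cokernel.\<close>
  moreover from this have q: "arr C X Q q" and "q \<cdot> Zer C X X = p"
    using F(3) unfolding is_par_colimit_def by auto
  moreover have "q \<cdot> Zer C X X = Zer C X Q" by (rule Cmp_Zer[OF q A_obj])
  ultimately have pc: "is_par_colimit C X X F Q (Zer C X Q) q" by simp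
  have Q: "Q \<in> Obj C" using q unfolding arr_def by blast
  note pcX = tensor_quotient[OF pc F(1) FH A_obj]
  note FX = tensor_subset_Hom[OF A_obj A_obj A_obj FH]
  have XX: "X \<boxtimes> X \<in> Obj C" and QX: "Q \<boxtimes> X \<in> Obj C" by (rule arr A_obj Q)+
  have qF: "q \<cdot> f = Zer C X Q" if "f \<in> F" for f using pc that unfolding is_par_colimit_def by blast
  let ?T = "\<lambda>h. h \<boxdot> Idt C X"
  note ty = A_obj Q q A_mul A_unt
  have Tq: "arr C (X \<boxtimes> X) (Q \<boxtimes> X) (?T q)" and q\<mu>: "arr C (X \<boxtimes> X) Q (q \<cdot> \<mu>)" by (rule arr ty)+
  \<comment> \<open>Linearity of \<open>f\<close> moves it past \<open>\<mu>\<close> to where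
    \<open>q\<close> kills it. Hence \<open>q \<cdot> \<mu>\<close> descends along
    \<open>q \<boxdot> Idt C X\<close>, and the induced map \<open>\<rho>\<close> is the
    action.\<close>
  have "(q \<cdot> \<mu>) \<cdot> g = Zer C (X \<boxtimes> X) Q" if g: "g \<in> ?T ` F" for g
  proof -
    obtain f where f: "f \<in> F" "g = ?T f" using g by blast
    then have f': "arr C X X f" "f \<cdot> \<mu> = \<mu> \<cdot> ?T f" using F(2) EndRing_carrier by auto
    have "arr C (X \<boxtimes> X) (X \<boxtimes> X) (?T f)" by (rule arr ty f')+
    then have "(q \<cdot> \<mu>) \<cdot> g = (q \<cdot> f) \<cdot> \<mu>"
      by (simp only: f(2) assoc[OF _ A_mul q] f'(2)[symmetric] assoc[OF A_mul f'(1) q])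
    also have "\<dots> = Zer C (X \<boxtimes> X) Q" by (simp only: qF[OF f(1)] Zer_Cmp[OF A_mul Q])
    finally show ?thesis .
  qed
  then obtain \<rho> where \<rho>: "arr C (Q \<boxtimes> X) Q \<rho>" and \<rho>q: "\<rho> \<cdot> ?T q = q \<cdot> \<mu>"
    using par_colimit_factor[OF pcX arr_Zer[OF XX Q] q\<mu>] by blast
  note ty = ty \<rho>
  define M where "M = \<lparr>mod_obj = Q, mod_act = \<rho>\<rparr>"
  \<comment> \<open>Maps out of \<open>(Q \<boxtimes> X) \<boxtimes> X\<close> are determined after
    \<open>q\<close> tensored twice with \<open>X\<close>; there the equation is the associativity
    of \<open>\<mu>\<close> followed by \<open>q\<close>.\<close>
  have assoc_eq: "\<rho> \<cdot> ?T \<rho> = \<rho> \<cdot> (Idt C Q \<boxdot> \<mu>) \<cdot> Asc C Q X X"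
  proof (rule quotient_epi[OF tensor_quotient[OF pcX finite_imageI[OF F(1)] FX A_obj]
        tensor_subset_Hom[OF XX XX A_obj FX]])
    show "arr C ((Q \<boxtimes> X) \<boxtimes> X) Q (\<rho> \<cdot> ?T \<rho>)"
      "arr C ((Q \<boxtimes> X) \<boxtimes> X) Q (\<rho> \<cdot> (Idt C Q \<boxdot> \<mu>) \<cdot> Asc C Q X X)" by (rule arr ty)+
    have a: "arr C ((X \<boxtimes> X) \<boxtimes> X) (X \<boxtimes> (X \<boxtimes> X)) (Asc C X X X)"
      "arr C ((Q \<boxtimes> X) \<boxtimes> X) (Q \<boxtimes> (X \<boxtimes> X)) (Asc C Q X X)"
      "arr C ((X \<boxtimes> X) \<boxtimes> X) ((Q \<boxtimes> X) \<boxtimes> X) (?T (?T q))"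
      "arr C (X \<boxtimes> (X \<boxtimes> X)) (Q \<boxtimes> (X \<boxtimes> X)) (q \<boxdot> Idt C (X \<boxtimes> X))"
      "arr C (X \<boxtimes> (X \<boxtimes> X)) (X \<boxtimes> X) (Idt C X \<boxdot> \<mu>)"
      "arr C (Q \<boxtimes> (X \<boxtimes> X)) (Q \<boxtimes> X) (Idt C Q \<boxdot> \<mu>)"
      "arr C ((Q \<boxtimes> X) \<boxtimes> X) (Q \<boxtimes> X) (?T \<rho>)"
      "arr C ((X \<boxtimes> X) \<boxtimes> X) (X \<boxtimes> X) (?T \<mu>)"
      "arr C (Q \<boxtimes> (X \<boxtimes> X)) Q (\<rho> \<cdot> (Idt C Q \<boxdot> \<mu>))"
      "arr C (X \<boxtimes> (X \<boxtimes> X)) X (\<mu> \<cdot> (Idt C X \<boxdot> \<mu>))" by (rule arr ty)+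
    have nat: "Asc C Q X X \<cdot> ?T (?T q) = (q \<boxdot> Idt C (X \<boxtimes> X)) \<cdot> Asc C X X X"
      using Asc_natural[OF A_obj Q A_obj A_obj A_obj A_obj] q A_id
      by (simp add: arr_def THom_Idt)
    have "(\<rho> \<cdot> ?T \<rho>) \<cdot> ?T (?T q) = \<rho> \<cdot> ?T (q \<cdot> \<mu>)"
      by (simp only: assoc[OF a(3) a(7) \<rho>] THom_Cmp_left[OF Tq \<rho> A_obj] \<rho>q)
    also have "\<dots> = (q \<cdot> \<mu>) \<cdot> ?T \<mu>"
      by (simp only: THom_Cmp_left[OF A_mul q A_obj, symmetric] assoc[OF a(8) Tq \<rho>, symmetric] \<rho>q)
    also have "\<dots> = q \<cdot> (\<mu> \<cdot> (Idt C X \<boxdot> \<mu>) \<cdot> Asc C X X X)"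
      by (simp only: assoc[OF a(8) A_mul q] A_assoc)
    also have "\<dots> = ((q \<cdot> \<mu>) \<cdot> (Idt C X \<boxdot> \<mu>)) \<cdot> Asc C X X X"
      by (simp only: assoc[OF a(1) a(10) q, symmetric] assoc[OF a(5) A_mul q])
    also have "\<dots> = (\<rho> \<cdot> (q \<boxdot> \<mu>)) \<cdot> Asc C X X X"
      by (simp only: \<rho>q[symmetric] assoc[OF a(5) Tq \<rho>] THom_right_left[OF q A_mul])
    also have "\<dots> = ((\<rho> \<cdot> (Idt C Q \<boxdot> \<mu>)) \<cdot> (q \<boxdot> Idt C (X \<boxtimes> X))) \<cdot> Asc C X X X"
      by (simp only: assoc[OF a(4) a(6) \<rho>] THom_left_right[OF q A_mul])
    also have "\<dots> = (\<rho> \<cdot> (Idt C Q \<boxdot> \<mu>) \<cdot> Asc C Q X X) \<cdot> ?T (?T q)"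
      by (simp only: assoc[OF a(1) a(4) a(9)] nat[symmetric] assoc[OF a(3) a(2) a(9)])
    finally show "(\<rho> \<cdot> ?T \<rho>) \<cdot> ?T (?T q) = (\<rho> \<cdot> (Idt C Q \<boxdot> \<mu>) \<cdot> Asc C Q X X) \<cdot> ?T (?T q)" .
  qed
  have unit_eq: "\<rho> \<cdot> (Idt C Q \<boxdot> \<eta>) = RUn C Q"
  proof (rule quotient_epi[OF tensor_quotient[OF pc F(1) FH Unt_in]
        tensor_subset_Hom[OF A_obj A_obj Unt_in FH]])
    show "arr C (Q \<boxtimes> Unt C) Q (\<rho> \<cdot> (Idt C Q \<boxdot> \<eta>))" "arr C (Q \<boxtimes> Unt C) Q (RUn C Q)"
      by (rule arr ty)+
    have a: "arr C (X \<boxtimes> Unt C) (Q \<boxtimes> Unt C) (q \<boxdot> Idt C (Unt C))"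
      "arr C (Q \<boxtimes> Unt C) (Q \<boxtimes> X) (Idt C Q \<boxdot> \<eta>)"
      "arr C (X \<boxtimes> Unt C) (X \<boxtimes> X) (Idt C X \<boxdot> \<eta>)" by (rule arr ty)+
    have "(\<rho> \<cdot> (Idt C Q \<boxdot> \<eta>)) \<cdot> (q \<boxdot> Idt C (Unt C)) = (\<rho> \<cdot> ?T q) \<cdot> (Idt C X \<boxdot> \<eta>)"
      by (simp only: assoc[OF a(1) a(2) \<rho>] assoc[OF a(3) Tq \<rho>] THom_left_right[OF q A_unt]
          THom_right_left[OF q A_unt])
    also have "\<dots> = q \<cdot> RUn C X" by (simp only: \<rho>q assoc[OF a(3) A_mul q] A_right_unit)
    also have "\<dots> = RUn C Q \<cdot> (q \<boxdot> Idt C (Unt C))"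
      using RUn_natural[OF A_obj Q] q unfolding arr_def by simp
    finally show "(\<rho> \<cdot> (Idt C Q \<boxdot> \<eta>)) \<cdot> (q \<boxdot> Idt C (Unt C)) = RUn C Q \<cdot> (q \<boxdot> Idt C (Unt C))" .
  qed
  have M: "M \<in> Obj (ModCat C A)"
    using \<rho> Q assoc_eq unit_eq by (simp add: M_def ModCat_def is_module_def arr_def)
  have qM: "arr (ModCat C A) (regular A) M q"
    unfolding arr_ModCat[OF A_in] using M A_regular q \<rho>q by (simp add: M_def regular_def)
  have zM: "arr (ModCat C A) (regular A) M (Zer C X Q)"
    using Modules.arr_Zer[OF A_regular M] by (simp add: ModCat_def M_def regular_def)
  have "is_par_colimit (ModCat C A) (regular A) (regular A) F M (Zer C X Q) q"
    unfolding is_par_colimit_def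
  proof (intro conjI allI impI ballI)
    fix N u v
    assume u: "arr (ModCat C A) (regular A) N u" and v: "arr (ModCat C A) (regular A) N v"
      and uv: "\<forall>f \<in> F. v \<cdot>\<^bsub>ModCat C A\<^esub> f = u"
    note u' = u[unfolded arr_ModCat[OF A_in]] and v' = v[unfolded arr_ModCat[OF A_in]]
    have N: "N \<in> Obj (ModCat C A)" using u' by blast
    note n = moduleD[OF N A_in]
    have uc: "arr C X (mod_obj N) u" and vc: "arr C X (mod_obj N) v"
      and va: "v \<cdot> \<mu> = mod_act N \<cdot> ?T v" using u' v' by (simp_all add: regular_def)
    obtain h where h: "arr C Q (mod_obj N) h" "h \<cdot> Zer C X Q = u" "h \<cdot> q = v"
      by (rule par_colimit_factor[OF pc uc vc]) (use uv in \<open>simp add: ModCat_def\<close>)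
    have Th: "arr C (Q \<boxtimes> X) (mod_obj N \<boxtimes> X) (?T h)" by (rule arr h A_obj)+
    \<comment> \<open>Composed with the epimorphism \<open>q \<boxdot> Idt C X\<close>, linearity of
      \<open>h\<close> becomes that of \<open>v\<close>.\<close>
    have "h \<cdot> \<rho> = mod_act N \<cdot> ?T h"
    proof (rule quotient_epi[OF pcX FX])
      show "arr C (Q \<boxtimes> X) (mod_obj N) (h \<cdot> \<rho>)" "arr C (Q \<boxtimes> X) (mod_obj N) (mod_act N \<cdot> ?T h)"
        by (rule arr ty h n)+
      show "(h \<cdot> \<rho>) \<cdot> ?T q = (mod_act N \<cdot> ?T h) \<cdot> ?T q"
        by (simp only: assoc[OF Tq \<rho> h(1)] \<rho>q assoc[OF A_mul q h(1), symmetric] h(3) va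
            assoc[OF Tq Th n(2)] THom_Cmp_left[OF q h(1) A_obj])
    qed
    then have hM: "arr (ModCat C A) M N h"
      unfolding arr_ModCat[OF A_in] using M N h(1) by (simp add: M_def)
    show "\<exists>!h. arr (ModCat C A) M N h \<and> h \<cdot>\<^bsub>ModCat C A\<^esub> Zer C X Q = u \<and> h \<cdot>\<^bsub>ModCat C A\<^esub> q = v"
    proof (rule ex1I[of _ h])
      show "arr (ModCat C A) M N h \<and> h \<cdot>\<^bsub>ModCat C A\<^esub> Zer C X Q = u \<and> h \<cdot>\<^bsub>ModCat C A\<^esub> q = v"
        using hM h by (simp add: ModCat_def)
      fix k assume k: "arr (ModCat C A) M N k \<and> k \<cdot>\<^bsub>ModCat C A\<^esub> Zer C X Q = u \<and> k \<cdot>\<^bsub>ModCat C A\<^esub> q = v"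
      then have "arr C Q (mod_obj N) k" "k \<cdot> q = h \<cdot> q"
        using h(3) unfolding arr_ModCat[OF A_in] by (simp_all add: M_def ModCat_def)
      then show "k = h" using quotient_epi[OF pc FH _ h(1)] by blast
    qed
  next
    fix f assume "f \<in> F"
    then show "q \<cdot>\<^bsub>ModCat C A\<^esub> f = Zer C X Q" using qF by (simp add: ModCat_def)
  qed (rule qM zM)+
  then show thesis using that[of M q] pc by (simp add: M_def)
qed


section \<open>Base change to a localisation\<close>

text \<open>The element of \<open>A\<close> that corresponds to \<open>t\<close> is
  \<open>t \<cdot> \<eta>\<close>. It sends \<open>q(a)\<close> to \<open>q(t(a)) = 0\<close>, and
  these exhaust the module because \<open>q \<boxdot> Idt C (Unt C)\<close> is epic.\<close>

lemma killed_element_acts_as_zero: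
  assumes M: "M \<in> Obj (ModCat C A)" and q: "arr (ModCat C A) (regular A) M q"
    and pc: "is_par_colimit C X X F (mod_obj M) (Zer C X (mod_obj M)) q" and F: "finite F" "F \<subseteq> carrier E"
    and t: "t \<in> F"
  shows "mod_act M \<cdot> (Idt C (mod_obj M) \<boxdot> (t \<cdot> \<eta>)) = Zer C (mod_obj M \<boxtimes> Unt C) (mod_obj M)"
proof -
  let ?Q = "mod_obj M" and ?\<rho> = "mod_act M"
  note FH = EndRing_subset[OF F(2)] and m = moduleD[OF M A_in]
  have tE: "t \<in> carrier E" using t F(2) by blast
  have tc: "arr C X X t" using tE EndRing_carrier by blast
  have qc: "arr C X ?Q q" and q\<mu>: "q \<cdot> \<mu> = ?\<rho> \<cdot> (q \<boxdot> Idt C X)"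
    using q unfolding arr_ModCat[OF A_in] by (simp_all add: regular_def)
  have qt: "q \<cdot> t = Zer C X ?Q" using pc t unfolding is_par_colimit_def by blast
  note ty = A_obj A_unt A_mul m tc qc
  have a: "arr C (X \<boxtimes> Unt C) (?Q \<boxtimes> Unt C) (q \<boxdot> Idt C (Unt C))"
    "arr C (?Q \<boxtimes> Unt C) (?Q \<boxtimes> X) (Idt C ?Q \<boxdot> (t \<cdot> \<eta>))"
    "arr C (X \<boxtimes> Unt C) (X \<boxtimes> X) (Idt C X \<boxdot> (t \<cdot> \<eta>))"
    "arr C (X \<boxtimes> X) (?Q \<boxtimes> X) (q \<boxdot> Idt C X)"
    "arr C (X \<boxtimes> Unt C) (X \<boxtimes> X) (Idt C X \<boxdot> \<eta>)"
    "arr C (X \<boxtimes> X) (X \<boxtimes> X) (Idt C X \<boxdot> t)"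
    "arr C (X \<boxtimes> X) ?Q (q \<cdot> \<mu>)"
    "arr C (Unt C) X (t \<cdot> \<eta>)"
    "arr C (?Q \<boxtimes> Unt C) ?Q (?\<rho> \<cdot> (Idt C ?Q \<boxdot> (t \<cdot> \<eta>)))"
    by (rule arr ty)+
  have QU: "?Q \<boxtimes> Unt C \<in> Obj C" by (rule arr m)+
  note Z = arr_Zer[OF QU m(1)]
  have "(?\<rho> \<cdot> (Idt C ?Q \<boxdot> (t \<cdot> \<eta>))) \<cdot> (q \<boxdot> Idt C (Unt C)) = (q \<cdot> \<mu>) \<cdot> (Idt C X \<boxdot> (t \<cdot> \<eta>))"
    by (simp only: assoc[OF a(1) a(2) m(2)] THom_left_right[OF qc a(8)] q\<mu> assoc[OF a(3) a(4) m(2)]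
        THom_right_left[OF qc a(8)])
  also have "\<dots> = (q \<cdot> (\<mu> \<cdot> (Idt C X \<boxdot> t))) \<cdot> (Idt C X \<boxdot> \<eta>)"
    by (simp only: THom_Cmp_right[OF A_unt tc A_obj, symmetric] assoc[OF a(5) a(6) a(7), symmetric]
        assoc[OF a(6) A_mul qc])
  also have "q \<cdot> (\<mu> \<cdot> (Idt C X \<boxdot> t)) = (q \<cdot> t) \<cdot> \<mu>"
    by (simp only: mul_endo_right[OF tE] assoc[OF A_mul tc qc])
  also have "\<dots> = Zer C (X \<boxtimes> X) ?Q" by (simp only: qt Zer_Cmp[OF A_mul m(1)])
  also have "\<dots> \<cdot> (Idt C X \<boxdot> \<eta>) = Zer C (X \<boxtimes> Unt C) ?Q" by (simp only: Zer_Cmp[OF a(5) m(1)])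
  also have "\<dots> = Zer C (?Q \<boxtimes> Unt C) ?Q \<cdot> (q \<boxdot> Idt C (Unt C))" by (simp only: Zer_Cmp[OF a(1) m(1)])
  finally show ?thesis
    by (rule quotient_epi[OF tensor_quotient[OF pc F(1) FH Unt_in]
        tensor_subset_Hom[OF A_obj A_obj Unt_in FH] a(9) Z])
qed

lemma localisation_arr:
  assumes "is_localisation C A t B f"
  shows "B \<in> Obj (Comm C)" "arr C X (mon_obj B) f" "f \<cdot> \<eta> = mon_unt B"
  using assms comm_monoidD(1)[of B] A_obj unfolding is_localisation_def arr_def
  by (simp_all add: Comm_def mon_hom_def)

text \<open>The inverse of \<open>t\<close> in \<open>A\<^sub>t\<close> is \<open>1 / t\<close>, the image of the unit of \<open>A\<close> under \<open>\<iota> 1\<close>.\<close>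

lemma localisation_inverse:
  assumes loc: "is_localisation C A t B f" and t: "t \<in> carrier E"
  obtains e where "arr C (Unt C) (mon_obj B) e"
    and "mon_mul B \<cdot> ((f \<cdot> (t \<cdot> \<eta>)) \<boxdot> e) = mon_unt B \<cdot> RUn C (Unt C)"
proof -
  note B = localisation_arr[OF loc]
  note b = comm_monoidD[OF B(1)]
  obtain \<iota> where col: "is_colimit omega (ModCat C A) (power_diagram C A t)
      (restrict_scalars C f (regular B)) \<iota>" and \<iota>0: "\<iota> 0 = f"
    and mult: "\<And>m n. mon_mul B \<cdot> (\<iota> m \<boxdot> \<iota> n) = \<iota> (m + n) \<cdot> \<mu>"
    using loc unfolding is_localisation_def by blast
  have cc: "is_cocone omega (ModCat C A) (power_diagram C A t) (restrict_scalars C f (regular B)) \<iota>"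
    using col unfolding is_colimit_def by blast
  have tc: "arr C X X t" using t EndRing_carrier by blast
  have "arr (ModCat C A) (regular A) (restrict_scalars C f (regular B)) (\<iota> 1)"
    using cc A_regular unfolding is_cocone_def arr_def by (simp add: omega_def power_diagram_def)
  then have i: "arr C X (mon_obj B) (\<iota> 1)"
    unfolding arr_ModCat[OF A_in] by (simp add: regular_def restrict_scalars_def)
  have "\<iota> 1 \<cdot>\<^bsub>ModCat C A\<^esub> FHom (power_diagram C A t) 0 1 () = \<iota> 0"
    using cc unfolding is_cocone_def by (simp add: omega_def)
  then have it: "\<iota> 1 \<cdot> t = f"
    using t \<iota>0 by (simp add: power_diagram_def ModCat_def)
  have a: "arr C (Unt C \<boxtimes> Unt C) (X \<boxtimes> X) ((t \<cdot> \<eta>) \<boxdot> \<eta>)"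
    "arr C (X \<boxtimes> X) (mon_obj B \<boxtimes> mon_obj B) (f \<boxdot> \<iota> 1)"
    "arr C (Unt C) X (t \<cdot> \<eta>)"
    "arr C (Unt C \<boxtimes> Unt C) (X \<boxtimes> Unt C) ((t \<cdot> \<eta>) \<boxdot> Idt C (Unt C))"
    "arr C (X \<boxtimes> Unt C) (X \<boxtimes> X) (Idt C X \<boxdot> \<eta>)"
    "arr C (Unt C \<boxtimes> Unt C) (Unt C) (RUn C (Unt C))"
    "arr C (Unt C) (mon_obj B) (\<iota> 1 \<cdot> \<eta>)"
    by (rule arr A_obj A_unt tc i B)+
  \<comment> \<open>The case \<open>m = 0\<close>, \<open>n = 1\<close> of the multiplication rule:
    \<open>a / 1\<close> times \<open>b / t\<close> is \<open>a b / t\<close>. With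
    \<open>a = t\<close> and \<open>b = 1\<close> the result is \<open>t / t\<close>, which
    \<open>it\<close> identifies with the unit.\<close>
  have mult01: "mon_mul B \<cdot> (f \<boxdot> \<iota> 1) = \<iota> 1 \<cdot> \<mu>" using mult[of 0 1] \<iota>0 by simp
  have "mon_mul B \<cdot> ((f \<cdot> (t \<cdot> \<eta>)) \<boxdot> (\<iota> 1 \<cdot> \<eta>)) = (\<iota> 1 \<cdot> \<mu>) \<cdot> ((t \<cdot> \<eta>) \<boxdot> \<eta>)"
    by (simp only: interchange[OF a(3) B(2) A_unt i, symmetric] assoc[OF a(1) a(2) b(2), symmetric] mult01)
  also have "\<dots> = \<iota> 1 \<cdot> (RUn C X \<cdot> ((t \<cdot> \<eta>) \<boxdot> Idt C (Unt C)))"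
    unfolding assoc[OF a(1) A_mul i] unfolding THom_left_right[OF a(3) A_unt, symmetric]
    by (simp only: assoc[OF a(4) a(5) A_mul, symmetric] A_right_unit)
  also have "RUn C X \<cdot> ((t \<cdot> \<eta>) \<boxdot> Idt C (Unt C)) = (t \<cdot> \<eta>) \<cdot> RUn C (Unt C)"
    using RUn_natural[OF Unt_in A_obj] a(3) unfolding arr_def by blast
  also have "\<iota> 1 \<cdot> \<dots> = ((\<iota> 1 \<cdot> t) \<cdot> \<eta>) \<cdot> RUn C (Unt C)"
    by (simp only: assoc[OF a(6) a(3) i] assoc[OF A_unt tc i])
  also have "\<dots> = mon_unt B \<cdot> RUn C (Unt C)" by (simp only: it B(3))
  finally show thesis using that[OF a(7)] by blast
qed

text \<open>In elements, \<open>coeq\<close> reads \<open>g(q a, b) = g(q, f(a) b)\<close>. For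
  \<open>a = t \<cdot> \<eta>\<close> the left side vanishes, so \<open>g\<close> vanishes on
  multiples of the image of \<open>t\<close>, which is invertible. The target \<open>W\<close> is
  arbitrary so that this applies to any competing map as well as to the coequalizer map
  itself.\<close>

lemma coequalizing_arr_eq_Zer:
  assumes M: "M \<in> Obj (ModCat C A)"
    and zero: "mod_act M \<cdot> (Idt C (mod_obj M) \<boxdot> (t \<cdot> \<eta>)) = Zer C (mod_obj M \<boxtimes> Unt C) (mod_obj M)"
    and loc: "is_localisation C A t B f" and t: "t \<in> carrier E"
    and g: "arr C (mod_obj M \<boxtimes> mon_obj B) W g"
    and coeq: "g \<cdot> (mod_act M \<boxdot> Idt C (mon_obj B)) =
      g \<cdot> ((Idt C (mod_obj M) \<boxdot> (mon_mul B \<cdot> (f \<boxdot> Idt C (mon_obj B)))) \<cdot> Asc C (mod_obj M) X (mon_obj B))"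
  shows "g = Zer C (mod_obj M \<boxtimes> mon_obj B) W"
proof -
  let ?Q = "mod_obj M" and ?\<rho> = "mod_act M" and ?Y = "mon_obj B" and ?m = "mon_mul B" and ?U = "Unt C"
  define x where "x = t \<cdot> \<eta>"
  obtain e' where e': "arr C ?U ?Y e'" and inv: "?m \<cdot> ((f \<cdot> x) \<boxdot> e') = mon_unt B \<cdot> RUn C ?U"
    using localisation_inverse[OF loc t] unfolding x_def .
  note B = localisation_arr[OF loc] and m = moduleD[OF M A_in]
  note b = comm_monoidD[OF B(1)]
  have tc: "arr C X X t" using t EndRing_carrier by blast
  have x: "arr C ?U X x" unfolding x_def by (rule arr tc A_unt)+
  have Wo: "W \<in> Obj C" using g unfolding arr_def by blast
  define e where "e = f \<cdot> x"
  have e: "arr C ?U ?Y e" unfolding e_def by (rule arr x B)+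
  \<comment> \<open>\<open>L\<close> and \<open>L'\<close> multiply by the image \<open>e\<close> of
    \<open>t\<close> and by its inverse \<open>e'\<close>, each taking the unit object as its first
    factor.\<close>
  define L where "L = ?m \<cdot> (e \<boxdot> Idt C ?Y)"
  define L' where "L' = ?m \<cdot> (e' \<boxdot> Idt C ?Y)"
  have L: "arr C (?U \<boxtimes> ?Y) ?Y L" unfolding L_def by (rule arr e b)+
  have L': "arr C (?U \<boxtimes> ?Y) ?Y L'" unfolding L'_def by (rule arr e' b)+
  note ty = A_obj m b(1-3) B(2) x e e' L L' g Wo
  let ?M = "Idt C ?Q \<boxdot> (?m \<cdot> (f \<boxdot> Idt C ?Y))"
  have a: "arr C ((?Q \<boxtimes> ?U) \<boxtimes> ?Y) ((?Q \<boxtimes> X) \<boxtimes> ?Y) ((Idt C ?Q \<boxdot> x) \<boxdot> Idt C ?Y)"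
    "arr C ((?Q \<boxtimes> X) \<boxtimes> ?Y) (?Q \<boxtimes> ?Y) (?\<rho> \<boxdot> Idt C ?Y)"
    "arr C ((?Q \<boxtimes> X) \<boxtimes> ?Y) (?Q \<boxtimes> (X \<boxtimes> ?Y)) (Asc C ?Q X ?Y)"
    "arr C ((?Q \<boxtimes> ?U) \<boxtimes> ?Y) (?Q \<boxtimes> (?U \<boxtimes> ?Y)) (Asc C ?Q ?U ?Y)"
    "arr C (?Q \<boxtimes> (X \<boxtimes> ?Y)) (?Q \<boxtimes> ?Y) ?M"
    "arr C (?Q \<boxtimes> (?U \<boxtimes> ?Y)) (?Q \<boxtimes> (X \<boxtimes> ?Y)) (Idt C ?Q \<boxdot> (x \<boxdot> Idt C ?Y))"
    "arr C (?Q \<boxtimes> (?U \<boxtimes> ?Y)) (?Q \<boxtimes> ?Y) (Idt C ?Q \<boxdot> L)"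
    "arr C (?U \<boxtimes> ?Y) (X \<boxtimes> ?Y) (x \<boxdot> Idt C ?Y)"
    "arr C (X \<boxtimes> ?Y) (?Y \<boxtimes> ?Y) (f \<boxdot> Idt C ?Y)"
    "arr C (X \<boxtimes> ?Y) ?Y (?m \<cdot> (f \<boxdot> Idt C ?Y))"
    "arr C (?Q \<boxtimes> ?U) (?Q \<boxtimes> X) (Idt C ?Q \<boxdot> x)"
    "arr C (?Q \<boxtimes> (?U \<boxtimes> ?Y)) W (g \<cdot> (Idt C ?Q \<boxdot> L))"
    "arr C ((?Q \<boxtimes> X) \<boxtimes> ?Y) (?Q \<boxtimes> ?Y) (?M \<cdot> Asc C ?Q X ?Y)"
    by (rule arr ty)+
  have QY: "?Q \<boxtimes> ?Y \<in> Obj C" "?Q \<boxtimes> (?U \<boxtimes> ?Y) \<in> Obj C" "(?Q \<boxtimes> ?U) \<boxtimes> ?Y \<in> Obj C" "?Q \<boxtimes> ?U \<in> Obj C"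
    by (rule arr ty)+
  have nat: "Asc C ?Q X ?Y \<cdot> ((Idt C ?Q \<boxdot> x) \<boxdot> Idt C ?Y) = (Idt C ?Q \<boxdot> (x \<boxdot> Idt C ?Y)) \<cdot> Asc C ?Q ?U ?Y"
    using Asc_natural[OF m(1) m(1) Unt_in A_obj b(1) b(1)] x arr_Idt[OF m(1)] arr_Idt[OF b(1)]
    unfolding arr_def by blast
  have Le: "(?m \<cdot> (f \<boxdot> Idt C ?Y)) \<cdot> (x \<boxdot> Idt C ?Y) = L"
    by (simp only: L_def e_def assoc[OF a(8) a(9) b(2)] THom_Cmp_left[OF x B(2) b(1)])
  have "g \<cdot> (Idt C ?Q \<boxdot> L) = Zer C (?Q \<boxtimes> (?U \<boxtimes> ?Y)) W"
  \<comment> \<open>Up to the associator, \<open>coeq\<close> trades the multiplication by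
    \<open>e\<close> on the second factor for the action of \<open>x\<close> on the first, which is
    zero.\<close>
  proof (rule iso_cancel_right[OF Asc_iso[OF m(1) Unt_in b(1)] QY(3) a(12) arr_Zer[OF QY(2) Wo]])
    have "(g \<cdot> (Idt C ?Q \<boxdot> L)) \<cdot> Asc C ?Q ?U ?Y
        = g \<cdot> ((?M \<cdot> (Idt C ?Q \<boxdot> (x \<boxdot> Idt C ?Y))) \<cdot> Asc C ?Q ?U ?Y)"
      by (simp only: assoc[OF a(4) a(7) g] THom_Cmp_right[OF a(8) a(10) m(1)] Le)
    also have "\<dots> = (g \<cdot> (?M \<cdot> Asc C ?Q X ?Y)) \<cdot> ((Idt C ?Q \<boxdot> x) \<boxdot> Idt C ?Y)"
      by (simp only: assoc[OF a(4) a(6) a(5)] nat[symmetric] assoc[OF a(1) a(3) a(5)] assoc[OF a(1) a(13) g])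
    also have "\<dots> = g \<cdot> ((?\<rho> \<cdot> (Idt C ?Q \<boxdot> x)) \<boxdot> Idt C ?Y)"
      by (simp only: coeq[symmetric] assoc[OF a(1) a(2) g] THom_Cmp_left[OF a(11) m(2) b(1)])
    also have "\<dots> = Zer C ((?Q \<boxtimes> ?U) \<boxtimes> ?Y) W"
      by (simp only: x_def zero Zer_THom[OF QY(4) m(1) b(1)] Cmp_Zer[OF g QY(3)])
    also have "\<dots> = Zer C (?Q \<boxtimes> (?U \<boxtimes> ?Y)) W \<cdot> Asc C ?Q ?U ?Y"
      by (simp only: Zer_Cmp[OF a(4) Wo])
    finally show "(g \<cdot> (Idt C ?Q \<boxdot> L)) \<cdot> Asc C ?Q ?U ?Y = Zer C (?Q \<boxtimes> (?U \<boxtimes> ?Y)) W \<cdot> Asc C ?Q ?U ?Y" .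
  qed
  note gL = this
  \<comment> \<open>\<open>K\<close> multiplies by \<open>e'\<close> and leaves the first unit
    factor for \<open>L\<close> to consume.\<close>
  define K where "K = (Idt C ?U \<boxdot> L') \<cdot> Asc C ?U ?U ?Y"
  have c: "arr C ((?U \<boxtimes> ?U) \<boxtimes> ?Y) (?U \<boxtimes> (?U \<boxtimes> ?Y)) (Asc C ?U ?U ?Y)"
    "arr C (?U \<boxtimes> (?U \<boxtimes> ?Y)) (?U \<boxtimes> ?Y) (Idt C ?U \<boxdot> L')"
    "arr C (?U \<boxtimes> ?Y) (?Y \<boxtimes> ?Y) (e \<boxdot> Idt C ?Y)"
    "arr C (?U \<boxtimes> (?U \<boxtimes> ?Y)) (?Y \<boxtimes> (?Y \<boxtimes> ?Y)) (e \<boxdot> (e' \<boxdot> Idt C ?Y))"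
    "arr C (?Y \<boxtimes> (?Y \<boxtimes> ?Y)) (?Y \<boxtimes> ?Y) (Idt C ?Y \<boxdot> ?m)"
    "arr C (?U \<boxtimes> ?Y) (?Y \<boxtimes> ?Y) (e' \<boxdot> Idt C ?Y)"
    "arr C ((?Y \<boxtimes> ?Y) \<boxtimes> ?Y) (?Y \<boxtimes> (?Y \<boxtimes> ?Y)) (Asc C ?Y ?Y ?Y)"
    "arr C ((?U \<boxtimes> ?U) \<boxtimes> ?Y) ((?Y \<boxtimes> ?Y) \<boxtimes> ?Y) ((e \<boxdot> e') \<boxdot> Idt C ?Y)"
    "arr C ((?Y \<boxtimes> ?Y) \<boxtimes> ?Y) (?Y \<boxtimes> ?Y) (?m \<boxdot> Idt C ?Y)"
    "arr C (?U \<boxtimes> ?U) (?Y \<boxtimes> ?Y) (e \<boxdot> e')"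
    "arr C (?U \<boxtimes> ?U) ?U (RUn C ?U)"
    "arr C ((?U \<boxtimes> ?U) \<boxtimes> ?Y) (?U \<boxtimes> ?Y) (RUn C ?U \<boxdot> Idt C ?Y)"
    "arr C (?U \<boxtimes> ?Y) (?Y \<boxtimes> ?Y) (mon_unt B \<boxdot> Idt C ?Y)"
    "arr C (?U \<boxtimes> ?Y) ?Y (LUn C ?Y)"
    "arr C (?Y \<boxtimes> (?Y \<boxtimes> ?Y)) ?Y (?m \<cdot> (Idt C ?Y \<boxdot> ?m))"
    "arr C (?U \<boxtimes> (?U \<boxtimes> ?Y)) (?Y \<boxtimes> ?Y) (e \<boxdot> L')"
    "arr C ?Y ?Y (Idt C ?Y)"
    "arr C ((?U \<boxtimes> ?U) \<boxtimes> ?Y) (?U \<boxtimes> ?Y) K"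
    unfolding K_def by (rule arr ty)+
  have nat': "Asc C ?Y ?Y ?Y \<cdot> ((e \<boxdot> e') \<boxdot> Idt C ?Y) = (e \<boxdot> (e' \<boxdot> Idt C ?Y)) \<cdot> Asc C ?U ?U ?Y"
    using Asc_natural[OF Unt_in b(1) Unt_in b(1) b(1) b(1)] e e' c(17) unfolding arr_def by blast
  have eL': "e \<boxdot> L' = (Idt C ?Y \<boxdot> ?m) \<cdot> (e \<boxdot> (e' \<boxdot> Idt C ?Y))"
    by (simp only: L'_def interchange[OF e c(17) c(6) b(2)] id_left[OF e])
  \<comment> \<open>Multiplying by \<open>e'\<close> and then by \<open>e\<close> is multiplying by
    \<open>e e' = 1\<close>; only unit isomorphisms remain.\<close>
  have "L \<cdot> K = (?m \<cdot> (e \<boxdot> L')) \<cdot> Asc C ?U ?U ?Y"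
    unfolding K_def assoc[OF c(1) c(2) L, symmetric]
    unfolding L_def by (simp only: assoc[OF c(2) c(3) b(2)] THom_right_left[OF e L'])
  also have "\<dots> = (?m \<cdot> (Idt C ?Y \<boxdot> ?m) \<cdot> Asc C ?Y ?Y ?Y) \<cdot> ((e \<boxdot> e') \<boxdot> Idt C ?Y)"
    by (simp only: eL' assoc[OF c(4) c(5) b(2), symmetric] assoc[OF c(1) c(4) c(15)] nat'[symmetric]
        assoc[OF c(8) c(7) c(15)])
  also have "\<dots> = ?m \<cdot> ((?m \<cdot> (e \<boxdot> e')) \<boxdot> Idt C ?Y)"
    by (simp only: b(4)[symmetric] assoc[OF c(8) c(9) b(2)] THom_Cmp_left[OF c(10) b(2) b(1)])
  also have "\<dots> = LUn C ?Y \<cdot> (RUn C ?U \<boxdot> Idt C ?Y)"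
    by (simp only: e_def inv THom_Cmp_left[OF c(11) b(3) b(1), symmetric]
        assoc[OF c(12) c(13) b(2), symmetric] b(5))
  finally have LK: "L \<cdot> K = LUn C ?Y \<cdot> (RUn C ?U \<boxdot> Idt C ?Y)" .
  obtain l where l: "arr C ?Y (?U \<boxtimes> ?Y) l" "LUn C ?Y \<cdot> l = Idt C ?Y"
    using LUn_iso[OF b(1)] c(14) unfolding is_iso_def arr_def by blast
  obtain r where r: "arr C ?U (?U \<boxtimes> ?U) r" "RUn C ?U \<cdot> r = Idt C ?U"
    using RUn_iso[OF Unt_in] c(11) unfolding is_iso_def arr_def by blast
  \<comment> \<open>\<open>J\<close> inserts the two unit factors, so that
    \<open>K \<cdot> J\<close> becomes a right inverse of \<open>L\<close>.\<close>
  define J where "J = (r \<boxdot> Idt C ?Y) \<cdot> l"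
  have d: "arr C (?U \<boxtimes> ?Y) ((?U \<boxtimes> ?U) \<boxtimes> ?Y) (r \<boxdot> Idt C ?Y)"
    "arr C ?Y ((?U \<boxtimes> ?U) \<boxtimes> ?Y) J" "arr C ?Y (?U \<boxtimes> ?Y) (K \<cdot> J)"
    "arr C (?Q \<boxtimes> ?Y) (?Q \<boxtimes> (?U \<boxtimes> ?Y)) (Idt C ?Q \<boxdot> (K \<cdot> J))"
    unfolding J_def by (rule arr ty r l c)+
  have "L \<cdot> (K \<cdot> J) = LUn C ?Y \<cdot> (((RUn C ?U \<boxdot> Idt C ?Y) \<cdot> (r \<boxdot> Idt C ?Y)) \<cdot> l)"
    unfolding assoc[OF d(2) c(18) L, symmetric] LK assoc[OF d(2) c(12) c(14)]
    by (simp only: J_def assoc[OF l(1) d(1) c(12)])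
  also have "\<dots> = Idt C ?Y"
    by (simp only: THom_Cmp_left[OF r(1) c(11) b(1)] r(2) THom_Idt[OF Unt_in b(1)] id_left[OF l(1)] l(2))
  finally have LKJ: "L \<cdot> (K \<cdot> J) = Idt C ?Y" .
  have "g = g \<cdot> (Idt C ?Q \<boxdot> (L \<cdot> (K \<cdot> J)))" by (simp only: LKJ THom_Idt[OF m(1) b(1)] id_right[OF g])
  also have "\<dots> = (g \<cdot> (Idt C ?Q \<boxdot> L)) \<cdot> (Idt C ?Q \<boxdot> (K \<cdot> J))"
    by (simp only: THom_Cmp_right[OF d(3) L m(1), symmetric] assoc[OF d(4) a(7) g])
  also have "\<dots> = Zer C (?Q \<boxtimes> ?Y) W" by (simp only: gL Zer_Cmp[OF d(4) Wo])
  finally show ?thesis .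
qed

end

section \<open>Zero modules\<close>

context relative_geometry
begin

lemma zero_moduleI:
  assumes "B \<in> Obj (Comm C)" "N \<in> Obj (ModCat C B)"
    and "Idt C (mod_obj N) = Zer C (mod_obj N) (mod_obj N)"
  shows "is_zero_object (ModCat C B) N"
  using preadditive_category.zero_objectI[OF preadditive_ModCat[OF assms(1)] assms(2)] assms(3)
  by (simp add: ModCat_def)

text \<open>Every diagram ending in a zero object commutes, so the zero action satisfies the module
  axioms. The module is the witness from which the choice in \<open>base_change_pair\<close> is
  controlled.\<close>

lemma zero_module_exists:
  assumes B: "B \<in> Obj (Comm C)"
  obtains N where "N \<in> Obj (ModCat C B)" "is_zero_object C (mod_obj N)"
proof -
  obtain Z where Z: "is_zero_object C Z" using has_zero_object by blast
  then have Zo: "Z \<in> Obj C" unfolding is_zero_object_def by blast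
  note b = comm_monoidD[OF B]
  let ?Y = "mon_obj B"
  have ZY: "Z \<boxtimes> ?Y \<in> Obj C" by (rule arr Zo b)+
  let ?r = "Zer C (Z \<boxtimes> ?Y) Z"
  have r: "arr C (Z \<boxtimes> ?Y) Z ?r" by (rule arr_Zer[OF ZY Zo])
  have "?r \<cdot> (?r \<boxdot> Idt C ?Y) = ?r \<cdot> (Idt C Z \<boxdot> mon_mul B) \<cdot> Asc C Z ?Y ?Y"
    by (rule zero_object_arr_eq(2)[OF Z]) (rule arr r Zo b)+
  moreover have "?r \<cdot> (Idt C Z \<boxdot> mon_unt B) = RUn C Z"
    by (rule zero_object_arr_eq(2)[OF Z]) (rule arr r Zo b)+
  ultimately have "\<lparr>mod_obj = Z, mod_act = ?r\<rparr> \<in> Obj (ModCat C B)"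
    using r Zo by (simp add: ModCat_def is_module_def arr_def)
  with Z show thesis using that by simp
qed

end

context affine_scheme
begin

text \<open>The base change is chosen by \<open>SOME\<close>, so a candidate must exist before the
  choice says anything. A zero module is one, as every coequalizing map vanishes. The chosen
  coequalizer map is itself coequalizing and so vanishes too.\<close>

lemma base_change_eq_zero:
  assumes M: "M \<in> Obj (ModCat C A)"
    and zero: "mod_act M \<cdot> (Idt C (mod_obj M) \<boxdot> (t \<cdot> \<eta>)) = Zer C (mod_obj M \<boxtimes> Unt C) (mod_obj M)"
    and loc: "is_localisation C A t B f" and t: "t \<in> carrier E"
  shows "is_zero_object (ModCat C B) (FObj (base_change C A B f) M)"
proof -
  note B = localisation_arr[OF loc] and m = moduleD[OF M A_in]
  note b = comm_monoidD[OF B(1)]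
  let ?Q = "mod_obj M" and ?\<rho> = "mod_act M" and ?Y = "mon_obj B" and ?m = "mon_mul B"
  let ?S = "(?Q \<boxtimes> X) \<boxtimes> ?Y" and ?T = "?Q \<boxtimes> ?Y"
  define u where "u = ?\<rho> \<boxdot> Idt C ?Y"
  define v where "v = (Idt C ?Q \<boxdot> (?m \<cdot> (f \<boxdot> Idt C ?Y))) \<cdot> Asc C ?Q X ?Y"
  have So: "?S \<in> Obj C" and To: "?T \<in> Obj C" by (rule arr m b A_obj)+
  have uv: "arr C ?S ?T u" "arr C ?S ?T v"
    unfolding u_def v_def by (rule arr m(2) b(1,2) B(2) A_obj | rule m(1))+
  note killed = coequalizing_arr_eq_Zer[OF M zero loc t, folded u_def v_def]
  obtain N0 where N0: "N0 \<in> Obj (ModCat C B)" "is_zero_object C (mod_obj N0)"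
    using zero_module_exists[OF B(1)] .
  note n0 = moduleD[OF N0(1) B(1)]
  let ?z = "Zer C ?T (mod_obj N0)"
  have z: "arr C ?T (mod_obj N0) ?z" by (rule arr_Zer[OF To n0(1)])
  have "is_coequalizer C ?S ?T u v (mod_obj N0) ?z"
    unfolding is_coequalizer_def
  proof (intro conjI ballI impI)
    show "?z \<cdot> u = ?z \<cdot> v" by (simp only: Zer_Cmp[OF uv(1) n0(1)] Zer_Cmp[OF uv(2) n0(1)])
    fix W g assume "W \<in> Obj C" "g \<in> Hom C ?T W" "g \<cdot> u = g \<cdot> v"
    then have W: "W \<in> Obj C" and g: "arr C ?T W g" "g \<cdot> u = g \<cdot> v" using To unfolding arr_def by auto
    have gz: "g = Zer C ?T W" by (rule killed[OF g])
    show "\<exists>!h. h \<in> Hom C (mod_obj N0) W \<and> h \<cdot> ?z = g"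
    proof (rule ex1I[of _ "Zer C (mod_obj N0) W"], intro conjI)
      show "Zer C (mod_obj N0) W \<in> Hom C (mod_obj N0) W"
        using arr_Zer[OF n0(1) W] unfolding arr_def by blast
      show "Zer C (mod_obj N0) W \<cdot> ?z = g" by (simp only: Zer_Cmp[OF z W] gz)
      fix h assume "h \<in> Hom C (mod_obj N0) W \<and> h \<cdot> ?z = g"
      then have "arr C (mod_obj N0) W h" using n0(1) W unfolding arr_def by blast
      then show "h = Zer C (mod_obj N0) W"
        by (rule zero_object_arr_eq(1)[OF N0(2) _ arr_Zer[OF n0(1) W]])
    qed
  qed (use z in \<open>auto simp: arr_def\<close>)
  moreover have "mod_act N0 \<cdot> (?z \<boxdot> Idt C ?Y) = ?z \<cdot> (Idt C ?Q \<boxdot> ?m) \<cdot> Asc C ?Q ?Y ?Y"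
    by (rule zero_object_arr_eq(2)[OF N0(2)]) (rule arr n0(2) z b(1,2) To m(1))+
  ultimately have "is_base_change_object C A B f M N0 ?z"
    using N0(1) by (simp add: is_base_change_object_def u_def v_def Let_def)
  then have "case (N0, ?z) of (N, q) \<Rightarrow> is_base_change_object C A B f M N q" by (rule case_prodI)
  then have "case base_change_pair C A B f M of (N, q) \<Rightarrow> is_base_change_object C A B f M N q"
    unfolding base_change_pair_def by (rule someI)
  moreover obtain N q where Nq: "base_change_pair C A B f M = (N, q)" by fastforce
  ultimately have N: "N \<in> Obj (ModCat C B)" and co: "is_coequalizer C ?S ?T u v (mod_obj N) q"
    by (simp_all add: is_base_change_object_def u_def v_def Let_def)
  note n = moduleD(1)[OF N B(1)]
  have q: "arr C ?T (mod_obj N) q" and quv: "q \<cdot> u = q \<cdot> v"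
    using co To unfolding is_coequalizer_def arr_def by auto
  have qz: "q = Zer C ?T (mod_obj N)" by (rule killed[OF q quv])
  \<comment> \<open>As \<open>q = 0\<close>, the identity and the zero map both carry
    \<open>q\<close> to \<open>q\<close>; uniqueness makes them equal.\<close>
  have "\<exists>!h. h \<in> Hom C (mod_obj N) (mod_obj N) \<and> h \<cdot> q = q"
    using co n q quv unfolding is_coequalizer_def arr_def by blast
  moreover have "Idt C (mod_obj N) \<cdot> q = q" by (rule id_left[OF q])
  moreover have "Zer C (mod_obj N) (mod_obj N) \<cdot> q = q" by (simp only: Zer_Cmp[OF q n] qz[symmetric])
  moreover have "Idt C (mod_obj N) \<in> Hom C (mod_obj N) (mod_obj N)"
    "Zer C (mod_obj N) (mod_obj N) \<in> Hom C (mod_obj N) (mod_obj N)"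
    using arr_Idt[OF n] arr_Zer[OF n n] unfolding arr_def by auto
  ultimately have "Idt C (mod_obj N) = Zer C (mod_obj N) (mod_obj N)" by blast
  then have "is_zero_object (ModCat C B) N" by (rule zero_moduleI[OF B(1) N])
  then show ?thesis using Nq by (simp add: base_change_def)
qed


section \<open>Ideals with zero quotient\<close>

text \<open>(C1) asks for free modules at all vertices; both vertices of the diagram below are
  \<open>regular A\<close>, of rank 1.\<close>

lemma regular_is_free: "is_free_module C A 1 (regular A)"
proof -
  have "is_copower (ModCat C A) {..<1::nat} (regular A) (regular A) (\<lambda>_. Idt (ModCat C A) (regular A))"
    unfolding is_copower_def
  proof (intro conjI ballI allI impI)
    fix Y and g :: "nat \<Rightarrow> 'm"
    assume Y: "Y \<in> Obj (ModCat C A)" and g: "\<forall>s \<in> {..<1}. g s \<in> Hom (ModCat C A) (regular A) Y"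
    have *: "h \<cdot>\<^bsub>ModCat C A\<^esub> Idt (ModCat C A) (regular A) = h"
      if "h \<in> Hom (ModCat C A) (regular A) Y" for h
      by (rule Modules.Cmp_Idt[OF A_regular Y that])
    show "\<exists>!h. h \<in> Hom (ModCat C A) (regular A) Y \<and>
        (\<forall>s \<in> {..<1}. h \<cdot>\<^bsub>ModCat C A\<^esub> Idt (ModCat C A) (regular A) = g s)"
      by (rule ex1I[of _ "g 0"]) (use g * in auto)
  qed (use A_regular Modules.Idt_in in auto)
  then show ?thesis unfolding is_free_module_def by blast
qed

text \<open>
  (C1) applies to the diagram of the arrows \<open>F\<close> on \<open>A\<close> itself, and there the colimit of the groups
  \<open>Hom(A, A)\<close> is the quotient of \<open>E\<close> by the ideal that \<open>F\<close> generates.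
\<close>

lemma unit_in_subgroup:
  assumes F: "finite F" "F \<subseteq> carrier E"
    and pc: "is_par_colimit (ModCat C A) (regular A) (regular A) F Q p q"
    and Q: "is_zero_object (ModCat C A) Q"
    and H: "subgroup H (add_monoid E)" and FH: "\<And>f g. f \<in> F \<Longrightarrow> g \<in> carrier E \<Longrightarrow> f \<otimes>\<^bsub>E\<^esub> g \<in> H"
  shows "\<one>\<^bsub>E\<^esub> \<in> H"
proof -
  let ?K = "ModCat C A" and ?R = "regular A"
  obtain z :: nat and S \<phi> where S: "finite S" "z \<notin> S" "\<phi> ` S = F"
    using finite_reindex[OF F(1) infinite_UNIV_nat] .
  have \<phi>: "\<phi> ` S \<subseteq> Hom ?K ?R ?R" using S(3) F(2) by (simp add: EndRing_def)
  let ?J = "par_cat 0 (1::nat) z S" and ?D = "par_func ?K 0 z ?R ?R \<phi>"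
  define \<iota> where "\<iota> = (\<lambda>j::nat. if j = 0 then p else q)"
  note par = Modules.category_axioms A_regular A_regular zero_neq_one S(2) \<phi>
  have O: "Obj ?J = {0, 1}" by (simp add: par_cat_def)
  have DO: "FObj ?D j = ?R" for j by (simp add: par_func_def)
  have "finite (arrows ?J)" by (rule finite_subset[OF arrows_par_cat]) (simp add: S(1))
  moreover have "finite (Obj ?J)" by (simp add: par_cat_def)
  ultimately have fc: "finite_cat ?J"
    unfolding finite_cat_def using category_par_cat[OF zero_neq_one S(2)] by blast
  have col: "is_colimit ?J ?K ?D Q \<iota>"
    unfolding is_colimit_par[OF par] using pc S(3) by (simp add: \<iota>_def)
  have iso: "Hom_ab_preserves_finite_colimit ?J ?K ?R ?D Q \<iota>"
    by (rule C1_free[OF A_in fc is_functor_par_func[OF par] _ col])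
      (use regular_is_free DO in metis)
  define G where "G = Hom_sum ?J ?K ?D ?R"
  define N where "N = Hom_sum_rel ?J ?K ?D ?R"
  define e where "e = Hom_sum_inj ?J ?K ?D ?R"
  define P where "P = add_monoid E"
  have P [simp]: "group P" "carrier P = carrier E" "monoid.mult P = ring.add E" "\<one>\<^bsub>P\<^esub> = \<zero>\<^bsub>E\<^esub>"
    using E.a_group unfolding P_def by simp_all
  interpret H: subgroup H P unfolding P_def by (rule H)
  have G: "G = sum_group {0, 1} (\<lambda>_. P)"
    by (simp only: G_def Hom_sum_def O DO P_def add_monoid_EndRing)
  interpret G: group G unfolding G by simp
  have cG: "carrier G = {0, 1} \<rightarrow>\<^sub>E carrier E"
    unfolding G by (subst carrier_sum_group) auto
  have Zer_K: "Zer ?K ?R ?R = \<zero>\<^bsub>E\<^esub>" by (simp add: EndRing_def ModCat_def regular_def)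
  have e: "e j g = (\<lambda>i \<in> {0, 1}. if i = j then g else \<zero>\<^bsub>E\<^esub>)" for j g
    unfolding e_def Hom_sum_inj_def O DO Zer_K ..
  have e_in: "e j g \<in> carrier G" if "g \<in> carrier E" for j g
    unfolding cG e using that by auto
  have mG: "(x \<otimes>\<^bsub>G\<^esub> y) 1 = x 1 \<oplus>\<^bsub>E\<^esub> y 1" for x y by (simp add: G)
  have iG: "(inv\<^bsub>G\<^esub> x) 1 = inv\<^bsub>P\<^esub> (x 1)" if "x \<in> carrier G" for x
    using that unfolding G by (subst inv_sum_group) auto
  have c1: "x 1 \<in> carrier E" if "x \<in> carrier G" for x using that unfolding cG by auto
  \<comment> \<open>Coordinate 1 belongs to the target of the arrows. A relator of an identity is
    trivial, and that of an arrow \<open>u\<close> has \<open>- \<phi> u g\<close> there, which lies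
    in \<open>H\<close>. So \<open>?B\<close> is a subgroup containing all relators.\<close>
  let ?B = "{x \<in> carrier G. x 1 \<in> H}"
  have B: "subgroup ?B G"
  proof (rule G.subgroupI)
    have "\<one>\<^bsub>G\<^esub> \<in> ?B" using H.one_closed G.one_closed by (simp add: G)
    then show "?B \<noteq> {}" by blast
    show "inv\<^bsub>G\<^esub> x \<in> ?B" if "x \<in> ?B" for x
      using that iG[of x] H.m_inv_closed by simp
    show "x \<otimes>\<^bsub>G\<^esub> y \<in> ?B" if "x \<in> ?B" "y \<in> ?B" for x y
      using that mG[of x y] H.m_closed by simp
  qed blast
  have gen: "e j g \<otimes>\<^bsub>G\<^esub> inv\<^bsub>G\<^esub> e k (FHom ?D j k u \<cdot>\<^bsub>?K\<^esub> g) \<in> ?B"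
    if j: "j \<in> {0, 1}" and k: "k \<in> {0, 1}" and u: "u \<in> Hom ?J j k" and g: "g \<in> carrier E" for j k u g
  proof -
    define d where "d = FHom ?D j k u \<cdot>\<^bsub>?K\<^esub> g"
    have g': "arr ?K ?R ?R g" using g EndRing_arr by simp
    consider "j = k" "d = g" | "j = 0" "k = 1" "u \<in> S" "d = \<phi> u \<otimes>\<^bsub>E\<^esub> g"
    proof (cases "j = k")
      case True
      then have "u = z" using u by (simp add: par_cat_def)
      then have "d = g" using Modules.id_left[OF g'] by (simp add: d_def par_func_def)
      then show thesis using that(1) True by blast
    next
      case False
      then have *: "j = 0" "k = 1" "u \<in> S" using u j k by (auto simp: par_cat_def split: if_splits)
      then have "u \<noteq> z" using S(2) by blast
      then have "d = \<phi> u \<otimes>\<^bsub>E\<^esub> g"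
        by (simp add: d_def par_func_def EndRing_simps ModCat_regular_simps)
      then show thesis using that(2) * by blast
    qed
    then show ?thesis unfolding d_def[symmetric]
    proof cases
      case 1
      then have "e j g \<otimes>\<^bsub>G\<^esub> inv\<^bsub>G\<^esub> e k d = \<one>\<^bsub>G\<^esub>" using G.r_inv[OF e_in[OF g]] by simp
      then show "e j g \<otimes>\<^bsub>G\<^esub> inv\<^bsub>G\<^esub> e k d \<in> ?B" using subgroup.one_closed[OF B] by metis
    next
      case 2
      have dH: "d \<in> H" using FH[of "\<phi> u" g] 2 g S(3) by blast
      then have d: "d \<in> carrier E" using H.subset by auto
      have "(e j g \<otimes>\<^bsub>G\<^esub> inv\<^bsub>G\<^esub> e k d) 1 = \<zero>\<^bsub>E\<^esub> \<oplus>\<^bsub>E\<^esub> inv\<^bsub>P\<^esub> d"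
        unfolding mG iG[OF e_in[OF d]] using 2 by (simp add: e)
      moreover have "\<zero>\<^bsub>E\<^esub> \<oplus>\<^bsub>E\<^esub> inv\<^bsub>P\<^esub> d \<in> H"
        using H.m_closed[OF H.one_closed H.m_inv_closed[OF dH]] by simp
      ultimately show "e j g \<otimes>\<^bsub>G\<^esub> inv\<^bsub>G\<^esub> e k d \<in> ?B" using e_in[OF g] e_in[OF d] by simp
    qed
  qed
  have "N \<subseteq> ?B"
    unfolding N_def Hom_sum_rel_def G_def[symmetric] e_def[symmetric] O
  proof (rule G.generate_subgroup_incl[OF _ B])
    show "{e j g \<otimes>\<^bsub>G\<^esub> inv\<^bsub>G\<^esub> e k (FHom ?D j k u \<cdot>\<^bsub>?K\<^esub> g) |j k u g. j \<in> {0, 1} \<and> k \<in> {0, 1} \<and>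
        u \<in> Hom ?J j k \<and> g \<in> Hom ?K ?R (FObj ?D j)} \<subseteq> ?B"
      using gen unfolding DO by (fastforce simp: EndRing_def)
  qed
  \<comment> \<open>The unit at vertex 1 is a relation: \<open>Hom ?K ?R Q\<close> has one element
    because \<open>Q\<close> is zero, and by (C1) \<open>h\<close> is injective, so its coset is the
    trivial one. Its coordinate 1 then puts the unit in \<open>H\<close>.\<close>
  moreover have "e 1 \<one>\<^bsub>E\<^esub> \<in> N"
  proof -
    define h where "h = (\<lambda>c. the_elem ((\<lambda>x. finprod (Hom_group ?K ?R Q) (\<lambda>j. \<iota> j \<cdot>\<^bsub>?K\<^esub> x j) (Obj ?J)) ` c))"
    have "h \<in> iso (G Mod N) (Hom_group ?K ?R Q)"
      using iso unfolding Hom_ab_preserves_finite_colimit_def h_def G_def N_def .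
    then have bij: "bij_betw h (carrier (G Mod N)) (Hom ?K ?R Q)"
      unfolding iso_def Hom_group_def by simp
    have "\<one>\<^bsub>G\<^esub> \<in> N" unfolding N_def Hom_sum_rel_def G_def by (rule generate.one)
    have NG: "N \<subseteq> carrier G" using \<open>N \<subseteq> ?B\<close> by blast
    have x: "e 1 \<one>\<^bsub>E\<^esub> \<in> carrier G" by (rule e_in) simp
    have cosets: "N #>\<^bsub>G\<^esub> e 1 \<one>\<^bsub>E\<^esub> \<in> carrier (G Mod N)" "N #>\<^bsub>G\<^esub> \<one>\<^bsub>G\<^esub> \<in> carrier (G Mod N)"
      using G.rcosetsI[OF NG x] G.rcosetsI[OF NG G.one_closed] by (simp_all only: FactGroup_def partial_object.simps)
    have "\<exists>!a. a \<in> Hom ?K ?R Q" using Q A_regular unfolding is_zero_object_def by blast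
    then have "h (N #>\<^bsub>G\<^esub> e 1 \<one>\<^bsub>E\<^esub>) = h (N #>\<^bsub>G\<^esub> \<one>\<^bsub>G\<^esub>)"
      using bij_betwE[OF bij] cosets by blast
    then have "N #>\<^bsub>G\<^esub> e 1 \<one>\<^bsub>E\<^esub> = N #>\<^bsub>G\<^esub> \<one>\<^bsub>G\<^esub>"
      by (rule inj_onD[OF bij_betw_imp_inj_on[OF bij] _ cosets])
    moreover have "\<one>\<^bsub>G\<^esub> \<otimes>\<^bsub>G\<^esub> e 1 \<one>\<^bsub>E\<^esub> \<in> N #>\<^bsub>G\<^esub> e 1 \<one>\<^bsub>E\<^esub>"
      using \<open>\<one>\<^bsub>G\<^esub> \<in> N\<close> unfolding r_coset_def by blast
    ultimately show ?thesis using G.coset_mult_one[OF NG] G.l_one[OF x] by simp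
  qed
  ultimately show ?thesis by (auto simp: e)
qed

text \<open>This is the subgroup to which \<open>unit_in_subgroup\<close> will be applied. Only the
  additive structure is checked here; that it contains the products of the generators with ring
  elements is the separate hypothesis \<open>FH\<close> there.\<close>

lemma subgroup_linear_combinations:
  assumes I: "finite I" and t: "\<And>i. i \<in> I \<Longrightarrow> t i \<in> carrier E"
  shows "subgroup {\<Oplus>\<^bsub>E\<^esub>i \<in> I. s i \<otimes>\<^bsub>E\<^esub> t i | s. s \<in> I \<rightarrow> carrier E} (add_monoid E)" (is "subgroup ?H _")
proof (rule group.subgroupI[OF E.a_group])
  show "?H \<subseteq> carrier (add_monoid E)" using t by (auto intro!: E.finsum_closed)
  have "(\<lambda>_. \<zero>\<^bsub>E\<^esub>) \<in> I \<rightarrow> carrier E" by simp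
  then show "?H \<noteq> {}" by blast
next
  fix x assume "x \<in> ?H"
  then obtain s where s: "s \<in> I \<rightarrow> carrier E" and x: "x = (\<Oplus>\<^bsub>E\<^esub>i \<in> I. s i \<otimes>\<^bsub>E\<^esub> t i)" by blast
  have st: "(\<lambda>i. s i \<otimes>\<^bsub>E\<^esub> t i) \<in> I \<rightarrow> carrier E" using s t by auto
  \<comment> \<open>Writing \<open>- x\<close> as \<open>(-1) x\<close> makes distributivity over
    finite sums applicable.\<close>
  have "\<ominus>\<^bsub>E\<^esub> x = \<ominus>\<^bsub>E\<^esub> \<one>\<^bsub>E\<^esub> \<otimes>\<^bsub>E\<^esub> x" using E.finsum_closed[OF st] by (simp add: x E.l_minus)
  also have "\<dots> = (\<Oplus>\<^bsub>E\<^esub>i \<in> I. \<ominus>\<^bsub>E\<^esub> \<one>\<^bsub>E\<^esub> \<otimes>\<^bsub>E\<^esub> (s i \<otimes>\<^bsub>E\<^esub> t i))"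
    unfolding x by (rule E.finsum_rdistr[OF I _ st]) simp
  also have "\<dots> = (\<Oplus>\<^bsub>E\<^esub>i \<in> I. \<ominus>\<^bsub>E\<^esub> s i \<otimes>\<^bsub>E\<^esub> t i)"
    by (rule E.finsum_cong') (use s t in \<open>auto simp: E.l_minus Pi_iff\<close>)
  finally have "\<ominus>\<^bsub>E\<^esub> x \<in> ?H" using s by (intro CollectI exI[of _ "\<lambda>i. \<ominus>\<^bsub>E\<^esub> s i"]) auto
  then show "inv\<^bsub>add_monoid E\<^esub> x \<in> ?H" by (simp add: a_inv_def)
next
  fix x y assume "x \<in> ?H" "y \<in> ?H"
  then obtain r s where s: "r \<in> I \<rightarrow> carrier E" "s \<in> I \<rightarrow> carrier E"
    and xy: "x = (\<Oplus>\<^bsub>E\<^esub>i \<in> I. r i \<otimes>\<^bsub>E\<^esub> t i)" "y = (\<Oplus>\<^bsub>E\<^esub>i \<in> I. s i \<otimes>\<^bsub>E\<^esub> t i)" by blast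
  have "x \<oplus>\<^bsub>E\<^esub> y = (\<Oplus>\<^bsub>E\<^esub>i \<in> I. r i \<otimes>\<^bsub>E\<^esub> t i \<oplus>\<^bsub>E\<^esub> s i \<otimes>\<^bsub>E\<^esub> t i)"
    unfolding xy by (rule E.finsum_addf[symmetric]) (use s t in auto)
  also have "\<dots> = (\<Oplus>\<^bsub>E\<^esub>i \<in> I. (r i \<oplus>\<^bsub>E\<^esub> s i) \<otimes>\<^bsub>E\<^esub> t i)"
    by (rule E.finsum_cong') (use s t in \<open>auto simp: E.l_distr Pi_iff\<close>)
  finally show "x \<otimes>\<^bsub>add_monoid E\<^esub> y \<in> ?H"
    using s by (intro CollectI exI[of _ "\<lambda>i. r i \<oplus>\<^bsub>E\<^esub> s i"]) auto
qed

lemma partition_of_unityI: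
  assumes I: "finite I" and t: "\<And>i. i \<in> I \<Longrightarrow> t i \<in> carrier E"
    and loc: "\<And>i. i \<in> I \<Longrightarrow> is_localisation C A (t i) (B i) (l i)"
    and cons: "\<And>M. M \<in> Obj (ModCat C A) \<Longrightarrow>
      (\<And>i. i \<in> I \<Longrightarrow> is_zero_object (ModCat C (B i)) (FObj (base_change C A (B i) (l i)) M)) \<Longrightarrow>
      is_zero_object (ModCat C A) M"
  shows "partition_of_unity C A I t"
proof -
  \<comment> \<open>For empty \<open>I\<close> this leaves \<open>F = {0}\<close> with quotient
    \<open>A\<close>; conservativity then makes \<open>A\<close> zero, and the empty sum is the
    unit.\<close>
  define F where "F = insert (Zer C X X) (t ` I)"
  have F: "finite F" "F \<subseteq> carrier E" "Zer C X X \<in> F"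
    using I t E.zero_closed by (auto simp: F_def EndRing_simps)
  obtain M q where pc: "is_par_colimit C X X F (mod_obj M) (Zer C X (mod_obj M)) q"
    and pcM: "is_par_colimit (ModCat C A) (regular A) (regular A) F M (Zer C X (mod_obj M)) q"
    using quotient_module_exists[OF F] .
  have q: "arr (ModCat C A) (regular A) M q" using pcM unfolding is_par_colimit_def by blast
  then have M: "M \<in> Obj (ModCat C A)" unfolding arr_def by blast
  have zero: "is_zero_object (ModCat C A) M"
  proof (rule cons[OF M])
    fix i assume i: "i \<in> I"
    then have "t i \<in> F" by (simp add: F_def)
    then show "is_zero_object (ModCat C (B i)) (FObj (base_change C A (B i) (l i)) M)"
      by (intro base_change_eq_zero[OF M _ loc[OF i] t[OF i]] killed_element_acts_as_zero[OF M q pc F(1,2)])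
  qed
  let ?H = "{\<Oplus>\<^bsub>E\<^esub>i \<in> I. s i \<otimes>\<^bsub>E\<^esub> t i | s. s \<in> I \<rightarrow> carrier E}"
  note H = subgroup_linear_combinations[of I t, OF I t]
  have "\<one>\<^bsub>E\<^esub> \<in> ?H"
  proof (rule unit_in_subgroup[OF F(1,2) pcM zero H])
    fix f g assume f: "f \<in> F" and g: "g \<in> carrier E"
    show "f \<otimes>\<^bsub>E\<^esub> g \<in> ?H"
    proof (cases "f = \<zero>\<^bsub>E\<^esub>")
      case True
      then show ?thesis using subgroup.one_closed[OF H] g by simp
    next
      case False
      \<comment> \<open>Several indices may give the same \<open>f\<close>; the whole coefficient
        \<open>g\<close> is put on one of them.\<close>
      then obtain i where i: "i \<in> I" "f = t i" using f by (auto simp: F_def EndRing_simps)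
      have "f \<otimes>\<^bsub>E\<^esub> g = g \<otimes>\<^bsub>E\<^esub> t i" using E.m_comm[OF t[OF i(1)] g] i(2) by simp
      also have "\<dots> = (\<Oplus>\<^bsub>E\<^esub>j \<in> I. if i = j then g \<otimes>\<^bsub>E\<^esub> t j else \<zero>\<^bsub>E\<^esub>)"
        by (rule E.finsum_singleton[symmetric, OF i(1) I]) (use g t in auto)
      also have "\<dots> = (\<Oplus>\<^bsub>E\<^esub>j \<in> I. (if i = j then g else \<zero>\<^bsub>E\<^esub>) \<otimes>\<^bsub>E\<^esub> t j)"
        by (rule E.finsum_cong') (use g t in auto)
      finally show ?thesis using g by (intro CollectI exI[of _ "\<lambda>j. if i = j then g else \<zero>\<^bsub>E\<^esub>"]) auto
    qed
  qed
  then obtain s where "s \<in> I \<rightarrow> carrier E" "(\<Oplus>\<^bsub>E\<^esub>i \<in> I. s i \<otimes>\<^bsub>E\<^esub> t i) = \<one>\<^bsub>E\<^esub>" by auto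
  then show ?thesis unfolding partition_of_unity_def using I t by blast
qed

end

theorem proposition2p10:
  fixes C :: "('o, 'm, 'x) tensor_cat_scheme"
    and A :: "('o, 'm) mon"
    and I :: "'i set"
    and t :: "'i \<Rightarrow> 'm"
    and A\<^sub>t :: "'i \<Rightarrow> ('o, 'm) mon"
    and l :: "'i \<Rightarrow> 'm"
  assumes "relative_geometry C TYPE('u)"
    and "A \<in> Obj (Comm C)"
    and "\<And>i. i \<in> I \<Longrightarrow> t i \<in> carrier (EndRing C A)"
    and "\<And>i. i \<in> I \<Longrightarrow> is_localisation C A (t i) (A\<^sub>t i) (l i)"
    and "zariski_open_cover TYPE('u) C A I A\<^sub>t l"
  shows "\<exists>I' \<subseteq> I. finite I' \<and> partition_of_unity C A I' t"
proof -
  interpret affine_scheme C "TYPE('u)" A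
    using assms(1,2) by (simp add: affine_scheme_def affine_scheme_axioms_def)
  obtain I' where I': "I' \<subseteq> I" "finite I'" and cons: "\<And>M. M \<in> Obj (ModCat C A) \<Longrightarrow>
      is_zero_object (ModCat C A) M \<longleftrightarrow>
        (\<forall>i \<in> I'. is_zero_object (ModCat C (A\<^sub>t i)) (FObj (base_change C A (A\<^sub>t i) (l i)) M))"
    using assms(5) unfolding zariski_open_cover_def by blast
  have "partition_of_unity C A I' t"
    by (rule partition_of_unityI[OF I'(2)]) (use I'(1) assms(3,4) cons in blast)+
  with I' show ?thesis by blast
qed

end
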